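(* Let $1<p<\infty$, $1/p+1/q=1$, $-1<\alpha<\infty$. Let $k\in A^q_\alpha$ be not identically zero and let $F$ be the extremal function for $k$. Let $\widehat{k}$ be any positive scalar multiple of $k$ (so that $\widehat{k}$ also has $F$ as extremal function). Let $G\in A^p_\alpha$ and suppose that for some $\delta$ such that $0<\delta<1$ the inequality $$\left\|\mathcal{P}_\alpha\!\left(|G|^p/\overline{G}\right)-\widehat{k}\right\|_{q,\alpha}<\delta$$ is satisfied. Then for $p>2$, $$\|F-G\|_{p,\alpha}<2p^{1/p}\delta^{1/p},$$ and for $p<2$, $$\|F-G\|_{p,\alpha}<2\sqrt2\,(p-1)^{-1/2}\delta^{1/2}.$$
   Context: $\mathbb{D}$ is the open unit disc. For $1<p<\infty$, $\alpha>-1$, the weighted Bergman space $A^p_\alpha$ is the space of analytic functions $f$ in $\mathbb{D}$ with $\|f\|_{p,\alpha}=\left(\int_{\mathbb{D}}|f|^p\,dA_\alpha\right)^{1/p}<\infty$, where $dA_\alpha=(\alpha+1)\pi^{-1}(1-|z|^2)^\alpha\,dA(z)$ and $dA$ is Lebesgue area measure; $L^p_\alpha=L^p(\mathbb{D},dA_\alpha)$. For $k\in A^q_\alpha$ not identically zero, the extremal function for $k$ is the unique $F\in A^p_\alpha$ with $\|F\|_{p,\alpha}=1$ maximizing $\operatorname{Re}\int_{\mathbb{D}}f\overline{k}\,dA_\alpha$ among all $f\in A^p_\alpha$ of norm $1$. $\mathcal{P}_\alpha$ is the Bergman projection: the orthogonal projection of $L^2_\alpha$ onto $A^2_\alpha$,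 which is bounded from $L^s_\alpha$ to $A^s_\alpha$ for every $1<s<\infty$. The expression $|G|^p/\overline{G}=|G|^{p-1}\operatorname{sgn}G$ (with $\operatorname{sgn} w=w/|w|$) is interpreted as $0$ where $G$ vanishes.
   Formalization: The formal statement additionally assumes that G has norm 1 in A^p_α; without this the claim fails, e.g. for G = 0 and a sufficiently small positive multiple of k, where ‖F−G‖ = 1 while both bounds tend to 0 with δ. *)

theory Defs
  imports "HOL-Complex_Analysis.Complex_Analysis"
begin

definition disc_measure :: "real \<Rightarrow> complex measure" where
  "disc_measure \<alpha> = density (restrict_space lborel (ball 0 1))
     (\<lambda>z. ennreal ((\<alpha> + 1) / pi * (1 - (cmod z)\<^sup>2) powr \<alpha>))"

text \<open>
  Elements of the function spaces below are total functions on the complex plane. Only their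
  values on the open unit disc are relevant, since \<^term>\<open>ball 0 1 :: complex set\<close> is the whole
  space of \<^const>\<open>disc_measure\<close>.
\<close>

definition weighted_Lp :: "real \<Rightarrow> real \<Rightarrow> (complex \<Rightarrow> complex) set" where
  "weighted_Lp s \<alpha> = {f. f \<in> borel_measurable (disc_measure \<alpha>) \<and>
     integrable (disc_measure \<alpha>) (\<lambda>z. cmod (f z) powr s)}"

definition bergman_space :: "real \<Rightarrow> real \<Rightarrow> (complex \<Rightarrow> complex) set" where
  "bergman_space s \<alpha> = {f. f holomorphic_on ball 0 1 \<and> f \<in> weighted_Lp s \<alpha>}"

definition weighted_norm :: "real \<Rightarrow> real \<Rightarrow> (complex \<Rightarrow> complex) \<Rightarrow> real" where
  "weighted_norm s \<alpha> f = (\<integral>z. cmod (f z) powr s \<partial>disc_measure \<alpha>) powr (1 / s)"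

definition disc_pairing ::
    "real \<Rightarrow> (complex \<Rightarrow> complex) \<Rightarrow> (complex \<Rightarrow> complex) \<Rightarrow> complex" where
  "disc_pairing \<alpha> f g = (\<integral>z. f z * cnj (g z) \<partial>disc_measure \<alpha>)"

text \<open>
  There is exactly one extremal function as a function on the disc; uniqueness is a consequence
  of strict convexity and not part of the definition.
\<close>

definition is_extremal_for ::
    "real \<Rightarrow> real \<Rightarrow> (complex \<Rightarrow> complex) \<Rightarrow> (complex \<Rightarrow> complex) \<Rightarrow> bool" where
  "is_extremal_for p \<alpha> k F \<longleftrightarrow>
     F \<in> bergman_space p \<alpha> \<and> weighted_norm p \<alpha> F = 1 \<and>
     (\<forall>f\<in>bergman_space p \<alpha>. weighted_norm p \<alpha> f = 1 \<longrightarrow>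
        Re (disc_pairing \<alpha> f k) \<le> Re (disc_pairing \<alpha> F k))"

text \<open>
  The orthogonal projection of \<open>L\<^sup>2\<close> onto the closed subspace of analytic functions. The value
  \<open>0\<close> off the disc only serves to single out one total function.
\<close>

definition bergman_proj_L2 :: "real \<Rightarrow> (complex \<Rightarrow> complex) \<Rightarrow> complex \<Rightarrow> complex" where
  "bergman_proj_L2 \<alpha> u = (THE g. g \<in> bergman_space 2 \<alpha> \<and> (\<forall>z. z \<notin> ball 0 1 \<longrightarrow> g z = 0) \<and>
     (\<forall>f\<in>bergman_space 2 \<alpha>. disc_pairing \<alpha> (\<lambda>z. u z - g z) f = 0))"

text \<open>
  The Bergman projection as a bounded operator from \<open>L\<^sup>s\<close> to the Bergman space with exponent
  \<open>s\<close>, for \<open>1 < s\<close>: the extension by continuity, in the norm with exponent \<open>s\<close>, of the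
  orthogonal projection from the dense subspace \<open>L\<^sup>s \<inter> L\<^sup>2\<close>. The operators obtained for different
  \<open>s\<close> agree on common arguments. The condition that the projections of the \<open>u n\<close> belong to the
  Bergman space is automatic for \<open>1 < s\<close>; it is listed because \<^const>\<open>weighted_norm\<close> is only
  meaningful for functions in \<^const>\<open>weighted_Lp\<close>.
\<close>

definition bergman_proj :: "real \<Rightarrow> real \<Rightarrow> (complex \<Rightarrow> complex) \<Rightarrow> complex \<Rightarrow> complex" where
  "bergman_proj s \<alpha> h = (THE g. g \<in> bergman_space s \<alpha> \<and> (\<forall>z. z \<notin> ball 0 1 \<longrightarrow> g z = 0) \<and>
     (\<exists>u :: nat \<Rightarrow> complex \<Rightarrow> complex.
        (\<forall>n. u n \<in> weighted_Lp s \<alpha> \<inter> weighted_Lp 2 \<alpha> \<and>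
             bergman_proj_L2 \<alpha> (u n) \<in> bergman_space s \<alpha>) \<and>
        (\<lambda>n. weighted_norm s \<alpha> (\<lambda>z. u n z - h z)) \<longlonglongrightarrow> 0 \<and>
        (\<lambda>n. weighted_norm s \<alpha> (\<lambda>z. bergman_proj_L2 \<alpha> (u n) z - g z)) \<longlonglongrightarrow> 0))"

end

theory Submission imports Defs begin

text \<open>
  The function \<open>h = |G|\<^sup>p / cnj G\<close> has norm \<open>1\<close> in \<open>L\<^sup>q\<close> and \<open>\<langle>G, h\<rangle> = 1\<close>. Since the projection is
  self-adjoint and fixes analytic functions, \<open>\<langle>f, P h\<rangle> = \<langle>f, h\<rangle>\<close> for every \<open>f\<close> in the Bergman space; so, with
  \<open>d < \<delta>\<close> the distance of \<open>P h\<close> from \<open>c k\<close>, we get \<open>Re \<langle>G, c k\<rangle> \<ge> 1 - d\<close> and \<open>Re \<langle>F, c k\<rangle> \<le> 1 + d\<close>. As \<open>F\<close>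
  is extremal, testing with \<open>(F + G) / 2\<close> gives \<open>\<parallel>(F + G) / 2\<parallel> \<ge> 1 / (1 + d)\<close>, and uniform convexity of \<open>L\<^sup>p\<close>
  (Clarkson for \<open>p > 2\<close>; the sharp inequality \<open>\<parallel>u\<parallel>\<^sup>2 + (p - 1) \<parallel>v\<parallel>\<^sup>2 \<le> 1\<close> for \<open>u \<plusminus> v\<close> of norm \<open>1\<close> and
  \<open>p < 2\<close>) bounds \<open>\<parallel>(F - G) / 2\<parallel>\<close>.

  The projection on \<open>L\<^sup>q\<close> is well defined because the integral operator with the Bergman kernel is bounded:
  the kernel has modulus \<open>|1 - z cnj w| powr (- (\<alpha> + 2))\<close>, the square of a modulus of a power series, so
  Parseval's formula yields the Forelli--Rudin estimate on which Schur's test rests.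
\<close>

section \<open>The weighted area measure: rotations, radial functions, moments\<close>

text \<open>\<open>bergman_proj\<close> is a definite description of a limit of orthogonal
  projections: nothing can be deduced about it until that limit is known to exist and to be
  independent of the approximating sequence, and both facts come from the L^q bound. The work is
  therefore done with an explicit operator, \<open>bergman_op\<close>, given by moments; it is
  identified with the two descriptions only after it is known to be bounded, symmetric and the
  identity on analytic functions. Polar coordinates are never set up. Rotation invariance supplies
  the orthogonality of monomials, and the distribution of the squared modulus supplies their norms.
  Origin of the constants: M = norm of (F + G) / 2 satisfies M \<ge> 1 / (1 + d), hence M^s \<ge> 1
  - s d. Taking s = p in Clarkson's inequality yields the p in the first bound; taking s = 2 in the
  sharp inequality yields the 2 under the root of the second, and its (p - 1)^(-1/2) is the
  coefficient of the half-difference. The leading 2 of both bounds turns (F - G) / 2 back into F -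
  G.\<close>

lemma nn_integral_lborel_complex:
  fixes f :: "complex \<Rightarrow> ennreal"
  assumes [measurable]: "f \<in> borel_measurable borel"
  shows "(\<integral>\<^sup>+z. f z \<partial>lborel) = (\<integral>\<^sup>+y. \<integral>\<^sup>+x. f (Complex x y) \<partial>lborel \<partial>lborel)"
proof -
  have [measurable]: "(\<lambda>p. Complex (fst p) (snd p)) \<in> borel_measurable (borel :: (real \<times> real) measure)"
    by (intro borel_measurable_continuous_onI) (auto intro!: continuous_intros)
  have "lborel = distr (lborel :: (real \<times> real) measure) borel (\<lambda>p. Complex (fst p) (snd p))"
  proof (rule lborel_eqI)
    fix l u :: complex
    assume le: "\<And>b. b \<in> Basis \<Longrightarrow> l \<bullet> b \<le> u \<bullet> b"
    have "(\<lambda>p. Complex (fst p) (snd p)) -` box l u = box (Re l, Im l) (Re u, Im u)"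
      by (auto simp: box_def Basis_complex_def Basis_prod_def)
    then show "emeasure (distr (lborel :: (real \<times> real) measure) borel (\<lambda>p. Complex (fst p) (snd p))) (box l u)
        = (\<Prod>b\<in>Basis. (u - l) \<bullet> b)"
      using le[of 1] le[of \<i>]
      by (simp add: emeasure_distr emeasure_lborel_box_eq Basis_complex_def Basis_prod_def)
  qed simp
  then have "(\<integral>\<^sup>+z. f z \<partial>lborel) = (\<integral>\<^sup>+z. f z \<partial>distr (lborel :: (real \<times> real) measure) borel (\<lambda>p. Complex (fst p) (snd p)))"
    by (rule arg_cong)
  also have "\<dots> = (\<integral>\<^sup>+p. f (Complex (fst p) (snd p)) \<partial>(lborel :: (real \<times> real) measure))"
    by (rule nn_integral_distr) simp_all
  also have "\<dots> = (\<integral>\<^sup>+y. \<integral>\<^sup>+x. f (Complex x y) \<partial>lborel \<partial>lborel)"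
    unfolding lborel_prod[symmetric]
    by (subst lborel_pair.nn_integral_snd[symmetric]) (simp_all add: lborel_prod)
  finally show ?thesis .
qed

text \<open>A shear moves one coordinate by an amount that depends on the other, so the moved
  coordinate has to be the inner variable. Horizontal and vertical shears thus need the two
  different orders of integration.\<close>

lemma nn_integral_lborel_complex':
  fixes f :: "complex \<Rightarrow> ennreal"
  assumes [measurable]: "f \<in> borel_measurable borel"
  shows "(\<integral>\<^sup>+z. f z \<partial>lborel) = (\<integral>\<^sup>+x. \<integral>\<^sup>+y. f (Complex x y) \<partial>lborel \<partial>lborel)"
proof -
  have [measurable]: "(\<lambda>p. Complex (fst p) (snd p)) \<in> borel_measurable (borel :: (real \<times> real) measure)"
    by (intro borel_measurable_continuous_onI) (auto intro!: continuous_intros)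
  have m: "(\<lambda>p. f (Complex (fst p) (snd p))) \<in> borel_measurable (lborel \<Otimes>\<^sub>M lborel)"
    by (simp add: lborel_prod)
  show ?thesis
    using lborel_pair.Fubini'[of "\<lambda>x y. f (Complex x y)"] m
    by (simp add: nn_integral_lborel_complex case_prod_unfold)
qed

lemma nn_integral_lborel_plus:
  fixes f :: "real \<Rightarrow> ennreal"
  assumes [measurable]: "f \<in> borel_measurable borel"
  shows "(\<integral>\<^sup>+x. f (x + t) \<partial>lborel) = (\<integral>\<^sup>+x. f x \<partial>lborel)"
  by (subst (2) lborel_distr_plus[of t, symmetric]) (simp add: nn_integral_distr add.commute)

text \<open>A rotation is a product of three shears, each of which preserves area by Fubini.\<close>

lemma nn_integral_lborel_rotate:
  fixes f :: "complex \<Rightarrow> ennreal"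
  assumes [measurable]: "f \<in> borel_measurable borel"
    and \<omega>: "cmod \<omega> = 1" "Im \<omega> \<noteq> 0"
  shows "(\<integral>\<^sup>+z. f (\<omega> * z) \<partial>lborel) = (\<integral>\<^sup>+z. f z \<partial>lborel)"
proof -
  \<comment> \<open>For \<omega> = cis \<theta> this is - tan (\<theta> / 2); the vertical shear has
    coefficient sin \<theta>. The quotient is where \<open>Im \<omega> \<noteq> 0\<close>
    enters.\<close>
  define a where "a = (Re \<omega> - 1) / Im \<omega>"
  define X where "X z = Complex (Re z + a * Im z) (Im z)" for z
  define Y where "Y z = Complex (Re z) (Im z + Im \<omega> * Re z)" for z
  have [measurable]: "X \<in> borel_measurable borel" "Y \<in> borel_measurable borel"
    unfolding X_def Y_def
    by (intro borel_measurable_continuous_onI; auto intro!: continuous_intros)+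
  have Xinv: "(\<integral>\<^sup>+z. g (X z) \<partial>lborel) = (\<integral>\<^sup>+z. g z \<partial>lborel)"
    if [measurable]: "g \<in> borel_measurable borel" for g :: "complex \<Rightarrow> ennreal"
  proof -
    have [measurable]: "(\<lambda>x. Complex x y) \<in> borel_measurable borel" for y
      by (intro borel_measurable_continuous_onI) (auto intro!: continuous_intros)
    have "(\<integral>\<^sup>+x. g (X (Complex x y)) \<partial>lborel) = (\<integral>\<^sup>+x. g (Complex x y) \<partial>lborel)" for y
      using nn_integral_lborel_plus[of "\<lambda>x. g (Complex x y)" "a * y"] by (simp add: X_def)
    then show ?thesis
      by (simp only: nn_integral_lborel_complex[of "\<lambda>z. g (X z)"] nn_integral_lborel_complex[of g]
          that measurable_compose[OF \<open>X \<in> borel_measurable borel\<close> that])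
  qed
  have Yinv: "(\<integral>\<^sup>+z. g (Y z) \<partial>lborel) = (\<integral>\<^sup>+z. g z \<partial>lborel)"
    if [measurable]: "g \<in> borel_measurable borel" for g :: "complex \<Rightarrow> ennreal"
  proof -
    have [measurable]: "(\<lambda>y. Complex x y) \<in> borel_measurable borel" for x
      by (intro borel_measurable_continuous_onI) (auto intro!: continuous_intros)
    have "(\<integral>\<^sup>+y. g (Y (Complex x y)) \<partial>lborel) = (\<integral>\<^sup>+y. g (Complex x y) \<partial>lborel)" for x
      using nn_integral_lborel_plus[of "\<lambda>y. g (Complex x y)" "Im \<omega> * x"] by (simp add: Y_def)
    then show ?thesis
      by (simp only: nn_integral_lborel_complex'[of "\<lambda>z. g (Y z)"] nn_integral_lborel_complex'[of g]
          that measurable_compose[OF \<open>Y \<in> borel_measurable borel\<close> that])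
  qed
  have sq: "(Re \<omega>)\<^sup>2 + (Im \<omega>)\<^sup>2 = 1"
    using \<omega>(1) by (simp add: cmod_def)
  then have r: "(Re \<omega> - 1) * (Re \<omega> + 1) = - (Im \<omega>)\<^sup>2"
    by (simp add: algebra_simps power2_eq_square)
  have ai: "a * Im \<omega> = Re \<omega> - 1" and aj: "a * (1 + Re \<omega>) = - Im \<omega>"
    using \<omega>(2) r by (auto simp: a_def field_simps power2_eq_square)
  have rot: "\<omega> * z = X (Y (X z))" for z
  proof (rule complex_eqI)
    have "Re (X (Y (X z))) = Re z * (1 + a * Im \<omega>) + Im z * (a * (1 + (1 + a * Im \<omega>)))"
      by (simp add: X_def Y_def algebra_simps)
    then show "Re (\<omega> * z) = Re (X (Y (X z)))"
      using aj by (simp add: ai)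
    have "Im (X (Y (X z))) = Im z * (1 + a * Im \<omega>) + Im \<omega> * Re z"
      by (simp add: X_def Y_def algebra_simps)
    then show "Im (\<omega> * z) = Im (X (Y (X z)))"
      by (simp add: ai)
  qed
  show ?thesis
    unfolding rot using Xinv[of "\<lambda>z. f (X (Y z))"] Yinv[of "\<lambda>z. f (X z)"] Xinv[of f] by simp
qed

lemma space_disc_measure [simp]: "space (disc_measure \<alpha>) = ball 0 1"
  and sets_disc_measure [simp, measurable_cong]:
    "sets (disc_measure \<alpha>) = sets (restrict_space borel (ball 0 1))"
  by (auto simp: disc_measure_def space_restrict_space sets_restrict_space)

lemma measurable_disc_measureI [measurable (raw)]:
  "f \<in> measurable borel N \<Longrightarrow> f \<in> measurable (disc_measure \<alpha>) N"
  using measurable_restrict_space1[of f borel N "ball 0 1"] measurable_cong_sets[OF sets_disc_measure refl]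
  by blast

lemma holomorphic_measurable_disc:
  "f holomorphic_on ball 0 1 \<Longrightarrow> f \<in> borel_measurable (disc_measure \<alpha>)"
  using borel_measurable_continuous_on_restrict[OF holomorphic_on_imp_continuous_on, of f "ball 0 1"]
  by (simp cong: measurable_cong_sets)

abbreviation disc_weight :: "real \<Rightarrow> complex \<Rightarrow> real" where
  "disc_weight \<alpha> z \<equiv> (\<alpha> + 1) / pi * (1 - (cmod z)\<^sup>2) powr \<alpha>"

lemma nn_integral_disc_measure:
  assumes f: "f \<in> borel_measurable (disc_measure \<alpha>)"
  shows "(\<integral>\<^sup>+z. f z \<partial>disc_measure \<alpha>) =
    (\<integral>\<^sup>+z. ennreal (disc_weight \<alpha> z) * f z * indicator (ball 0 1) z \<partial>lborel)"
proof -
  have f': "f \<in> borel_measurable (restrict_space lborel (ball 0 1))"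
    using f by (simp cong: measurable_cong_sets add: sets_restrict_space)
  have w: "(\<lambda>z. ennreal (disc_weight \<alpha> z)) \<in> borel_measurable (restrict_space lborel (ball 0 1))"
    by (rule measurable_restrict_space1) measurable
  show ?thesis
    unfolding disc_measure_def
    by (subst nn_integral_density[OF w f']) (simp add: nn_integral_restrict_space)
qed

lemma disc_measure_rotate:
  assumes \<omega>: "cmod \<omega> = 1" "Im \<omega> \<noteq> 0"
  shows "distr (disc_measure \<alpha>) (disc_measure \<alpha>) (\<lambda>z. \<omega> * z) = disc_measure \<alpha>"
proof (rule measure_eqI)
  have m: "(\<lambda>z. \<omega> * z) \<in> measurable (disc_measure \<alpha>) (disc_measure \<alpha>)"
    unfolding measurable_cong_sets[OF sets_disc_measure sets_disc_measure]
    by (intro measurable_restrict_space3) (auto simp: norm_mult \<omega>)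
  fix A assume "A \<in> sets (distr (disc_measure \<alpha>) (disc_measure \<alpha>) (\<lambda>z. \<omega> * z))"
  then have A: "A \<in> sets (disc_measure \<alpha>)" by simp
  then have A': "A \<subseteq> ball 0 1" and [measurable]: "A \<in> sets borel"
    by (auto simp: sets_restrict_space)
  have "emeasure (distr (disc_measure \<alpha>) (disc_measure \<alpha>) (\<lambda>z. \<omega> * z)) A
      = (\<integral>\<^sup>+z. indicator A z \<partial>distr (disc_measure \<alpha>) (disc_measure \<alpha>) (\<lambda>z. \<omega> * z))"
    using A by (subst nn_integral_indicator) auto
  also have "\<dots> = (\<integral>\<^sup>+z. indicator A (\<omega> * z) \<partial>disc_measure \<alpha>)"
    using A by (intro nn_integral_distr m) auto
  also have "\<dots> = (\<integral>\<^sup>+z. ennreal (disc_weight \<alpha> (\<omega> * z)) * indicator A (\<omega> * z) * indicator (ball 0 1) (\<omega> * z) \<partial>lborel)"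
    by (subst nn_integral_disc_measure) (auto simp: norm_mult \<omega> indicator_def intro!: nn_integral_cong)
  also have "\<dots> = (\<integral>\<^sup>+z. ennreal (disc_weight \<alpha> z) * indicator A z * indicator (ball 0 1) z \<partial>lborel)"
    by (intro nn_integral_lborel_rotate[OF _ \<omega>] borel_measurable_times_ennreal borel_measurable_indicator) auto
  also have "\<dots> = (\<integral>\<^sup>+z. indicator A z \<partial>disc_measure \<alpha>)"
    by (subst nn_integral_disc_measure) auto
  also have "\<dots> = emeasure (disc_measure \<alpha>) A"
    using A by simp
  finally show "emeasure (distr (disc_measure \<alpha>) (disc_measure \<alpha>) (\<lambda>z. \<omega> * z)) A = emeasure (disc_measure \<alpha>) A" .
qed simp

text \<open>A rotation by \<omega> leaves the measure and the radial factor alone and multiplies the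
  integrand by \<open>\<omega> ^ n * cnj \<omega> ^ m\<close>. If this factor is not 1, the integral
  must vanish.\<close>

lemma integral_monomials_orthogonal:
  fixes \<phi> :: "real \<Rightarrow> real"
  assumes [measurable]: "\<phi> \<in> borel_measurable borel" and nm: "n \<noteq> m"
  shows "(\<integral>z. z ^ n * cnj z ^ m * of_real (\<phi> (cmod z)) \<partial>disc_measure \<alpha>) = 0"
proof -
  let ?f = "\<lambda>z. z ^ n * cnj z ^ m * complex_of_real (\<phi> (cmod z))"
  define d where "d = (if n < m then m - n else n - m)"
  \<comment> \<open>With this angle the factor is a quarter turn, \<i> or its conjugate. A half turn
    would give \<omega> = -1 for d = 1, which is excluded by the condition
    \<open>Im \<omega> \<noteq> 0\<close> of the rotation lemma.\<close>
  define \<theta> where "\<theta> = pi / (2 * real d)"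
  define \<omega> where "\<omega> = cis \<theta>"
  have d: "d > 0" using nm by (auto simp: d_def)
  have "0 < \<theta>" using d by (simp add: \<theta>_def)
  moreover have "\<theta> \<le> pi / 2" using d by (simp add: \<theta>_def field_simps)
  ultimately have "sin \<theta> > 0" by (intro sin_gt_zero) (use pi_gt_zero in linarith)+
  then have \<omega>: "cmod \<omega> = 1" "Im \<omega> \<noteq> 0" by (auto simp: \<omega>_def)
  have "\<omega> ^ d = cis (pi / 2)"
  proof -
    have "real d * \<theta> = pi / 2" using d by (simp add: \<theta>_def)
    then show ?thesis by (simp only: \<omega>_def Complex.DeMoivre)
  qed
  then have wd: "\<omega> ^ d = \<i>" by simp
  have w1: "\<omega> * cnj \<omega> = 1" by (simp add: complex_norm_square[symmetric] \<omega>)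
  have ne: "\<omega> ^ n * cnj \<omega> ^ m \<noteq> 1"
  proof
    assume *: "\<omega> ^ n * cnj \<omega> ^ m = 1"
    show False
    proof (cases "n < m")
      case True
      then have m: "m = n + d" by (simp add: d_def)
      have "(\<omega> * cnj \<omega>) ^ n * cnj (\<omega> ^ d) = 1"
        using * by (simp add: m power_add power_mult_distrib mult_ac)
      then show False by (simp add: w1 wd complex_eq_iff)
    next
      case False
      then have n: "n = m + d" using nm by (simp add: d_def)
      have "(\<omega> * cnj \<omega>) ^ m * \<omega> ^ d = 1"
        using * by (simp add: n power_add power_mult_distrib mult_ac)
      then show False by (simp add: w1 wd complex_eq_iff)
    qed
  qed
  have m: "(\<lambda>z. \<omega> * z) \<in> measurable (disc_measure \<alpha>) (disc_measure \<alpha>)"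
    unfolding measurable_cong_sets[OF sets_disc_measure sets_disc_measure]
    by (intro measurable_restrict_space3) (auto simp: norm_mult \<omega>)
  have cm [measurable]: "cnj \<in> borel_measurable borel"
    by (intro borel_measurable_continuous_onI continuous_intros)
  have fm: "?f \<in> borel_measurable (disc_measure \<alpha>)" by measurable
  have "(\<integral>z. ?f z \<partial>disc_measure \<alpha>) = (\<integral>z. ?f z \<partial>distr (disc_measure \<alpha>) (disc_measure \<alpha>) (\<lambda>z. \<omega> * z))"
    by (simp add: disc_measure_rotate[OF \<omega>])
  also have "\<dots> = (\<integral>z. ?f (\<omega> * z) \<partial>disc_measure \<alpha>)"
    by (rule integral_distr[OF m fm])
  also have "\<dots> = (\<integral>z. (\<omega> ^ n * cnj \<omega> ^ m) * ?f z \<partial>disc_measure \<alpha>)"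
    by (simp add: norm_mult \<omega> power_mult_distrib mult_ac)
  also have "\<dots> = (\<omega> ^ n * cnj \<omega> ^ m) * (\<integral>z. ?f z \<partial>disc_measure \<alpha>)"
    by simp
  finally show ?thesis using ne by (simp add: mult_cancel_right1)
qed

text \<open>This replaces polar coordinates for radial integrands. The annulus sqrt x < |z| < 1 has
  area pi (1 - x), so both measures agree on the half-lines above x, and these determine a locally
  finite measure.\<close>

lemma distr_cmod_square:
  "distr (restrict_space lborel (ball (0::complex) 1)) borel (\<lambda>z. (cmod z)\<^sup>2)
    = density lborel (\<lambda>t. ennreal (pi * indicator {0<..<1} t))" (is "?L = ?R")
proof (rule measure_eqI_lessThan)
  have [measurable]: "(\<lambda>z. (cmod z)\<^sup>2) \<in> borel_measurable (restrict_space lborel (ball (0::complex) 1))"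
    by (rule measurable_restrict_space1) measurable
  have L: "emeasure ?L {x<..} = emeasure lborel ({z. x < (cmod z)\<^sup>2} \<inter> ball 0 1)" for x
    by (auto simp: emeasure_distr space_restrict_space emeasure_restrict_space intro!: arg_cong[where f = "emeasure lborel"])
  have R: "emeasure ?R {x<..} = ennreal pi * emeasure lborel ({0<..<1} \<inter> {x<..})" for x :: real
  proof -
    have "emeasure ?R {x<..} = (\<integral>\<^sup>+t. ennreal pi * indicator ({0<..<1} \<inter> {x<..}) t \<partial>lborel)"
      by (subst emeasure_density) (auto intro!: nn_integral_cong simp: indicator_def)
    then show ?thesis by (simp add: nn_integral_cmult)
  qed
  have ball: "emeasure lborel (ball (0::complex) r) = ennreal (pi * r\<^sup>2)" if "0 \<le> r" for r
    using emeasure_ball[OF that, of "0::complex"] by (simp add: eval_unit_ball_vol)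
  fix x :: real
  show eq: "emeasure ?L {x<..} = emeasure ?R {x<..}"
  proof -
    consider "x < 0" | "0 \<le> x" "x < 1" | "1 \<le> x" by linarith
    then show ?thesis
    proof cases
      case 1
      then have "{z. x < (cmod z)\<^sup>2} \<inter> ball 0 1 = ball 0 1"
        by (auto intro: less_le_trans)
      moreover have "{0<..<1} \<inter> {x<..} = {0<..<1::real}" using 1 by auto
      ultimately show ?thesis unfolding L R by (simp add: ball)
    next
      case 2
      have eq: "{z. x < (cmod z)\<^sup>2} \<inter> ball 0 1 = ball 0 1 - cball (0::complex) (sqrt x)"
      proof -
        have "sqrt x < cmod z \<longleftrightarrow> x < (cmod z)\<^sup>2" for z
          using real_sqrt_less_iff[of x "(cmod z)\<^sup>2"] by (simp only: real_sqrt_abs abs_norm_cancel)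
        then show ?thesis
          by (intro set_eqI) (simp only: Int_iff mem_Collect_eq Diff_iff mem_cball dist_0_norm not_le conj_commute)
      qed
      have cb: "emeasure lborel (cball (0::complex) (sqrt x)) = ennreal (pi * x)"
        using emeasure_cball[of "sqrt x" "0::complex"] 2 by (simp add: eval_unit_ball_vol)
      have sub: "cball (0::complex) (sqrt x) \<subseteq> ball 0 1"
      proof -
        have "sqrt x < 1" using 2 by simp
        then show ?thesis by (intro subsetI) (simp only: mem_cball mem_ball dist_0_norm order.strict_trans1)
      qed
      have "emeasure lborel (ball (0::complex) 1 - cball 0 (sqrt x)) = 
          emeasure lborel (ball (0::complex) 1) - emeasure lborel (cball (0::complex) (sqrt x))"
        by (intro emeasure_Diff sub) (simp_all add: cb)
      also have "\<dots> = ennreal pi - ennreal (pi * x)"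
        unfolding cb by (simp add: ball)
      also have "\<dots> = ennreal (pi * (1 - x))"
        using 2 by (subst ennreal_minus) (auto simp: right_diff_distrib)
      finally have *: "emeasure lborel (ball (0::complex) 1 - cball 0 (sqrt x)) = ennreal (pi * (1 - x))" .
      have "{0<..<1} \<inter> {x<..} = {x<..<1::real}" using 2 by auto
      then show ?thesis unfolding L R eq * using 2
        by (simp add: ennreal_mult)
    next
      case 3
      then have "{z. x < (cmod z)\<^sup>2} \<inter> ball 0 1 = {}"
      proof -
        have "(cmod z)\<^sup>2 \<le> 1" if "cmod z < 1" for z
          using that by (simp add: power_le_one)
        then show ?thesis using 3 by force
      qed
      moreover have "{0<..<1} \<inter> {x<..} = ({}::real set)" using 3 by auto
      ultimately show ?thesis unfolding L R by simp
    qed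
  qed
  show "emeasure ?L {x<..} < \<infinity>"
  proof -
    have "emeasure lborel ({z. x < (cmod z)\<^sup>2} \<inter> ball 0 1) \<le> emeasure lborel (ball (0::complex) 1)"
      by (intro emeasure_mono) auto
    then show ?thesis unfolding L by (simp add: ball order.strict_trans1)
  qed
qed auto

lemma nn_integral_disc_radial:
  fixes g :: "real \<Rightarrow> ennreal"
  assumes [measurable]: "g \<in> borel_measurable borel" and \<alpha>: "-1 < \<alpha>"
  shows "(\<integral>\<^sup>+z. g ((cmod z)\<^sup>2) \<partial>disc_measure \<alpha>) =
    (\<integral>\<^sup>+t. ennreal ((\<alpha> + 1) * (1 - t) powr \<alpha>) * g t * indicator {0<..<1} t \<partial>lborel)"
proof -
  let ?B = "restrict_space lborel (ball (0::complex) 1)"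
  have [measurable]: "(\<lambda>z. (cmod z)\<^sup>2) \<in> borel_measurable ?B"
    by (rule measurable_restrict_space1) measurable
  have "(\<integral>\<^sup>+z. g ((cmod z)\<^sup>2) \<partial>disc_measure \<alpha>) =
      (\<integral>\<^sup>+z. (\<lambda>t. ennreal ((\<alpha> + 1) / pi * (1 - t) powr \<alpha>) * g t) ((cmod z)\<^sup>2) \<partial>?B)"
    unfolding disc_measure_def by (subst nn_integral_density) (auto intro!: measurable_restrict_space1)
  also have "\<dots> = (\<integral>\<^sup>+t. ennreal ((\<alpha> + 1) / pi * (1 - t) powr \<alpha>) * g t \<partial>distr ?B borel (\<lambda>z. (cmod z)\<^sup>2))"
    by (subst nn_integral_distr) auto
  also have "\<dots> = (\<integral>\<^sup>+t. ennreal (pi * indicator {0<..<1} t) * (ennreal ((\<alpha> + 1) / pi * (1 - t) powr \<alpha>) * g t) \<partial>lborel)"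
    unfolding distr_cmod_square by (subst nn_integral_density) auto
  also have "\<dots> = (\<integral>\<^sup>+t. ennreal ((\<alpha> + 1) * (1 - t) powr \<alpha>) * g t * indicator {0<..<1} t \<partial>lborel)"
    using \<alpha> by (intro nn_integral_cong) (auto simp: indicator_def mult.assoc[symmetric] ennreal_mult'[symmetric])
  finally show ?thesis .
qed

text \<open>In the variable t = |z|^2 this is Euler's integral of t^n (1 - t)^(\<alpha> -
  \<epsilon>), convergent because \<open>\<epsilon> < \<alpha> + 1\<close>. The value \<epsilon> = 0
  serves the norms of monomials, positive \<epsilon> the Forelli--Rudin estimate.\<close>

lemma nn_integral_disc_moment:
  assumes \<alpha>: "-1 < \<alpha>" and e: "\<epsilon> < \<alpha> + 1"
  shows "(\<integral>\<^sup>+z. ennreal ((cmod z) ^ (2 * n) * (1 - (cmod z)\<^sup>2) powr (- \<epsilon>)) \<partial>disc_measure \<alpha>)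
    = ennreal ((\<alpha> + 1) * Beta (real n + 1) (\<alpha> - \<epsilon> + 1))"
proof -
  have "(\<integral>\<^sup>+z. ennreal ((cmod z) ^ (2 * n) * (1 - (cmod z)\<^sup>2) powr (- \<epsilon>)) \<partial>disc_measure \<alpha>) =
     (\<integral>\<^sup>+t. ennreal ((\<alpha> + 1) * (1 - t) powr \<alpha>) * ennreal (t ^ n * (1 - t) powr (- \<epsilon>)) * indicator {0<..<1} t \<partial>lborel)"
    by (subst nn_integral_disc_radial[symmetric]) (auto simp: power_mult \<alpha>)
  also have "\<dots> = (\<integral>\<^sup>+t. ennreal (indicator {0..1} t * ((\<alpha> + 1) * (t powr (real n + 1 - 1) * (1 - t) powr (\<alpha> - \<epsilon> + 1 - 1)))) \<partial>lborel)"
  proof (rule nn_integral_cong_AE)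
    have "AE t in lborel. t \<noteq> (0::real) \<and> t \<noteq> 1"
      using AE_lborel_singleton[of "0::real"] AE_lborel_singleton[of "1::real"] by eventually_elim auto
    then show "AE t in lborel. ennreal ((\<alpha> + 1) * (1 - t) powr \<alpha>) * ennreal (t ^ n * (1 - t) powr (- \<epsilon>)) * indicator {0<..<1} t
      = ennreal (indicator {0..1} t * ((\<alpha> + 1) * (t powr (real n + 1 - 1) * (1 - t) powr (\<alpha> - \<epsilon> + 1 - 1))))"
      by (rule eventually_mono)
        (use \<alpha> in \<open>auto simp: indicator_def ennreal_mult'[symmetric] powr_realpow powr_diff powr_minus divide_simps\<close>)
  qed
  also have "\<dots> = ennreal ((\<alpha> + 1) * Beta (real n + 1) (\<alpha> - \<epsilon> + 1))"
  proof (rule nn_integral_has_integral_lebesgue)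
    show "((\<lambda>t. (\<alpha> + 1) * (t powr (real n + 1 - 1) * (1 - t) powr (\<alpha> - \<epsilon> + 1 - 1))) has_integral
        (\<alpha> + 1) * Beta (real n + 1) (\<alpha> - \<epsilon> + 1)) {0..1}"
      using has_integral_Beta_real[of "real n + 1" "\<alpha> - \<epsilon> + 1"] e
      by (intro has_integral_mult_right) (auto simp: algebra_simps)
  qed (use \<alpha> in auto)
  finally show ?thesis .
qed

section \<open>The Forelli--Rudin estimate\<close>

lemma binomial_series_neg_powr:
  fixes z :: complex
  assumes "cmod z < 1"
  shows "(\<lambda>n. of_real (pochhammer l n / fact n) * z ^ n) sums (1 - z) powr (- of_real l)"
proof -
  have "(\<lambda>n. ((- of_real l) gchoose n) * (- z) ^ n) sums (1 + (- z)) powr (- of_real l)"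
    by (rule gen_binomial_complex) (use assms in simp)
  moreover have "((- of_real l) gchoose n) * (- z) ^ n = of_real (pochhammer l n / fact n) * z ^ n" for n
  proof -
    have "(- z) ^ n = (-1) ^ n * z ^ n" by (rule power_minus)
    moreover have "(-1) ^ n * (-1) ^ n = (1::complex)" by (simp flip: power_add)
    ultimately show ?thesis
      by (simp add: gbinomial_pochhammer pochhammer_of_real mult_ac)
  qed
  ultimately show ?thesis by simp
qed

lemma binomial_series_neg_powr_real:
  fixes x :: real
  assumes "\<bar>x\<bar> < 1"
  shows "(\<lambda>n. pochhammer l n / fact n * x ^ n) sums (1 - x) powr (- l)"
proof -
  have "(\<lambda>n. ((- l) gchoose n) * (- x) ^ n) sums (1 + (- x)) powr (- l)"
    by (rule gen_binomial_real) (use assms in simp)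
  moreover have "((- l) gchoose n) * (- x) ^ n = pochhammer l n / fact n * x ^ n" for n
  proof -
    have "(- x) ^ n = (-1) ^ n * x ^ n" by (rule power_minus)
    moreover have "(-1) ^ n * (-1) ^ n = (1::real)" by (simp flip: power_add)
    ultimately show ?thesis
      by (simp add: gbinomial_pochhammer mult_ac)
  qed
  ultimately show ?thesis by simp
qed

text \<open>By Euler's limit, \<open>pochhammer y (Suc n)\<close> is asymptotic to n! n^y / Gamma y.
  In the quotient of the two sides the factorials cancel, and the powers of n cancel because a + b =
  2 x; the quotient converges and is therefore bounded.\<close>

lemma pochhammer_square_le:
  fixes x a b :: real
  assumes pos: "0 < x" "0 < a" "0 < b" and sum: "a + b = 2 * x"
  obtains C where "0 < C" "\<And>n. (pochhammer x n)\<^sup>2 \<le> C * (pochhammer a n * pochhammer b n)"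
proof -
  define f where "f n = (rGamma_series x n)\<^sup>2 / (rGamma_series a n * rGamma_series b n)" for n
  have nz: "rGamma y \<noteq> 0" if "0 < y" for y :: real
    using that by (auto simp: rGamma_eq_zero_iff elim!: nonpos_Ints_cases)
  have "f \<longlonglongrightarrow> (rGamma x)\<^sup>2 / (rGamma a * rGamma b)"
    unfolding f_def using nz[OF pos(2)] nz[OF pos(3)] by (intro tendsto_intros rGamma_series_LIMSEQ) auto
  then have "Bseq f" by (intro convergent_imp_Bseq) (auto simp: convergent_def)
  then obtain K where K: "0 < K" "\<And>n. \<bar>f n\<bar> \<le> K" by (auto simp: Bseq_def)
  have f: "f n = (pochhammer x (Suc n))\<^sup>2 / (pochhammer a (Suc n) * pochhammer b (Suc n))" for n
  proof -
    let ?L = "ln (real n)"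
    have e: "exp (a * ?L) * exp (b * ?L) = (exp (x * ?L))\<^sup>2"
      unfolding exp_add[symmetric] power2_eq_square by (simp flip: distrib_right add: sum)
    have "f n = ((pochhammer x (Suc n))\<^sup>2 / ((fact n)\<^sup>2 * (exp (x * ?L))\<^sup>2)) /
        ((pochhammer a (Suc n) * pochhammer b (Suc n)) / ((fact n)\<^sup>2 * (exp (a * ?L) * exp (b * ?L))))"
      by (simp add: f_def rGamma_series_def power_divide power_mult_distrib power2_eq_square mult_ac)
    then show ?thesis unfolding e by simp
  qed
  show ?thesis
  proof
    \<comment> \<open>\<open>rGamma_series\<close> at m involves \<open>pochhammer\<close> at
      \<open>Suc m\<close>, so the bound K says nothing about index 0. There all Pochhammer symbols
      are 1, whence the maximum with 1.\<close>
    show "0 < max 1 K" by simp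
    fix n
    show "(pochhammer x n)\<^sup>2 \<le> max 1 K * (pochhammer a n * pochhammer b n)"
    proof (cases n)
      case (Suc m)
      have pp: "0 < pochhammer a n * pochhammer b n" using pos by (intro mult_pos_pos pochhammer_pos)
      have "(pochhammer x n)\<^sup>2 / (pochhammer a n * pochhammer b n) \<le> max 1 K"
        using abs_le_D1[OF K(2)[of m]] f[of m] Suc by simp
      then show ?thesis using pp by (simp add: divide_le_eq)
    qed simp
  qed
qed

text \<open>For a polynomial the squared modulus is a finite double sum, which may be integrated
  term by term; orthogonality leaves the diagonal.\<close>

lemma finite_parseval_radial:
  fixes \<phi> :: "real \<Rightarrow> real"
  assumes [measurable]: "\<phi> \<in> borel_measurable borel" and nonneg: "\<And>x. 0 \<le> \<phi> x"
    and m: "\<And>n. (\<integral>\<^sup>+z. ennreal (cmod z ^ (2 * n) * \<phi> (cmod z)) \<partial>disc_measure \<alpha>) = ennreal (m n)"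
    and m0: "\<And>n. 0 \<le> m n"
  shows "(\<integral>\<^sup>+z. ennreal ((cmod (\<Sum>n<N. a n * z ^ n))\<^sup>2 * \<phi> (cmod z)) \<partial>disc_measure \<alpha>)
    = ennreal (\<Sum>n<N. (cmod (a n))\<^sup>2 * m n)"
proof -
  let ?M = "disc_measure \<alpha>"
  let ?e = "\<lambda>n k z. z ^ n * cnj z ^ k * complex_of_real (\<phi> (cmod z))"
  have cm [measurable]: "cnj \<in> borel_measurable borel"
    by (intro borel_measurable_continuous_onI continuous_intros)
  have i: "integrable ?M (\<lambda>z. cmod z ^ (2 * n) * \<phi> (cmod z))" for n
    by (rule integrableI_nonneg) (use nonneg m in auto)
  have v: "(\<integral>z. cmod z ^ (2 * n) * \<phi> (cmod z) \<partial>?M) = m n" for n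
    by (subst integral_eq_nn_integral) (use nonneg m m0 in auto)
  have ie: "integrable ?M (?e n k)" for n k
  proof (rule Bochner_Integration.integrable_bound[OF i[of 0]])
    show "AE z in ?M. cmod (?e n k z) \<le> norm (cmod z ^ (2 * 0) * \<phi> (cmod z))"
    proof (rule AE_I2)
      fix z assume "z \<in> space ?M"
      then have "cmod z ^ n * cmod z ^ k \<le> 1"
        by (simp flip: power_add add: power_le_one)
      then show "cmod (?e n k z) \<le> norm (cmod z ^ (2 * 0) * \<phi> (cmod z))"
        using nonneg[of "cmod z"] mult_right_mono[of "cmod z ^ n * cmod z ^ k" 1 "\<phi> (cmod z)"]
        by (simp add: norm_mult norm_power)
    qed
  qed measurable
  have ve: "(\<integral>z. ?e n k z \<partial>?M) = (if n = k then of_real (m n) else 0)" for n k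
  proof (cases "n = k")
    case True
    have "z ^ n * cnj z ^ n = of_real (cmod z ^ (2 * n))" for z
      by (simp only: power_mult power_mult_distrib[symmetric] complex_norm_square[symmetric] of_real_power)
    then have "?e n n z = complex_of_real (cmod z ^ (2 * n) * \<phi> (cmod z))" for z by simp
    then have "(\<integral>z. ?e n n z \<partial>?M) = complex_of_real (\<integral>z. cmod z ^ (2 * n) * \<phi> (cmod z) \<partial>?M)"
      by (simp only: integral_complex_of_real)
    then show ?thesis using True by (simp only: v simp_thms if_True)
  qed (simp add: integral_monomials_orthogonal)
  have sq: "complex_of_real ((cmod (\<Sum>n<N. a n * z ^ n))\<^sup>2 * \<phi> (cmod z)) = 
      (\<Sum>n<N. \<Sum>k<N. (a n * cnj (a k)) * ?e n k z)" for z
    unfolding of_real_mult complex_norm_square cnj_sum sum_product unfolding sum_distrib_right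
    by (intro sum.cong refl) (simp add: mult_ac)
  have isq: "integrable ?M (\<lambda>z. complex_of_real ((cmod (\<Sum>n<N. a n * z ^ n))\<^sup>2 * \<phi> (cmod z)))"
    unfolding sq by (intro Bochner_Integration.integrable_sum integrable_mult_right ie)
  have "complex_of_real (\<integral>z. (cmod (\<Sum>n<N. a n * z ^ n))\<^sup>2 * \<phi> (cmod z) \<partial>?M)
      = (\<Sum>n<N. \<Sum>k<N. (a n * cnj (a k)) * (if n = k then of_real (m n) else 0))"
    unfolding integral_complex_of_real[symmetric] sq
    by (subst Bochner_Integration.integral_sum)
      (auto intro!: Bochner_Integration.integrable_sum ie sum.cong
        simp: Bochner_Integration.integral_sum ie ve simp del: mult_eq_0_iff)
  also have "\<dots> = complex_of_real (\<Sum>n<N. (cmod (a n))\<^sup>2 * m n)"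
    by (simp add: if_distrib[of "\<lambda>x. _ * x"] sum.delta complex_norm_square cong: if_cong del: of_real_power)
  finally have "(\<integral>z. (cmod (\<Sum>n<N. a n * z ^ n))\<^sup>2 * \<phi> (cmod z) \<partial>?M) = (\<Sum>n<N. (cmod (a n))\<^sup>2 * m n)"
    by (simp only: of_real_eq_iff)
  moreover have "integrable ?M (\<lambda>z. (cmod (\<Sum>n<N. a n * z ^ n))\<^sup>2 * \<phi> (cmod z))"
    using isq by (simp only: complex_of_real_integrable_eq)
  ultimately show ?thesis
    using nonneg by (subst nn_integral_eq_integral) auto
qed

text \<open>Only an upper bound is wanted, so Fatou's lemma applied to the partial sums suffices and
  no interchange of limit and integral has to be justified.\<close>

lemma parseval_radial_le:
  fixes \<phi> :: "real \<Rightarrow> real"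
  assumes \<phi>: "\<phi> \<in> borel_measurable borel" and nonneg: "\<And>x. 0 \<le> \<phi> x"
    and m: "\<And>n. (\<integral>\<^sup>+z. ennreal (cmod z ^ (2 * n) * \<phi> (cmod z)) \<partial>disc_measure \<alpha>) = ennreal (m n)"
    and m0: "\<And>n. 0 \<le> m n"
    and S: "\<And>z. cmod z < 1 \<Longrightarrow> (\<lambda>n. a n * z ^ n) sums S z"
    and bd: "\<And>N. (\<Sum>n<N. (cmod (a n))\<^sup>2 * m n) \<le> B"
  shows "(\<integral>\<^sup>+z. ennreal ((cmod (S z))\<^sup>2 * \<phi> (cmod z)) \<partial>disc_measure \<alpha>) \<le> ennreal B"
proof -
  note [measurable] = \<phi>
  let ?p = "\<lambda>N z. (cmod (\<Sum>n<N. a n * z ^ n))\<^sup>2 * \<phi> (cmod z)"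
  have "(\<integral>\<^sup>+z. ennreal ((cmod (S z))\<^sup>2 * \<phi> (cmod z)) \<partial>disc_measure \<alpha>)
      = (\<integral>\<^sup>+z. liminf (\<lambda>N. ennreal (?p N z)) \<partial>disc_measure \<alpha>)"
  proof (rule nn_integral_cong)
    fix z assume "z \<in> space (disc_measure \<alpha>)"
    then have "(\<lambda>N. \<Sum>n<N. a n * z ^ n) \<longlonglongrightarrow> S z" using S[of z] by (simp add: sums_def)
    then have "(\<lambda>N. ennreal (?p N z)) \<longlonglongrightarrow> ennreal ((cmod (S z))\<^sup>2 * \<phi> (cmod z))"
      by (intro tendsto_intros tendsto_ennrealI)
    then show "ennreal ((cmod (S z))\<^sup>2 * \<phi> (cmod z)) = liminf (\<lambda>N. ennreal (?p N z))"
      by (simp add: lim_imp_Liminf)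
  qed
  also have "\<dots> \<le> liminf (\<lambda>N. \<integral>\<^sup>+z. ennreal (?p N z) \<partial>disc_measure \<alpha>)"
    by (rule nn_integral_liminf) measurable
  also have "\<dots> = liminf (\<lambda>N. ennreal (\<Sum>n<N. (cmod (a n))\<^sup>2 * m n))"
    by (simp only: finite_parseval_radial[OF \<phi> nonneg m m0])
  also have "\<dots> \<le> liminf (\<lambda>N::nat. ennreal B)"
    by (intro Liminf_mono always_eventually allI ennreal_leI bd)
  also have "\<dots> = ennreal B" by (simp add: Liminf_const)
  finally show ?thesis .
qed

lemma Beta_disc_moment:
  assumes \<alpha>: "-1 < \<alpha>" and e: "\<epsilon> < \<alpha> + 1"
  shows "(\<alpha> + 1) * Beta (real n + 1) (\<alpha> - \<epsilon> + 1)
    = (\<alpha> + 1) / (\<alpha> + 1 - \<epsilon>) * (fact n / pochhammer (\<alpha> + 2 - \<epsilon>) n)"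
proof -
  define b where "b = \<alpha> + 2 - \<epsilon>"
  have b: "1 < b" using assms by (auto simp: b_def)
  have bn: "b \<notin> \<int>\<^sub>\<le>\<^sub>0" and b1: "b - 1 \<notin> \<int>\<^sub>\<le>\<^sub>0" using b by (auto elim!: nonpos_Ints_cases)
  have "Gamma (b + real n) = pochhammer b n * Gamma b"
    using pochhammer_Gamma[OF bn, of n] bn by (simp add: Gamma_eq_zero_iff)
  moreover have "Gamma b = (b - 1) * Gamma (b - 1)"
    using Gamma_plus1[OF b1] by simp
  moreover have "Gamma (b - 1) \<noteq> 0" using b1 by (simp add: Gamma_eq_zero_iff)
  moreover have "real n + 1 + (b - 1) = b + real n" by simp
  ultimately have "Beta (real n + 1) (b - 1) = fact n / ((b - 1) * pochhammer b n)"
    using Gamma_fact[of n, where ?'a = real] b pochhammer_pos[of b n]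
    by (simp add: Beta_def add.commute divide_simps)
  then show ?thesis by (simp add: b_def algebra_simps)
qed

text \<open>Put l = (\<alpha> + 2) / 2 and b = \<alpha> + 2 - \<epsilon>. The coefficients of (1 -
  cnj z w)^(-l) contribute (l)_n^2 |z|^(2n) / n!^2, the moments a constant times n! / (b)_n. As
  \<epsilon> + b = 2 l, \<open>pochhammer_square_le\<close> replaces (l)_n^2 by a multiple of
  (\<epsilon>)_n (b)_n. What remains is (\<epsilon>)_n |z|^(2n) / n!, the series of (1 - |z|^2)^(-
  \<epsilon>).\<close>

lemma forelli_rudin:
  assumes \<alpha>: "-1 < \<alpha>" and \<epsilon>: "0 < \<epsilon>" "\<epsilon> < \<alpha> + 1"
  obtains C where "0 < C" 
    "\<And>z. cmod z < 1 \<Longrightarrow>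
      (\<integral>\<^sup>+w. ennreal (cmod (1 - z * cnj w) powr (-(\<alpha> + 2)) * (1 - (cmod w)\<^sup>2) powr (- \<epsilon>)) \<partial>disc_measure \<alpha>)
      \<le> ennreal (C * (1 - (cmod z)\<^sup>2) powr (- \<epsilon>))"
proof -
  define l where "l = (\<alpha> + 2) / 2"
  define b where "b = \<alpha> + 2 - \<epsilon>"
  have l: "0 < l" and b: "1 < b" using assms by (auto simp: l_def b_def)
  obtain C where C: "0 < C" "\<And>n. (pochhammer l n)\<^sup>2 \<le> C * (pochhammer \<epsilon> n * pochhammer b n)"
    by (rule pochhammer_square_le[of l \<epsilon> b]) (use l b assms in \<open>auto simp: l_def b_def\<close>)
  define D where "D = C * (\<alpha> + 1) / (b - 1)"
  have D: "0 < D" using C \<alpha> b by (simp add: D_def)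
  define m where "m n = (\<alpha> + 1) * Beta (real n + 1) (\<alpha> - \<epsilon> + 1)" for n
  have bm: "m n = (\<alpha> + 1) / (b - 1) * (fact n / pochhammer b n)" for n
    using Beta_disc_moment[OF \<alpha> \<epsilon>(2), of n] by (simp add: m_def b_def algebra_simps)
  have m0: "0 \<le> m n" for n
    using b \<alpha> pochhammer_pos[of b n] by (simp add: bm)
  have norm_pow: "cmod (u powr (- complex_of_real l)) ^ 2 = cmod u powr (-(\<alpha> + 2))" for u
  proof -
    have "cmod (u powr (- complex_of_real l)) = cmod u powr (- l)"
      by (subst norm_powr_real_powr') auto
    then show ?thesis 
      by (simp add: power2_eq_square powr_add[symmetric] l_def)
  qed
  show ?thesis
  proof
    show "0 < D" by (rule D)
    fix z :: complex assume z: "cmod z < 1"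
    define a where "a n = complex_of_real (pochhammer l n / fact n) * cnj z ^ n" for n
    have "(\<integral>\<^sup>+w. ennreal ((cmod ((1 - cnj z * w) powr (- complex_of_real l)))\<^sup>2 * (1 - (cmod w)\<^sup>2) powr (- \<epsilon>)) \<partial>disc_measure \<alpha>)
      \<le> ennreal (D * (1 - (cmod z)\<^sup>2) powr (- \<epsilon>))"
    proof (rule parseval_radial_le[where m = m and a = a])
      show "(\<integral>\<^sup>+ z. ennreal (cmod z ^ (2 * n) * (1 - (cmod z)\<^sup>2) powr - \<epsilon>) \<partial>disc_measure \<alpha>) = ennreal (m n)" for n
        unfolding m_def by (rule nn_integral_disc_moment) (use assms in auto)
      show "(\<lambda>n. a n * w ^ n) sums (1 - cnj z * w) powr (- complex_of_real l)" if "cmod w < 1" for w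
      proof -
        have "cmod (cnj z * w) < 1"
          using mult_strict_mono[of "cmod z" 1 "cmod w" 1] that z by (simp add: norm_mult)
        from binomial_series_neg_powr[OF this] show ?thesis by (simp add: a_def power_mult_distrib mult_ac)
      qed
      fix N
      have "\<bar>(cmod z)\<^sup>2\<bar> < 1" using z by (simp add: power_less_one_iff abs_square_less_1)
      note s = binomial_series_neg_powr_real[OF this, of \<epsilon>]
      have le: "(cmod (a n))\<^sup>2 * m n \<le> D * (pochhammer \<epsilon> n / fact n * ((cmod z)\<^sup>2) ^ n)" for n
      proof -
        have pb: "0 < pochhammer b n" using b by (simp add: pochhammer_pos)
        have "(cmod (a n))\<^sup>2 * m n = (pochhammer l n)\<^sup>2 * ((\<alpha> + 1) / (b - 1) * ((cmod z)\<^sup>2) ^ n / (fact n * pochhammer b n))"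
          by (simp add: a_def bm norm_mult norm_power norm_divide power_mult_distrib power_divide 
              power2_eq_square divide_simps flip: power_mult)
        also have "\<dots> \<le> (C * (pochhammer \<epsilon> n * pochhammer b n)) * ((\<alpha> + 1) / (b - 1) * ((cmod z)\<^sup>2) ^ n / (fact n * pochhammer b n))"
          using b \<alpha> pb by (intro mult_right_mono C) auto
        also have "\<dots> = D * (pochhammer \<epsilon> n / fact n * ((cmod z)\<^sup>2) ^ n)"
          using pb by (simp add: D_def)
        finally show ?thesis .
      qed
      have "(\<Sum>n<N. (cmod (a n))\<^sup>2 * m n) \<le> (\<Sum>n<N. D * (pochhammer \<epsilon> n / fact n * ((cmod z)\<^sup>2) ^ n))"
        by (intro sum_mono le)
      also have "\<dots> = D * (\<Sum>n<N. pochhammer \<epsilon> n / fact n * ((cmod z)\<^sup>2) ^ n)"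
        by (simp add: sum_distrib_left)
      also have "\<dots> \<le> D * (1 - (cmod z)\<^sup>2) powr (- \<epsilon>)"
      proof (rule mult_left_mono)
        show "(\<Sum>n<N. pochhammer \<epsilon> n / fact n * ((cmod z)\<^sup>2) ^ n) \<le> (1 - (cmod z)\<^sup>2) powr (- \<epsilon>)"
          unfolding sums_unique[OF s]
          by (rule sum_le_suminf[OF sums_summable[OF s]]) (use \<epsilon> in \<open>auto intro!: pochhammer_nonneg divide_nonneg_nonneg mult_nonneg_nonneg\<close>)
      qed (use D in simp)
      finally show "(\<Sum>n<N. (cmod (a n))\<^sup>2 * m n) \<le> D * (1 - (cmod z)\<^sup>2) powr (- \<epsilon>)" .
    qed (use m0 in auto)
    \<comment> \<open>Parseval needs a power series in w, so the conjugate of the expression in the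
      kernel was expanded; the moduli agree.\<close>
    moreover have "cmod (1 - z * cnj w) = cmod (1 - cnj z * w)" for w
      by (metis complex_cnj_cnj complex_cnj_diff complex_cnj_mult complex_cnj_one complex_mod_cnj)
    ultimately show "(\<integral>\<^sup>+w. ennreal (cmod (1 - z * cnj w) powr (-(\<alpha> + 2)) * (1 - (cmod w)\<^sup>2) powr (- \<epsilon>)) \<partial>disc_measure \<alpha>)
      \<le> ennreal (D * (1 - (cmod z)\<^sup>2) powr (- \<epsilon>))"
      by (simp add: norm_pow)
  qed
qed

section \<open>The integral form of the Bergman projection\<close>

lemma finite_measure_disc_measure:
  assumes "-1 < \<alpha>" shows "finite_measure (disc_measure \<alpha>)"
proof
  have "emeasure (disc_measure \<alpha>) (space (disc_measure \<alpha>)) = (\<integral>\<^sup>+z. 1 \<partial>disc_measure \<alpha>)"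
    by (subst nn_integral_const) simp
  also have "\<dots> = (\<integral>\<^sup>+z. ennreal (cmod z ^ (2 * 0) * (1 - (cmod z)\<^sup>2) powr (- 0)) \<partial>disc_measure \<alpha>)"
  proof (rule nn_integral_cong)
    fix z assume "z \<in> space (disc_measure \<alpha>)"
    then have "(cmod z)\<^sup>2 < 1" by (simp add: abs_square_less_1)
    then show "(1::ennreal) = ennreal (cmod z ^ (2 * 0) * (1 - (cmod z)\<^sup>2) powr (- 0))" by simp
  qed
  also have "\<dots> < \<infinity>"
    using nn_integral_disc_moment[OF assms, of 0 0] assms by simp
  finally show "emeasure (disc_measure \<alpha>) (space (disc_measure \<alpha>)) \<noteq> \<infinity>" by simp
qed

text \<open>These squared norms of the monomials are the reciprocals of the numbers
  \<open>bergman_coeff\<close> below; that is the reason for the reproducing property.\<close>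

lemma nn_integral_disc_monomial:
  assumes "-1 < \<alpha>"
  shows "(\<integral>\<^sup>+z. ennreal (cmod z ^ (2 * n)) \<partial>disc_measure \<alpha>) = ennreal (fact n / pochhammer (\<alpha> + 2) n)"
proof -
  have "(\<integral>\<^sup>+z. ennreal (cmod z ^ (2 * n)) \<partial>disc_measure \<alpha>)
      = (\<integral>\<^sup>+z. ennreal (cmod z ^ (2 * n) * (1 - (cmod z)\<^sup>2) powr (- 0)) \<partial>disc_measure \<alpha>)"
  proof (rule nn_integral_cong)
    fix z assume "z \<in> space (disc_measure \<alpha>)"
    then have "(cmod z)\<^sup>2 < 1" by (simp add: abs_square_less_1)
    then show "ennreal (cmod z ^ (2 * n)) = ennreal (cmod z ^ (2 * n) * (1 - (cmod z)\<^sup>2) powr (- 0))" by simp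
  qed
  also have "\<dots> = ennreal (fact n / pochhammer (\<alpha> + 2) n)"
    using nn_integral_disc_moment[OF assms, of 0 n] Beta_disc_moment[OF assms, of 0 n] assms by simp
  finally show ?thesis .
qed

section \<open>Closure and integrability properties of the weighted spaces\<close>

lemma powr_add_le:
  fixes a b s :: real
  assumes "0 \<le> a" "0 \<le> b" "0 \<le> s"
  shows "(a + b) powr s \<le> 2 powr s * (a powr s + b powr s)"
proof -
  have "(a + b) powr s \<le> (2 * max a b) powr s" using assms by (intro powr_mono2) auto
  also have "\<dots> = 2 powr s * max a b powr s" using assms by (simp add: powr_mult)
  also have "\<dots> \<le> 2 powr s * (a powr s + b powr s)" by (intro mult_left_mono) (auto simp: max_def)
  finally show ?thesis .
qed

lemma weighted_Lp_measurable [measurable_dest]: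
  "f \<in> weighted_Lp s \<alpha> \<Longrightarrow> f \<in> borel_measurable (disc_measure \<alpha>)"
  and weighted_Lp_integrable:
  "f \<in> weighted_Lp s \<alpha> \<Longrightarrow> integrable (disc_measure \<alpha>) (\<lambda>z. cmod (f z) powr s)"
  by (auto simp: weighted_Lp_def)

lemma bergman_space_weighted_Lp: "f \<in> bergman_space s \<alpha> \<Longrightarrow> f \<in> weighted_Lp s \<alpha>"
  and bergman_space_holomorphic: "f \<in> bergman_space s \<alpha> \<Longrightarrow> f holomorphic_on ball 0 1"
  by (auto simp: bergman_space_def)

lemma weighted_Lp_bound:
  assumes g: "g \<in> weighted_Lp s \<alpha>" and [measurable]: "f \<in> borel_measurable (disc_measure \<alpha>)"
    and le: "\<And>z. z \<in> ball 0 1 \<Longrightarrow> cmod (f z) \<le> cmod (g z)" and s: "0 \<le> s"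
  shows "f \<in> weighted_Lp s \<alpha>"
  unfolding weighted_Lp_def
  by (auto intro!: AE_I2 Bochner_Integration.integrable_bound[OF weighted_Lp_integrable[OF g]] powr_mono2 le s)

lemma weighted_Lp_add:
  assumes f: "f \<in> weighted_Lp s \<alpha>" and g: "g \<in> weighted_Lp s \<alpha>" and s: "0 \<le> s"
  shows "(\<lambda>z. f z + g z) \<in> weighted_Lp s \<alpha>"
proof -
  note [measurable] = weighted_Lp_measurable[OF f] weighted_Lp_measurable[OF g]
  have "integrable (disc_measure \<alpha>) (\<lambda>z. 2 powr s * (cmod (f z) powr s + cmod (g z) powr s))"
    using weighted_Lp_integrable[OF f] weighted_Lp_integrable[OF g] by auto
  then have "integrable (disc_measure \<alpha>) (\<lambda>z. cmod (f z + g z) powr s)"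
  proof (rule Bochner_Integration.integrable_bound)
    show "AE z in disc_measure \<alpha>. norm (cmod (f z + g z) powr s) \<le> norm (2 powr s * (cmod (f z) powr s + cmod (g z) powr s))"
    proof (rule AE_I2)
      fix z
      have "cmod (f z + g z) powr s \<le> (cmod (f z) + cmod (g z)) powr s"
        by (intro powr_mono2 norm_triangle_ineq s) auto
      also have "\<dots> \<le> 2 powr s * (cmod (f z) powr s + cmod (g z) powr s)"
        by (intro powr_add_le s) auto
      finally show "norm (cmod (f z + g z) powr s) \<le> norm (2 powr s * (cmod (f z) powr s + cmod (g z) powr s))" by simp
    qed
  qed measurable
  then show ?thesis by (simp add: weighted_Lp_def)
qed

lemma weighted_Lp_cmult:
  assumes f: "f \<in> weighted_Lp s \<alpha>"
  shows "(\<lambda>z. c * f z) \<in> weighted_Lp s \<alpha>"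
  using weighted_Lp_measurable[OF f] weighted_Lp_integrable[OF f]
  by (auto simp: weighted_Lp_def norm_mult powr_mult)

lemma weighted_Lp_diff:
  assumes f: "f \<in> weighted_Lp s \<alpha>" and g: "g \<in> weighted_Lp s \<alpha>" and s: "0 \<le> s"
  shows "(\<lambda>z. f z - g z) \<in> weighted_Lp s \<alpha>"
  using weighted_Lp_add[OF f weighted_Lp_cmult[OF g, of "-1"] s] by simp

lemma bergman_space_lincomb:
  assumes f: "f \<in> bergman_space s \<alpha>" and g: "g \<in> bergman_space s \<alpha>" and s: "0 \<le> s"
  shows "(\<lambda>z. a * f z + b * g z) \<in> bergman_space s \<alpha>"
  using f g weighted_Lp_add[OF weighted_Lp_cmult weighted_Lp_cmult s, of f _ g a b]
  by (auto simp: bergman_space_def intro!: holomorphic_intros)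

lemma bergman_space_diff:
  assumes "f \<in> bergman_space s \<alpha>" "g \<in> bergman_space s \<alpha>" "0 \<le> s"
  shows "(\<lambda>z. f z - g z) \<in> bergman_space s \<alpha>"
  using bergman_space_lincomb[OF assms, of 1 "-1"] by simp

text \<open>On a finite measure |f| \<le> 1 + |f|^s is enough. Through this inclusion one operator,
  defined on integrable functions, serves all exponents.\<close>

lemma weighted_Lp_integrable_1:
  assumes \<alpha>: "-1 < \<alpha>" and f: "f \<in> weighted_Lp s \<alpha>" and s: "1 \<le> s"
  shows "integrable (disc_measure \<alpha>) f"
proof -
  interpret finite_measure "disc_measure \<alpha>" by (rule finite_measure_disc_measure[OF \<alpha>])
  note [measurable] = weighted_Lp_measurable[OF f]
  have "integrable (disc_measure \<alpha>) (\<lambda>z. 1 + cmod (f z) powr s)"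
    using weighted_Lp_integrable[OF f] by auto
  then show ?thesis
  proof (rule Bochner_Integration.integrable_bound)
    show "AE z in disc_measure \<alpha>. cmod (f z) \<le> norm (1 + cmod (f z) powr s)"
    proof (rule AE_I2)
      fix z
      have "cmod (f z) \<le> 1 + cmod (f z) powr s"
      proof (cases "cmod (f z) \<le> 1")
        case False
        then have "cmod (f z) powr 1 \<le> cmod (f z) powr s" using s by (intro powr_mono) auto
        then show ?thesis using False by simp
      qed (auto intro: add_increasing2)
      then show "cmod (f z) \<le> norm (1 + cmod (f z) powr s)" by simp
    qed
  qed simp
qed

lemma integrable_mult_cnj:
  assumes f: "f \<in> weighted_Lp p \<alpha>" and g: "g \<in> weighted_Lp q \<alpha>"
    and pq: "1 < p" "1 < q" "1 / p + 1 / q = 1"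
  shows "integrable (disc_measure \<alpha>) (\<lambda>z. f z * cnj (g z))"
proof -
  note [measurable] = weighted_Lp_measurable[OF f] weighted_Lp_measurable[OF g]
  have cm [measurable]: "cnj \<in> borel_measurable borel"
    by (intro borel_measurable_continuous_onI continuous_intros)
  have "integrable (disc_measure \<alpha>) (\<lambda>z. cmod (f z) powr p / p + cmod (g z) powr q / q)"
    using weighted_Lp_integrable[OF f] weighted_Lp_integrable[OF g] by auto
  then show ?thesis
  proof (rule Bochner_Integration.integrable_bound)
    show "AE z in disc_measure \<alpha>. cmod (f z * cnj (g z)) \<le> norm (cmod (f z) powr p / p + cmod (g z) powr q / q)"
      using Youngs_inequality[OF pq] pq by (intro AE_I2) (simp add: norm_mult)
  qed measurable
qed

section \<open>The Bergman kernel, its integral operator and the reproducing property\<close>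

definition bergman_coeff :: "real \<Rightarrow> nat \<Rightarrow> real" where
  "bergman_coeff \<alpha> n = pochhammer (\<alpha> + 2) n / fact n"

text \<open>On the disc this is (1 - z cnj w)^(-(\<alpha> + 2)), see
  \<open>bergman_kernel_eq\<close>. The series makes joint measurability immediate and can be
  integrated term by term.\<close>

definition bergman_kernel :: "real \<Rightarrow> complex \<Rightarrow> complex \<Rightarrow> complex" where
  "bergman_kernel \<alpha> z w = (\<Sum>n. of_real (bergman_coeff \<alpha> n) * (z * cnj w) ^ n)"

text \<open>The expansion of the projection in the orthogonal monomials,
  \<open>bergman_coeff\<close> being the inverse of their squared norms. It makes sense for every
  integrable u and is holomorphic by construction. The estimates use its kernel form
  \<open>bergman_op_kernel\<close>.\<close>

definition bergman_op :: "real \<Rightarrow> (complex \<Rightarrow> complex) \<Rightarrow> complex \<Rightarrow> complex" where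
  "bergman_op \<alpha> u z = (\<Sum>n. of_real (bergman_coeff \<alpha> n) * (\<integral>w. u w * cnj w ^ n \<partial>disc_measure \<alpha>) * z ^ n)"

lemma mult_cnj_lt_1: "cmod z < 1 \<Longrightarrow> cmod w < 1 \<Longrightarrow> cmod (z * cnj w) < 1"
  using mult_strict_mono[of "cmod z" 1 "cmod w" 1] by (simp add: norm_mult)

context
  fixes \<alpha> :: real
  assumes \<alpha>: "-1 < \<alpha>"
begin

interpretation M: finite_measure "disc_measure \<alpha>"
  by (rule finite_measure_disc_measure[OF \<alpha>])

interpretation MM: pair_sigma_finite "disc_measure \<alpha>" "disc_measure \<alpha>" ..

lemma bergman_coeff_pos: "0 < bergman_coeff \<alpha> n"
  using \<alpha> by (simp add: bergman_coeff_def pochhammer_pos)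

lemma bergman_kernel_eq:
  "cmod (z * cnj w) < 1 \<Longrightarrow> bergman_kernel \<alpha> z w = (1 - z * cnj w) powr (- of_real (\<alpha> + 2))"
  using binomial_series_neg_powr[of "z * cnj w" "\<alpha> + 2"]
  by (simp add: bergman_kernel_def bergman_coeff_def sums_iff)

lemma norm_bergman_kernel:
  "cmod (z * cnj w) < 1 \<Longrightarrow> cmod (bergman_kernel \<alpha> z w) = cmod (1 - z * cnj w) powr (- (\<alpha> + 2))"
  by (subst bergman_kernel_eq, assumption, subst norm_powr_real_powr') auto

lemma norm_bergman_kernel_commute:
  assumes "cmod (z * cnj w) < 1"
  shows "cmod (bergman_kernel \<alpha> z w) = cmod (bergman_kernel \<alpha> w z)"
proof -
  have w: "cmod (w * cnj z) < 1" using assms by (simp add: norm_mult mult.commute)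
  have "cnj (1 - z * cnj w) = 1 - w * cnj z" by (simp add: mult.commute)
  then have "cmod (1 - z * cnj w) = cmod (1 - w * cnj z)" by (metis complex_mod_cnj)
  then show ?thesis by (simp only: norm_bergman_kernel[OF assms] norm_bergman_kernel[OF w])
qed

lemma summable_bergman_coeff: "0 \<le> x \<Longrightarrow> x < 1 \<Longrightarrow> summable (\<lambda>n. bergman_coeff \<alpha> n * x ^ n)"
  using binomial_series_neg_powr_real[of x "\<alpha> + 2"] by (auto simp: bergman_coeff_def sums_iff)

lemma bergman_kernel_sums:
  "cmod (z * cnj w) < 1 \<Longrightarrow>
    (\<lambda>n. of_real (bergman_coeff \<alpha> n) * (z * cnj w) ^ n) sums bergman_kernel \<alpha> z w"
  using binomial_series_neg_powr[of "z * cnj w" "\<alpha> + 2"]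
  by (simp only: bergman_kernel_eq bergman_coeff_def)

lemma cnj_bergman_kernel:
  assumes "cmod (z * cnj w) < 1"
  shows "cnj (bergman_kernel \<alpha> z w) = bergman_kernel \<alpha> w z"
proof -
  have "cmod (w * cnj z) < 1" using assms by (simp add: norm_mult mult.commute)
  note sums = bergman_kernel_sums[OF this]
  have "cnj (of_real (bergman_coeff \<alpha> n) * (z * cnj w) ^ n) = of_real (bergman_coeff \<alpha> n) * (w * cnj z) ^ n" for n
    by (simp only: complex_cnj_mult complex_cnj_power complex_cnj_cnj complex_cnj_complex_of_real mult.commute[of "cnj z"])
  then show ?thesis
    using bounded_linear.sums[OF bounded_linear_cnj bergman_kernel_sums[OF assms]]
    by (intro sums_unique2[OF _ sums]) (simp only:)
qed

lemma measurable_fst_borel [measurable]: "fst \<in> borel_measurable (disc_measure \<alpha> \<Otimes>\<^sub>M disc_measure \<alpha>)"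
  by (rule measurable_compose[OF measurable_fst measurable_disc_measureI]) simp

lemma measurable_snd_borel [measurable]: "snd \<in> borel_measurable (disc_measure \<alpha> \<Otimes>\<^sub>M disc_measure \<alpha>)"
  by (rule measurable_compose[OF measurable_snd measurable_disc_measureI]) simp

lemma measurable_cnj [measurable]: "cnj \<in> borel_measurable borel"
  by (intro borel_measurable_continuous_onI continuous_intros)

lemma measurable_bergman_kernel_pair [measurable]:
  "(\<lambda>p. bergman_kernel \<alpha> (fst p) (snd p)) \<in> borel_measurable (disc_measure \<alpha> \<Otimes>\<^sub>M disc_measure \<alpha>)"
  unfolding bergman_kernel_def by measurable

lemma measurable_bergman_kernel1 [measurable]: "bergman_kernel \<alpha> z \<in> borel_measurable (disc_measure \<alpha>)"
  unfolding bergman_kernel_def by measurable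

lemma measurable_bergman_kernel2 [measurable]: "(\<lambda>z. bergman_kernel \<alpha> z w) \<in> borel_measurable (disc_measure \<alpha>)"
  unfolding bergman_kernel_def by measurable

lemma integrable_mult_bounded:
  fixes u v :: "complex \<Rightarrow> complex"
  assumes u: "integrable (disc_measure \<alpha>) u" and [measurable]: "v \<in> borel_measurable (disc_measure \<alpha>)"
    and v: "\<And>z. cmod z < 1 \<Longrightarrow> cmod (v z) \<le> B"
  shows "integrable (disc_measure \<alpha>) (\<lambda>z. u z * v z)"
proof (rule Bochner_Integration.integrable_bound)
  show "integrable (disc_measure \<alpha>) (\<lambda>z. B * cmod (u z))" using u by simp
  have B: "0 \<le> B" using v[of 0] order_trans[OF norm_ge_zero] by auto
  show "AE z in disc_measure \<alpha>. cmod (u z * v z) \<le> norm (B * cmod (u z))"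
    using v B by (intro AE_I2) (simp add: norm_mult mult.commute[of "cmod (u _)"] mult_right_mono)
qed (use borel_measurable_integrable[OF u] in measurable)

lemma norm_moment_le:
  assumes u: "integrable (disc_measure \<alpha>) u"
  shows "cmod (\<integral>w. u w * cnj w ^ n \<partial>disc_measure \<alpha>) \<le> (\<integral>w. cmod (u w) \<partial>disc_measure \<alpha>)"
proof -
  have "cmod (\<integral>w. u w * cnj w ^ n \<partial>disc_measure \<alpha>) \<le> (\<integral>w. cmod (u w * cnj w ^ n) \<partial>disc_measure \<alpha>)"
    by (rule integral_norm_bound)
  also have "\<dots> \<le> (\<integral>w. cmod (u w) \<partial>disc_measure \<alpha>)"
  proof (rule integral_mono)
    show "integrable (disc_measure \<alpha>) (\<lambda>w. cmod (u w * cnj w ^ n))"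
      by (intro integrable_norm integrable_mult_bounded[OF u, of _ 1]) (auto simp: norm_power power_le_one)
  qed (use u in \<open>auto simp: norm_mult norm_power power_le_one mult_left_le\<close>)
  finally show ?thesis .
qed

lemma bergman_op_sums:
  assumes u: "integrable (disc_measure \<alpha>) u" and z: "cmod z < 1"
  shows "(\<lambda>n. of_real (bergman_coeff \<alpha> n) * (\<integral>w. u w * cnj w ^ n \<partial>disc_measure \<alpha>) * z ^ n) sums bergman_op \<alpha> u z"
  unfolding bergman_op_def
proof (rule summable_sums, rule summable_comparison_test')
  show "summable (\<lambda>n. (\<integral>w. cmod (u w) \<partial>disc_measure \<alpha>) * (bergman_coeff \<alpha> n * cmod z ^ n))"
    by (intro summable_mult summable_bergman_coeff) (use z in auto)
  show "cmod (of_real (bergman_coeff \<alpha> n) * (\<integral>w. u w * cnj w ^ n \<partial>disc_measure \<alpha>) * z ^ n)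
      \<le> (\<integral>w. cmod (u w) \<partial>disc_measure \<alpha>) * (bergman_coeff \<alpha> n * cmod z ^ n)" for n
    using mult_right_mono[OF norm_moment_le[OF u, of n], of "bergman_coeff \<alpha> n * cmod z ^ n"] bergman_coeff_pos[of n]
    by (simp add: norm_mult norm_power mult_ac)
qed

lemma bergman_op_holomorphic:
  assumes u: "integrable (disc_measure \<alpha>) u"
  shows "bergman_op \<alpha> u holomorphic_on ball 0 1"
  by (rule power_series_holomorphic[where a = "\<lambda>n. of_real (bergman_coeff \<alpha> n) * (\<integral>w. u w * cnj w ^ n \<partial>disc_measure \<alpha>)"])
     (use bergman_op_sums[OF u] in auto)

text \<open>For fixed z the kernel series is dominated, uniformly in w, by a convergent numerical
  series in |z|; multiplied by an integrable u it may be integrated term by term.\<close>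

lemma bergman_op_kernel:
  assumes u: "integrable (disc_measure \<alpha>) u" and z: "cmod z < 1"
  shows "bergman_op \<alpha> u z = (\<integral>w. bergman_kernel \<alpha> z w * u w \<partial>disc_measure \<alpha>)"
proof -
  let ?f = "\<lambda>n w. u w * (of_real (bergman_coeff \<alpha> n) * (z * cnj w) ^ n)"
  note [measurable] = borel_measurable_integrable[OF u]
  have le: "cmod ((of_real (bergman_coeff \<alpha> n) * (z * cnj w) ^ n)) \<le> bergman_coeff \<alpha> n * cmod z ^ n" if "cmod w < 1" for n w
    using that bergman_coeff_pos[of n]
    by (auto simp: norm_mult norm_power power_mult_distrib intro!: mult_left_mono mult_left_le power_le_one)
  have i: "integrable (disc_measure \<alpha>) (?f n)" for n
    by (rule integrable_mult_bounded[OF u _ le]) auto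
  have sm: "summable (\<lambda>n. bergman_coeff \<alpha> n * cmod z ^ n)"
    by (intro summable_bergman_coeff) (use z in auto)
  have s1: "AE w in disc_measure \<alpha>. summable (\<lambda>n. norm (?f n w))"
  proof (rule AE_I2)
    fix w assume "w \<in> space (disc_measure \<alpha>)"
    then have w: "cmod w < 1" by simp
    have "summable (\<lambda>n. cmod (u w) * cmod ((of_real (bergman_coeff \<alpha> n) * (z * cnj w) ^ n)))"
      by (intro summable_mult summable_comparison_test'[OF sm]) (use le[OF w] in auto)
    then show "summable (\<lambda>n. norm (?f n w))" by (simp add: norm_mult)
  qed
  have s2: "summable (\<lambda>n. \<integral>w. norm (?f n w) \<partial>disc_measure \<alpha>)"
  proof (rule summable_comparison_test')
    show "summable (\<lambda>n. (\<integral>w. cmod (u w) \<partial>disc_measure \<alpha>) * (bergman_coeff \<alpha> n * cmod z ^ n))"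
      by (intro summable_mult sm)
    show "norm (\<integral>w. norm (?f n w) \<partial>disc_measure \<alpha>) \<le> (\<integral>w. cmod (u w) \<partial>disc_measure \<alpha>) * (bergman_coeff \<alpha> n * cmod z ^ n)" for n
    proof -
      have "(\<integral>w. norm (?f n w) \<partial>disc_measure \<alpha>) \<le> (\<integral>w. cmod (u w) * (bergman_coeff \<alpha> n * cmod z ^ n) \<partial>disc_measure \<alpha>)"
      proof (rule integral_mono)
        fix w assume "w \<in> space (disc_measure \<alpha>)"
        then show "norm (?f n w) \<le> cmod (u w) * (bergman_coeff \<alpha> n * cmod z ^ n)"
          using mult_left_mono[OF le[of w n], of "cmod (u w)"] by (simp only: norm_mult norm_ge_zero) simp
      qed (use i u in auto)
      then show ?thesis by simp
    qed
  qed
  have "(\<integral>w. bergman_kernel \<alpha> z w * u w \<partial>disc_measure \<alpha>) = (\<integral>w. (\<Sum>n. ?f n w) \<partial>disc_measure \<alpha>)"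
  proof (rule Bochner_Integration.integral_cong[OF refl])
    fix w assume "w \<in> space (disc_measure \<alpha>)"
    then have w: "cmod w < 1" by simp
    have "summable (\<lambda>n. of_real (bergman_coeff \<alpha> n) * (z * cnj w) ^ n)"
      by (rule summable_comparison_test'[OF sm]) (use le[OF w] in auto)
    then show "bergman_kernel \<alpha> z w * u w = (\<Sum>n. ?f n w)"
      unfolding bergman_kernel_def by (subst suminf_mult) (auto simp: mult.commute)
  qed
  also have "\<dots> = (\<Sum>n. \<integral>w. ?f n w \<partial>disc_measure \<alpha>)"
    by (rule integral_suminf[OF i s1 s2])
  also have "\<dots> = bergman_op \<alpha> u z"
    unfolding bergman_op_def
  proof (intro arg_cong[where f = suminf] ext)
    fix n
    have eq: "(\<integral>w. ?f n w \<partial>disc_measure \<alpha>) = (\<integral>w. (of_real (bergman_coeff \<alpha> n) * z ^ n) * (u w * cnj w ^ n) \<partial>disc_measure \<alpha>)"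
      by (intro Bochner_Integration.integral_cong) (auto simp: power_mult_distrib mult_ac)
    show "(\<integral>w. ?f n w \<partial>disc_measure \<alpha>) = of_real (bergman_coeff \<alpha> n) * (\<integral>w. u w * cnj w ^ n \<partial>disc_measure \<alpha>) * z ^ n"
      unfolding eq integral_mult_right_zero by (simp only: mult.assoc mult.commute[of "z ^ n"])
  qed
  finally show ?thesis by simp
qed

lemma bergman_op_diff:
  assumes u: "integrable (disc_measure \<alpha>) u" and v: "integrable (disc_measure \<alpha>) v" and z: "cmod z < 1"
  shows "bergman_op \<alpha> (\<lambda>z. u z - v z) z = bergman_op \<alpha> u z - bergman_op \<alpha> v z"
proof -
  have i: "integrable (disc_measure \<alpha>) (\<lambda>w. u w * cnj w ^ n)" if "integrable (disc_measure \<alpha>) u" for u n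
    by (rule integrable_mult_bounded[OF that, of _ 1]) (auto simp: norm_power power_le_one)
  have "(\<integral>w. (u w - v w) * cnj w ^ n \<partial>disc_measure \<alpha>) = 
      (\<integral>w. u w * cnj w ^ n \<partial>disc_measure \<alpha>) - (\<integral>w. v w * cnj w ^ n \<partial>disc_measure \<alpha>)" for n
    using Bochner_Integration.integral_diff[OF i[OF u] i[OF v]] by (simp only: left_diff_distrib)
  note D = this
  have "(\<lambda>n. of_real (bergman_coeff \<alpha> n) * (\<integral>w. u w * cnj w ^ n \<partial>disc_measure \<alpha>) * z ^ n
     - of_real (bergman_coeff \<alpha> n) * (\<integral>w. v w * cnj w ^ n \<partial>disc_measure \<alpha>) * z ^ n)
     = (\<lambda>n. of_real (bergman_coeff \<alpha> n) * (\<integral>w. (u w - v w) * cnj w ^ n \<partial>disc_measure \<alpha>) * z ^ n)"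
    unfolding D by (simp only: left_diff_distrib right_diff_distrib)
  then show ?thesis
    using sums_diff[OF bergman_op_sums[OF u z] bergman_op_sums[OF v z]]
      sums_unique2[OF bergman_op_sums[OF Bochner_Integration.integrable_diff[OF u v] z]] by simp
qed

text \<open>Formally one integrates the Taylor series against \<open>cnj w ^ n\<close> and only the
  n-th term survives. The series need not converge uniformly up to the boundary, so the integrals
  are first cut off to |w| < R k. The cutoff is radial and preserves orthogonality; it is removed by
  dominated convergence on both sides of \<open>IJ\<close>.\<close>

lemma holomorphic_moment:
  assumes f: "f holomorphic_on ball 0 1" "integrable (disc_measure \<alpha>) f"
  shows "of_real (bergman_coeff \<alpha> n) * (\<integral>w. f w * cnj w ^ n \<partial>disc_measure \<alpha>) = (deriv ^^ n) f 0 / fact n"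
proof -
  define a where "a m = (deriv ^^ m) f 0 / fact m" for m
  have S: "(\<lambda>m. a m * w ^ m) sums f w" if "cmod w < 1" for w
    using holomorphic_power_series[OF f(1), of w] that by (simp add: a_def)
  define R where "R k = 1 - 1 / (real k + 2)" for k
  have R: "0 < R k" "R k < 1" for k by (auto simp: R_def field_simps)
  define \<phi> :: "nat \<Rightarrow> real \<Rightarrow> real" where "\<phi> k = indicator {x. x < R k}" for k
  have [measurable]: "\<phi> k \<in> borel_measurable borel" for k unfolding \<phi>_def by measurable
  note [measurable] = borel_measurable_integrable[OF f(2)]
  have lim: "(\<lambda>k. \<phi> k (cmod w)) \<longlonglongrightarrow> 1" if "cmod w < 1" for w
  proof (rule tendsto_eventually)
    have "R \<longlonglongrightarrow> 1" unfolding R_def by real_asymp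
    then have "eventually (\<lambda>k. R k > cmod w) sequentially" using that by (rule order_tendstoD)
    then show "eventually (\<lambda>k. \<phi> k (cmod w) = 1) sequentially" by eventually_elim (simp add: \<phi>_def)
  qed
  let ?I = "\<lambda>k. \<integral>w. f w * (cnj w ^ n * of_real (\<phi> k (cmod w))) \<partial>disc_measure \<alpha>"
  let ?J = "\<lambda>k. \<integral>w. w ^ n * cnj w ^ n * of_real (\<phi> k (cmod w)) \<partial>disc_measure \<alpha>"
  have IJ: "?I k = a n * ?J k" for k
  proof -
    let ?g = "\<lambda>m w. a m * (w ^ m * cnj w ^ n * of_real (\<phi> k (cmod w)))"
    have le: "cmod (?g m w) \<le> cmod (a m) * R k ^ m" if "cmod w < 1" for m w
    proof -
      have "cmod (w ^ m * cnj w ^ n * of_real (\<phi> k (cmod w))) \<le> R k ^ m"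
      proof (cases "cmod w < R k")
        case True
        have "cmod w ^ m * cmod w ^ n \<le> R k ^ m * 1"
          using True that by (intro mult_mono power_mono power_le_one zero_le_power) (use R[of k] in auto)
        then show ?thesis using True by (simp add: \<phi>_def norm_mult norm_power)
      qed (use R[of k] in \<open>simp add: \<phi>_def\<close>)
      then show ?thesis by (subst norm_mult) (intro mult_left_mono, auto)
    qed
    \<comment> \<open>Convergence at a point r strictly between R k and 1 gives absolute convergence
      at R k.\<close>
    have sm: "summable (\<lambda>m. cmod (a m) * R k ^ m)"
    proof -
      obtain r where r: "R k < r" "r < 1" using dense R(2) by blast
      have "summable (\<lambda>m. a m * of_real r ^ m)" using S[of "of_real r"] r R(1)[of k] by (auto simp: sums_iff)
      from powser_insidea[OF this, of "of_real (R k)"] show ?thesis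
        using r R(1)[of k] by (simp add: norm_mult norm_power)
    qed
    have i: "integrable (disc_measure \<alpha>) (?g m)" for m
      by (rule M.integrable_const_bound[where B = "cmod (a m) * R k ^ m"]) (use le in auto)
    have "?I k = (\<integral>w. (\<Sum>m. ?g m w) \<partial>disc_measure \<alpha>)"
    proof (rule Bochner_Integration.integral_cong[OF refl])
      fix w assume "w \<in> space (disc_measure \<alpha>)"
      then have "(\<lambda>m. a m * w ^ m) sums f w" by (intro S) simp
      from sums_mult2[OF this, of "cnj w ^ n * of_real (\<phi> k (cmod w))"]
      show "f w * (cnj w ^ n * of_real (\<phi> k (cmod w))) = (\<Sum>m. ?g m w)"
        by (simp add: sums_iff mult_ac)
    qed
    also have "\<dots> = (\<Sum>m. \<integral>w. ?g m w \<partial>disc_measure \<alpha>)"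
    proof (rule integral_suminf[OF i])
      show "AE w in disc_measure \<alpha>. summable (\<lambda>m. norm (?g m w))"
        by (rule AE_I2, rule summable_comparison_test'[OF sm]) (use le in auto)
      show "summable (\<lambda>m. \<integral>w. norm (?g m w) \<partial>disc_measure \<alpha>)"
      proof (rule summable_comparison_test')
        show "summable (\<lambda>m. measure (disc_measure \<alpha>) (ball 0 1) * (cmod (a m) * R k ^ m))"
          by (intro summable_mult sm)
        fix m
        have "(\<integral>w. norm (?g m w) \<partial>disc_measure \<alpha>) \<le> (\<integral>w. cmod (a m) * R k ^ m \<partial>disc_measure \<alpha>)"
          by (rule integral_mono) (use le i in auto)
        then show "norm (\<integral>w. norm (?g m w) \<partial>disc_measure \<alpha>) \<le> measure (disc_measure \<alpha>) (ball 0 1) * (cmod (a m) * R k ^ m)"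
          by simp
      qed
    qed
    also have "\<dots> = (\<Sum>m. if m = n then a n * ?J k else 0)"
      by (intro arg_cong[where f = suminf] ext) (auto simp: integral_monomials_orthogonal)
    also have "\<dots> = a n * ?J k"
      using suminf_finite[of "{n}" "\<lambda>m. if m = n then a n * ?J k else 0"] by simp
    finally show ?thesis .
  qed
  have limI: "?I \<longlonglongrightarrow> (\<integral>w. f w * cnj w ^ n \<partial>disc_measure \<alpha>)"
  proof (rule integral_dominated_convergence)
    show "integrable (disc_measure \<alpha>) (\<lambda>w. cmod (f w))" using f(2) by simp
    show "AE w in disc_measure \<alpha>. (\<lambda>k. f w * (cnj w ^ n * of_real (\<phi> k (cmod w)))) \<longlonglongrightarrow> f w * cnj w ^ n"
    proof (rule AE_I2)
      fix w assume "w \<in> space (disc_measure \<alpha>)"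
      then have "(\<lambda>k. f w * (cnj w ^ n * of_real (\<phi> k (cmod w)))) \<longlonglongrightarrow> f w * (cnj w ^ n * of_real 1)"
        by (intro tendsto_intros lim) simp
      then show "(\<lambda>k. f w * (cnj w ^ n * of_real (\<phi> k (cmod w)))) \<longlonglongrightarrow> f w * cnj w ^ n" by simp
    qed
    show "AE w in disc_measure \<alpha>. norm (f w * (cnj w ^ n * of_real (\<phi> k (cmod w)))) \<le> cmod (f w)" for k
      by (rule AE_I2) (auto simp: norm_mult norm_power \<phi>_def indicator_def intro!: mult_left_le power_le_one)
  qed measurable
  have limJ: "?J \<longlonglongrightarrow> (\<integral>w. w ^ n * cnj w ^ n \<partial>disc_measure \<alpha>)"
  proof (rule integral_dominated_convergence)
    show "integrable (disc_measure \<alpha>) (\<lambda>w. 1::real)" by simp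
    show "AE w in disc_measure \<alpha>. (\<lambda>k. w ^ n * cnj w ^ n * of_real (\<phi> k (cmod w))) \<longlonglongrightarrow> w ^ n * cnj w ^ n"
    proof (rule AE_I2)
      fix w assume "w \<in> space (disc_measure \<alpha>)"
      then have "(\<lambda>k. w ^ n * cnj w ^ n * of_real (\<phi> k (cmod w))) \<longlonglongrightarrow> w ^ n * cnj w ^ n * of_real 1"
        by (intro tendsto_intros lim) simp
      then show "(\<lambda>k. w ^ n * cnj w ^ n * of_real (\<phi> k (cmod w))) \<longlonglongrightarrow> w ^ n * cnj w ^ n" by simp
    qed
    show "AE w in disc_measure \<alpha>. norm (w ^ n * cnj w ^ n * of_real (\<phi> k (cmod w))) \<le> 1" for k
      by (rule AE_I2) (auto simp: norm_mult norm_power \<phi>_def indicator_def intro!: mult_le_one power_le_one)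
  qed measurable
  have J: "(\<integral>w. w ^ n * cnj w ^ n \<partial>disc_measure \<alpha>) = of_real (fact n / pochhammer (\<alpha> + 2) n)"
  proof -
    have "w ^ n * cnj w ^ n = of_real (cmod w ^ (2 * n))" for w
      by (simp only: power_mult power_mult_distrib[symmetric] complex_norm_square[symmetric] of_real_power)
    moreover have "(\<integral>w. cmod w ^ (2 * n) \<partial>disc_measure \<alpha>) = fact n / pochhammer (\<alpha> + 2) n"
      using \<alpha> pochhammer_nonneg[of "\<alpha> + 2" n] by (subst integral_eq_nn_integral) (auto simp: nn_integral_disc_monomial)
    ultimately show ?thesis by (simp only: integral_complex_of_real)
  qed
  have "(\<integral>w. f w * cnj w ^ n \<partial>disc_measure \<alpha>) = a n * of_real (fact n / pochhammer (\<alpha> + 2) n)"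
    using limI unfolding IJ by (rule LIMSEQ_unique) (use limJ in \<open>simp only: J tendsto_mult_left\<close>)
  moreover have "pochhammer (\<alpha> + 2) n > 0" using \<alpha> by (intro pochhammer_pos) auto
  ultimately show ?thesis by (simp add: a_def bergman_coeff_def)
qed

lemma bergman_op_reproducing:
  assumes f: "f holomorphic_on ball 0 1" "integrable (disc_measure \<alpha>) f" and z: "cmod z < 1"
  shows "bergman_op \<alpha> f z = f z"
  using bergman_op_sums[OF f(2) z] holomorphic_power_series[OF f(1), of z] z
  unfolding holomorphic_moment[OF f] by (simp add: sums_iff)

text \<open>The operator sees only the almost-everywhere class of its argument, so it maps f to 0;
  but it also reproduces f at every point of the disc.\<close>

lemma holomorphic_AE_zero:
  assumes f: "f holomorphic_on ball 0 1" and ae: "AE z in disc_measure \<alpha>. f z = 0" and z: "cmod z < 1"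
  shows "f z = 0"
proof -
  note m = holomorphic_measurable_disc[OF f]
  have i: "integrable (disc_measure \<alpha>) f"
    using ae m by (subst integrable_cong_AE[where g = "\<lambda>_. 0"]) auto
  have "(\<integral>w. f w * cnj w ^ n \<partial>disc_measure \<alpha>) = (\<integral>w. 0 \<partial>disc_measure \<alpha>)" for n
    using m ae by (intro integral_cong_AE) (auto elim!: eventually_mono)
  then have "bergman_op \<alpha> f z = 0" by (simp add: bergman_op_def)
  then show ?thesis using bergman_op_reproducing[OF f i z] by simp
qed

end

section \<open>Boundedness and self-adjointness\<close>

text \<open>Schur's test with the weight \<open>(1 - |z|\<^sup>2)\<close> to the power \<open>- t\<close>.\<close>

lemma bergman_kernel_schur:
  assumes \<alpha>: "-1 < \<alpha>" and pq: "1 < p" "1 < q" "1 / p + 1 / q = 1"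
  obtains C where "0 < C"
    "\<And>u v. u \<in> borel_measurable (disc_measure \<alpha>) \<Longrightarrow> v \<in> borel_measurable (disc_measure \<alpha>) \<Longrightarrow>
      (\<integral>\<^sup>+z. \<integral>\<^sup>+w. ennreal (cmod (bergman_kernel \<alpha> z w) * cmod (u w) * cmod (v z)) \<partial>disc_measure \<alpha> \<partial>disc_measure \<alpha>)
      \<le> ennreal C * ((\<integral>\<^sup>+w. ennreal (cmod (u w) powr q) \<partial>disc_measure \<alpha>) + (\<integral>\<^sup>+z. ennreal (cmod (v z) powr p) \<partial>disc_measure \<alpha>))"
proof -
  interpret M: finite_measure "disc_measure \<alpha>"
    by (rule finite_measure_disc_measure[OF \<alpha>])
  interpret MM: pair_sigma_finite "disc_measure \<alpha>" "disc_measure \<alpha>" ..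
  note [measurable] = measurable_bergman_kernel_pair[OF \<alpha>] measurable_fst_borel[OF \<alpha>] measurable_snd_borel[OF \<alpha>]
    measurable_bergman_kernel1[OF \<alpha>] measurable_bergman_kernel2[OF \<alpha>]
  \<comment> \<open>Small enough for both t p and t q to lie strictly between 0 and \<alpha> + 1,
    the range of the Forelli--Rudin estimate.\<close>
  define t where "t = (\<alpha> + 1) / (2 * (p + q))"
  have t: "0 < t" using \<alpha> pq by (simp add: t_def)
  have tlt: "t * s < \<alpha> + 1" if "s \<le> p + q" for s
  proof -
    have "t * s \<le> t * (p + q)" using that t by (intro mult_left_mono) auto
    also have "\<dots> = (\<alpha> + 1) / 2" using pq by (simp only: t_def) (simp add: divide_simps)
    also have "\<dots> < \<alpha> + 1" using \<alpha> by simp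
    finally show ?thesis .
  qed
  define K where "K z w = cmod (bergman_kernel \<alpha> z w)" for z w
  have [measurable]: "K z \<in> borel_measurable (disc_measure \<alpha>)" "(\<lambda>z. K z w) \<in> borel_measurable (disc_measure \<alpha>)"
    "(\<lambda>x. K (fst x) (snd x)) \<in> borel_measurable (disc_measure \<alpha> \<Otimes>\<^sub>M disc_measure \<alpha>)" for z w
    unfolding K_def by measurable
  define \<phi> where "\<phi> z = (1 - (cmod z)\<^sup>2) powr (- t)" for z :: complex
  have [measurable]: "\<phi> \<in> borel_measurable (disc_measure \<alpha>)"
    "(\<lambda>x. \<phi> (fst x)) \<in> borel_measurable (disc_measure \<alpha> \<Otimes>\<^sub>M disc_measure \<alpha>)"
    "(\<lambda>x. \<phi> (snd x)) \<in> borel_measurable (disc_measure \<alpha> \<Otimes>\<^sub>M disc_measure \<alpha>)"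
    unfolding \<phi>_def by measurable
  have \<phi>: "0 < \<phi> z" if "cmod z < 1" for z
    using that abs_square_less_1[of "cmod z"] by (simp add: \<phi>_def)
  have "\<exists>C>0. \<forall>z. cmod z < 1 \<longrightarrow> (\<integral>\<^sup>+w. ennreal (K z w * \<phi> w powr s) \<partial>disc_measure \<alpha>) \<le> ennreal (C * \<phi> z powr s)"
    if s: "1 < s" "s \<le> p + q" for s
  proof -
    have ts: "0 < t * s" using t s by simp
    obtain C where C: "0 < C" "\<And>z. cmod z < 1 \<Longrightarrow>
      (\<integral>\<^sup>+w. ennreal (cmod (1 - z * cnj w) powr (-(\<alpha> + 2)) * (1 - (cmod w)\<^sup>2) powr (- (t * s))) \<partial>disc_measure \<alpha>)
      \<le> ennreal (C * (1 - (cmod z)\<^sup>2) powr (- (t * s)))"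
      by (rule forelli_rudin[OF \<alpha> ts tlt[OF s(2)]]) (rule that)
    have "(\<integral>\<^sup>+w. ennreal (K z w * \<phi> w powr s) \<partial>disc_measure \<alpha>) \<le> ennreal (C * \<phi> z powr s)" if z: "cmod z < 1" for z
    proof -
      have "(\<integral>\<^sup>+w. ennreal (K z w * \<phi> w powr s) \<partial>disc_measure \<alpha>)
         = (\<integral>\<^sup>+w. ennreal (cmod (1 - z * cnj w) powr (-(\<alpha> + 2)) * (1 - (cmod w)\<^sup>2) powr (- (t * s))) \<partial>disc_measure \<alpha>)"
        by (intro nn_integral_cong)
          (simp add: K_def norm_bergman_kernel[OF \<alpha>] mult_cnj_lt_1[OF z] \<phi>_def powr_powr)
      then show ?thesis using C(2)[OF z] by (simp add: \<phi>_def powr_powr)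
    qed
    then show ?thesis using C(1) by blast
  qed
  from this[of p] this[of q] pq obtain C1 C2 where C: "0 < C1" "0 < C2"
    and C1: "\<And>z. cmod z < 1 \<Longrightarrow> (\<integral>\<^sup>+w. ennreal (K z w * \<phi> w powr p) \<partial>disc_measure \<alpha>) \<le> ennreal (C1 * \<phi> z powr p)"
    and C2: "\<And>z. cmod z < 1 \<Longrightarrow> (\<integral>\<^sup>+w. ennreal (K z w * \<phi> w powr q) \<partial>disc_measure \<alpha>) \<le> ennreal (C2 * \<phi> z powr q)"
    by auto
  \<comment> \<open>The estimates \<open>C1\<close> and \<open>C2\<close> integrate over the second
    argument. In the term \<open>?A\<close> the free variable is z, so there Fubini and this
    symmetry come first; \<open>?B\<close> is integrated over w directly.\<close>
  have sym: "K z w = K w z" if "cmod z < 1" "cmod w < 1" for z w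
    unfolding K_def by (rule norm_bergman_kernel_commute[OF \<alpha> mult_cnj_lt_1[OF that]])
  show thesis
  proof
    show "0 < C1 + C2" using C by simp
    fix u v :: "complex \<Rightarrow> complex"
    assume [measurable]: "u \<in> borel_measurable (disc_measure \<alpha>)" "v \<in> borel_measurable (disc_measure \<alpha>)"
    have [measurable]: "(\<lambda>x. u (fst x)) \<in> borel_measurable (disc_measure \<alpha> \<Otimes>\<^sub>M disc_measure \<alpha>)"
      "(\<lambda>x. u (snd x)) \<in> borel_measurable (disc_measure \<alpha> \<Otimes>\<^sub>M disc_measure \<alpha>)"
      "(\<lambda>x. v (fst x)) \<in> borel_measurable (disc_measure \<alpha> \<Otimes>\<^sub>M disc_measure \<alpha>)"
      by measurable
    let ?A = "\<lambda>z w. ennreal (cmod (u w) powr q / \<phi> w powr q) * ennreal (K z w * \<phi> z powr q)"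
    let ?B = "\<lambda>z w. ennreal (cmod (v z) powr p / \<phi> z powr p) * ennreal (K z w * \<phi> w powr p)"
    have AB: "ennreal (K z w * cmod (u w) * cmod (v z)) \<le> ?A z w + ?B z w" if zw: "cmod z < 1" "cmod w < 1" for z w
    proof -
      note ph = \<phi>[OF zw(1)] \<phi>[OF zw(2)]
      \<comment> \<open>The two weight ratios are mutually inverse and cancel in the product x y.
        Young's inequality separates u from v and leaves with each a power of \<phi> that the kernel
        estimate turns back into the weight cancelling its denominator.\<close>
      define x where "x = cmod (u w) * \<phi> z / \<phi> w"
      define y where "y = cmod (v z) * \<phi> w / \<phi> z"
      have xy: "0 \<le> x" "0 \<le> y" using ph by (simp_all add: x_def y_def)
      have "cmod (u w) * cmod (v z) = y * x" using ph by (simp add: x_def y_def)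
      also have "\<dots> \<le> y powr p / p + x powr q / q" by (rule Youngs_inequality[OF pq xy(2) xy(1)])
      also have "\<dots> \<le> y powr p + x powr q"
        using pq mult_left_mono[of 1 p "y powr p"] mult_left_mono[of 1 q "x powr q"]
        by (intro add_mono) (simp_all add: divide_le_eq)
      finally have "K z w * (cmod (u w) * cmod (v z)) \<le> K z w * (y powr p + x powr q)"
        by (intro mult_left_mono) (simp_all add: K_def)
      also have "\<dots> = cmod (u w) powr q / \<phi> w powr q * (K z w * \<phi> z powr q) + cmod (v z) powr p / \<phi> z powr p * (K z w * \<phi> w powr p)"
        using ph by (simp add: x_def y_def powr_mult powr_divide algebra_simps)
      finally show ?thesis
        using ph by (simp add: ennreal_mult'[symmetric] ennreal_plus[symmetric] K_def mult.assoc del: ennreal_plus)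
    qed
    have "(\<integral>\<^sup>+z. \<integral>\<^sup>+w. ennreal (K z w * cmod (u w) * cmod (v z)) \<partial>disc_measure \<alpha> \<partial>disc_measure \<alpha>)
        \<le> (\<integral>\<^sup>+z. \<integral>\<^sup>+w. ?A z w + ?B z w \<partial>disc_measure \<alpha> \<partial>disc_measure \<alpha>)"
      by (intro nn_integral_mono AB) auto
    also have "\<dots> = (\<integral>\<^sup>+z. \<integral>\<^sup>+w. ?A z w \<partial>disc_measure \<alpha> \<partial>disc_measure \<alpha>) + (\<integral>\<^sup>+z. \<integral>\<^sup>+w. ?B z w \<partial>disc_measure \<alpha> \<partial>disc_measure \<alpha>)"
    proof -
      have "(\<lambda>z. \<integral>\<^sup>+w. ?A z w \<partial>disc_measure \<alpha>) \<in> borel_measurable (disc_measure \<alpha>)"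
        by (rule M.borel_measurable_nn_integral) (simp add: case_prod_unfold)
      moreover have "(\<lambda>z. \<integral>\<^sup>+w. ?B z w \<partial>disc_measure \<alpha>) \<in> borel_measurable (disc_measure \<alpha>)"
        by (rule M.borel_measurable_nn_integral) (simp add: case_prod_unfold)
      ultimately show ?thesis
        by (subst nn_integral_add[symmetric]) (auto intro!: nn_integral_cong nn_integral_add)
    qed
    also have "(\<integral>\<^sup>+z. \<integral>\<^sup>+w. ?A z w \<partial>disc_measure \<alpha> \<partial>disc_measure \<alpha>) \<le> ennreal C2 * (\<integral>\<^sup>+w. ennreal (cmod (u w) powr q) \<partial>disc_measure \<alpha>)"
    proof -
      have "(\<integral>\<^sup>+z. \<integral>\<^sup>+w. ?A z w \<partial>disc_measure \<alpha> \<partial>disc_measure \<alpha>) = (\<integral>\<^sup>+w. \<integral>\<^sup>+z. ?A z w \<partial>disc_measure \<alpha> \<partial>disc_measure \<alpha>)"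
        by (rule MM.Fubini'[symmetric]) (simp add: case_prod_unfold)
      also have "\<dots> = (\<integral>\<^sup>+w. ennreal (cmod (u w) powr q / \<phi> w powr q) * (\<integral>\<^sup>+z. ennreal (K w z * \<phi> z powr q) \<partial>disc_measure \<alpha>) \<partial>disc_measure \<alpha>)"
        by (intro nn_integral_cong, subst nn_integral_cmult[symmetric]) (auto intro!: nn_integral_cong simp: sym)
      also have "\<dots> \<le> (\<integral>\<^sup>+w. ennreal C2 * ennreal (cmod (u w) powr q) \<partial>disc_measure \<alpha>)"
      proof (rule nn_integral_mono)
        fix w assume "w \<in> space (disc_measure \<alpha>)"
        then have w: "cmod w < 1" by simp
        have "ennreal (cmod (u w) powr q / \<phi> w powr q) * (\<integral>\<^sup>+z. ennreal (K w z * \<phi> z powr q) \<partial>disc_measure \<alpha>)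
           \<le> ennreal (cmod (u w) powr q / \<phi> w powr q) * ennreal (C2 * \<phi> w powr q)"
          by (intro mult_left_mono C2 w) auto
        also have "\<dots> = ennreal C2 * ennreal (cmod (u w) powr q)"
          using \<phi>[OF w] C by (simp add: ennreal_mult'[symmetric] mult.commute)
        finally show "ennreal (cmod (u w) powr q / \<phi> w powr q) * (\<integral>\<^sup>+z. ennreal (K w z * \<phi> z powr q) \<partial>disc_measure \<alpha>) \<le> \<dots>" .
      qed
      also have "\<dots> = ennreal C2 * (\<integral>\<^sup>+w. ennreal (cmod (u w) powr q) \<partial>disc_measure \<alpha>)"
        by (rule nn_integral_cmult) measurable
      finally show ?thesis .
    qed
    also have "(\<integral>\<^sup>+z. \<integral>\<^sup>+w. ?B z w \<partial>disc_measure \<alpha> \<partial>disc_measure \<alpha>) \<le> ennreal C1 * (\<integral>\<^sup>+z. ennreal (cmod (v z) powr p) \<partial>disc_measure \<alpha>)"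
    proof -
      have "(\<integral>\<^sup>+z. \<integral>\<^sup>+w. ?B z w \<partial>disc_measure \<alpha> \<partial>disc_measure \<alpha>) = 
          (\<integral>\<^sup>+z. ennreal (cmod (v z) powr p / \<phi> z powr p) * (\<integral>\<^sup>+w. ennreal (K z w * \<phi> w powr p) \<partial>disc_measure \<alpha>) \<partial>disc_measure \<alpha>)"
        by (intro nn_integral_cong nn_integral_cmult) measurable
      also have "\<dots> \<le> (\<integral>\<^sup>+z. ennreal C1 * ennreal (cmod (v z) powr p) \<partial>disc_measure \<alpha>)"
      proof (rule nn_integral_mono)
        fix z assume "z \<in> space (disc_measure \<alpha>)"
        then have z: "cmod z < 1" by simp
        have "ennreal (cmod (v z) powr p / \<phi> z powr p) * (\<integral>\<^sup>+w. ennreal (K z w * \<phi> w powr p) \<partial>disc_measure \<alpha>)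
           \<le> ennreal (cmod (v z) powr p / \<phi> z powr p) * ennreal (C1 * \<phi> z powr p)"
          by (intro mult_left_mono C1 z) auto
        also have "\<dots> = ennreal C1 * ennreal (cmod (v z) powr p)"
          using \<phi>[OF z] C by (simp add: ennreal_mult'[symmetric] mult.commute)
        finally show "ennreal (cmod (v z) powr p / \<phi> z powr p) * (\<integral>\<^sup>+w. ennreal (K z w * \<phi> w powr p) \<partial>disc_measure \<alpha>) \<le> \<dots>" .
      qed
      also have "\<dots> = ennreal C1 * (\<integral>\<^sup>+z. ennreal (cmod (v z) powr p) \<partial>disc_measure \<alpha>)"
        by (rule nn_integral_cmult) measurable
      finally show ?thesis .
    qed
    also have "ennreal C2 * (\<integral>\<^sup>+w. ennreal (cmod (u w) powr q) \<partial>disc_measure \<alpha>) + ennreal C1 * (\<integral>\<^sup>+z. ennreal (cmod (v z) powr p) \<partial>disc_measure \<alpha>)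
      \<le> ennreal (C1 + C2) * (\<integral>\<^sup>+w. ennreal (cmod (u w) powr q) \<partial>disc_measure \<alpha>) + ennreal (C1 + C2) * (\<integral>\<^sup>+z. ennreal (cmod (v z) powr p) \<partial>disc_measure \<alpha>)"
      using C by (intro add_mono mult_right_mono) (auto intro!: ennreal_leI)
    finally show "(\<integral>\<^sup>+z. \<integral>\<^sup>+w. ennreal (cmod (bergman_kernel \<alpha> z w) * cmod (u w) * cmod (v z)) \<partial>disc_measure \<alpha> \<partial>disc_measure \<alpha>)
      \<le> ennreal (C1 + C2) * ((\<integral>\<^sup>+w. ennreal (cmod (u w) powr q) \<partial>disc_measure \<alpha>) + (\<integral>\<^sup>+z. ennreal (cmod (v z) powr p) \<partial>disc_measure \<alpha>))"
      by (simp add: K_def distrib_left add_mono)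
  qed
qed

lemma powr_conjugate:
  fixes p q :: real
  assumes "1 < p" "1 < q" "1 / p + 1 / q = 1"
  shows "(p - 1) * q = p" "(q - 1) * p = q"
  using assms by (simp_all add: field_simps)

lemma nn_integral_weighted_Lp:
  "f \<in> weighted_Lp s \<alpha> \<Longrightarrow>
    (\<integral>\<^sup>+z. ennreal (cmod (f z) powr s) \<partial>disc_measure \<alpha>) = ennreal (\<integral>z. cmod (f z) powr s \<partial>disc_measure \<alpha>)"
  by (intro nn_integral_eq_integral weighted_Lp_integrable) auto

text \<open>
  Testing the bilinear bound on \<open>|T u|\<close> to the power \<open>q - 1\<close>, cut off to \<open>|z| \<le> r\<close> so that its norm is finite,
  gives an estimate whose right-hand side can be absorbed uniformly in \<open>r\<close>.
\<close>

lemma bergman_op_bounded: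
  assumes \<alpha>: "-1 < \<alpha>" and q: "1 < q"
  obtains C where "0 < C" "\<And>u. u \<in> weighted_Lp q \<alpha> \<Longrightarrow> bergman_op \<alpha> u \<in> bergman_space q \<alpha>"
    "\<And>u. u \<in> weighted_Lp q \<alpha> \<Longrightarrow>
      (\<integral>z. cmod (bergman_op \<alpha> u z) powr q \<partial>disc_measure \<alpha>) \<le> C * (\<integral>z. cmod (u z) powr q \<partial>disc_measure \<alpha>)"
proof -
  interpret M: finite_measure "disc_measure \<alpha>"
    by (rule finite_measure_disc_measure[OF \<alpha>])
  define p where "p = q / (q - 1)"
  have pq: "1 < p" "1 < q" "1 / p + 1 / q = 1" using q by (simp_all add: p_def field_simps)
  obtain C where C: "0 < C"
    and schur: "\<And>u v. u \<in> borel_measurable (disc_measure \<alpha>) \<Longrightarrow> v \<in> borel_measurable (disc_measure \<alpha>) \<Longrightarrow>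
      (\<integral>\<^sup>+z. \<integral>\<^sup>+w. ennreal (cmod (bergman_kernel \<alpha> z w) * cmod (u w) * cmod (v z)) \<partial>disc_measure \<alpha> \<partial>disc_measure \<alpha>)
      \<le> ennreal C * ((\<integral>\<^sup>+w. ennreal (cmod (u w) powr q) \<partial>disc_measure \<alpha>) + (\<integral>\<^sup>+z. ennreal (cmod (v z) powr p) \<partial>disc_measure \<alpha>))"
    by (rule bergman_kernel_schur[OF \<alpha> pq]) (rule that)
  \<comment> \<open>The bilinear bound is a sum and not a product of norms, so the two arguments may
    be rescaled by s and 1 / s. With s^p = 2 C the term of the test function becomes half of the
    left-hand side.\<close>
  define s where "s = (2 * C) powr (1 / p)"
  have s: "0 < s" using C by (simp add: s_def)
  have sp: "s powr p = 2 * C" using C pq by (simp add: s_def powr_powr)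
  define D where "D = 2 * C * s powr q"
  have D: "0 < D" using C s by (simp add: D_def)
  have main: "(\<integral>\<^sup>+z. ennreal (cmod (bergman_op \<alpha> u z) powr q) \<partial>disc_measure \<alpha>) \<le> ennreal (D * (\<integral>z. cmod (u z) powr q \<partial>disc_measure \<alpha>))"
    and hol: "bergman_op \<alpha> u holomorphic_on ball 0 1" if u: "u \<in> weighted_Lp q \<alpha>" for u
  proof -
    let ?g = "bergman_op \<alpha> u"
    define U where "U = (\<integral>z. cmod (u z) powr q \<partial>disc_measure \<alpha>)"
    have U: "0 \<le> U" by (simp add: U_def)
    note ui = weighted_Lp_integrable_1[OF \<alpha> u less_imp_le[OF q]]
    note [measurable] = weighted_Lp_measurable[OF u]
    show hol: "?g holomorphic_on ball 0 1" by (rule bergman_op_holomorphic[OF \<alpha> ui])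
    note [measurable] = holomorphic_measurable_disc[OF hol]
    have X: "(\<integral>\<^sup>+z. ennreal (cmod (?g z) powr q * indicator (cball 0 r) z) \<partial>disc_measure \<alpha>) \<le> ennreal (D * U)"
      if r: "r < 1" for r
    proof -
      have [measurable]: "indicator (cball 0 r) \<in> borel_measurable (disc_measure \<alpha>)"
        by (intro measurable_disc_measureI borel_measurable_indicator) simp
      \<comment> \<open>Holomorphic functions are bounded on this smaller closed disc, so x below is
        finite even though membership of ?g in L^q is not yet known. Otherwise x / 2 could not be
        subtracted.\<close>
      have "compact (?g ` cball 0 r)"
        using r by (intro compact_continuous_image holomorphic_on_imp_continuous_on holomorphic_on_subset[OF hol]) auto
      then obtain B where B: "\<And>z. z \<in> cball 0 r \<Longrightarrow> cmod (?g z) \<le> B"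
        using compact_imp_bounded bounded_iff by (metis imageI)
      have gi: "integrable (disc_measure \<alpha>) (\<lambda>z. cmod (?g z) powr q * indicator (cball 0 r) z)"
      proof (rule M.integrable_const_bound[where B = "\<bar>B\<bar> powr q"])
        show "AE z in disc_measure \<alpha>. norm (cmod (?g z) powr q * indicator (cball 0 r) z) \<le> \<bar>B\<bar> powr q"
          using q by (intro AE_I2) (auto simp: indicator_def intro!: powr_mono2 order_trans[OF B])
      qed measurable
      define x where "x = (\<integral>z. cmod (?g z) powr q * indicator (cball 0 r) z \<partial>disc_measure \<alpha>)"
      have nx: "(\<integral>\<^sup>+z. ennreal (cmod (?g z) powr q * indicator (cball 0 r) z) \<partial>disc_measure \<alpha>) = ennreal x"
        unfolding x_def by (intro nn_integral_eq_integral gi) auto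
      have x0: "0 \<le> x" by (simp add: x_def)
      \<comment> \<open>Its product with s |?g| is |?g|^q on the smaller disc, and so is, up to the
        factor 1 / (2 C), its p-th power, because (q - 1) p = q.\<close>
      define v where "v z = complex_of_real (cmod (?g z) powr (q - 1) * indicator (cball 0 r) z / s)" for z
      have nv: "cmod (v z) = cmod (?g z) powr (q - 1) * indicator (cball 0 r) z / s" for z
        unfolding v_def norm_of_real using s by simp
      have [measurable]: "v \<in> borel_measurable (disc_measure \<alpha>)" unfolding v_def by measurable
      have "ennreal x \<le> (\<integral>\<^sup>+z. \<integral>\<^sup>+w. ennreal (cmod (bergman_kernel \<alpha> z w) * cmod (of_real s * u w) * cmod (v z)) \<partial>disc_measure \<alpha> \<partial>disc_measure \<alpha>)"
        unfolding nx[symmetric]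
      proof (rule nn_integral_mono)
        fix z assume "z \<in> space (disc_measure \<alpha>)"
        then have z: "cmod z < 1" by simp
        have mk: "(\<lambda>w. bergman_kernel \<alpha> z w) \<in> borel_measurable (disc_measure \<alpha>)"
          by (rule measurable_bergman_kernel1[OF \<alpha>])
        note [measurable] = mk
        have "ennreal (cmod (?g z)) \<le> (\<integral>\<^sup>+w. ennreal (cmod (bergman_kernel \<alpha> z w * u w)) \<partial>disc_measure \<alpha>)"
        proof (cases "integrable (disc_measure \<alpha>) (\<lambda>w. bergman_kernel \<alpha> z w * u w)")
          case True
          then show ?thesis unfolding bergman_op_kernel[OF \<alpha> ui z] by (rule integral_norm_bound_ennreal)
        next
          \<comment> \<open>The Bochner integral of a non-integrable function is 0, so the bound is
            trivial.\<close>
          case False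
          then show ?thesis unfolding bergman_op_kernel[OF \<alpha> ui z] by (simp add: not_integrable_integral_eq)
        qed
        then have "ennreal (cmod (v z) * s) * ennreal (cmod (?g z)) \<le>
            ennreal (cmod (v z) * s) * (\<integral>\<^sup>+w. ennreal (cmod (bergman_kernel \<alpha> z w * u w)) \<partial>disc_measure \<alpha>)"
          by (intro mult_left_mono) auto
        also have "\<dots> = (\<integral>\<^sup>+w. ennreal (cmod (v z) * s) * ennreal (cmod (bergman_kernel \<alpha> z w * u w)) \<partial>disc_measure \<alpha>)"
          by (rule nn_integral_cmult[symmetric]) measurable
        also have "\<dots> = (\<integral>\<^sup>+w. ennreal (cmod (bergman_kernel \<alpha> z w) * cmod (of_real s * u w) * cmod (v z)) \<partial>disc_measure \<alpha>)"
          using s by (intro nn_integral_cong) (simp add: ennreal_mult'[symmetric] norm_mult mult_ac)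
        also have "ennreal (cmod (v z) * s) * ennreal (cmod (?g z)) = ennreal (cmod (?g z) powr q * indicator (cball 0 r) z)"
        proof (cases "?g z = 0")
          case False
          then have "cmod (?g z) powr q = cmod (?g z) powr (q - 1) * cmod (?g z)"
            by (simp add: powr_diff)
          then show ?thesis
            using s by (simp add: nv ennreal_mult'[symmetric] indicator_def)
        qed (use q in simp)
        finally show "ennreal (cmod (?g z) powr q * indicator (cball 0 r) z) \<le> 
          (\<integral>\<^sup>+w. ennreal (cmod (bergman_kernel \<alpha> z w) * cmod (of_real s * u w) * cmod (v z)) \<partial>disc_measure \<alpha>)" .
      qed
      also have "\<dots> \<le> ennreal C * ((\<integral>\<^sup>+w. ennreal (cmod (of_real s * u w) powr q) \<partial>disc_measure \<alpha>) + (\<integral>\<^sup>+z. ennreal (cmod (v z) powr p) \<partial>disc_measure \<alpha>))"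
        by (rule schur) measurable
      also have "(\<integral>\<^sup>+w. ennreal (cmod (of_real s * u w) powr q) \<partial>disc_measure \<alpha>) = ennreal (s powr q * U)"
        using nn_integral_weighted_Lp[OF weighted_Lp_cmult[OF u, of "of_real s"]] s
        by (simp add: norm_mult powr_mult U_def)
      also have "(\<integral>\<^sup>+z. ennreal (cmod (v z) powr p) \<partial>disc_measure \<alpha>) = ennreal (x / (2 * C))"
      proof -
        have "cmod (v z) powr p = (1 / (2 * C)) * (cmod (?g z) powr q * indicator (cball 0 r) z)" for z
          using s pq(1) powr_conjugate(2)[OF pq] C
          by (simp add: nv powr_divide powr_mult powr_powr sp indicator_def)
        then have "(\<integral>\<^sup>+z. ennreal (cmod (v z) powr p) \<partial>disc_measure \<alpha>) = 
            (\<integral>\<^sup>+z. ennreal (1 / (2 * C)) * ennreal (cmod (?g z) powr q * indicator (cball 0 r) z) \<partial>disc_measure \<alpha>)"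
          using C by (simp add: ennreal_mult'[symmetric])
        also have "\<dots> = ennreal (1 / (2 * C)) * ennreal x"
          by (subst nn_integral_cmult) (simp_all add: nx)
        also have "\<dots> = ennreal (x / (2 * C))" using C x0 by (simp add: ennreal_mult'[symmetric])
        finally show ?thesis .
      qed
      also have "ennreal C * (ennreal (s powr q * U) + ennreal (x / (2 * C))) = ennreal (C * (s powr q * U + x / (2 * C)))"
        using C x0 U by (simp add: ennreal_mult'[symmetric] ennreal_plus[symmetric] del: ennreal_plus)
      finally have "x \<le> C * (s powr q * U + x / (2 * C))"
        using C x0 U by (subst (asm) ennreal_le_iff) auto
      then have "x \<le> D * U" using C by (simp add: D_def field_simps)
      then show ?thesis unfolding nx by (rule ennreal_leI)
    qed
    \<comment> \<open>The bound D U does not depend on r, so letting the radius tend to 1 with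
      Fatou's lemma extends it to the whole disc.\<close>
    define R where "R k = 1 - 1 / (real k + 2)" for k
    have [measurable]: "indicator (cball 0 (R k)) \<in> borel_measurable (disc_measure \<alpha>)" for k
      by (intro measurable_disc_measureI borel_measurable_indicator) simp
    have "(\<integral>\<^sup>+z. ennreal (cmod (?g z) powr q) \<partial>disc_measure \<alpha>) = 
        (\<integral>\<^sup>+z. liminf (\<lambda>k. ennreal (cmod (?g z) powr q * indicator (cball 0 (R k)) z)) \<partial>disc_measure \<alpha>)"
    proof (rule nn_integral_cong)
      fix z assume "z \<in> space (disc_measure \<alpha>)"
      then have z: "cmod z < 1" by simp
      have "R \<longlonglongrightarrow> 1" unfolding R_def by real_asymp
      then have "eventually (\<lambda>k. R k > cmod z) sequentially" using z by (rule order_tendstoD)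
      then have "eventually (\<lambda>k. ennreal (cmod (?g z) powr q * indicator (cball 0 (R k)) z) = ennreal (cmod (?g z) powr q)) sequentially"
        by eventually_elim simp
      from lim_imp_Liminf[OF _ tendsto_eventually[OF this]]
      show "ennreal (cmod (?g z) powr q) = liminf (\<lambda>k. ennreal (cmod (?g z) powr q * indicator (cball 0 (R k)) z))"
        by simp
    qed
    also have "\<dots> \<le> liminf (\<lambda>k. \<integral>\<^sup>+z. ennreal (cmod (?g z) powr q * indicator (cball 0 (R k)) z) \<partial>disc_measure \<alpha>)"
      by (rule nn_integral_liminf) measurable
    also have "\<dots> \<le> liminf (\<lambda>k::nat. ennreal (D * U))"
      by (intro Liminf_mono always_eventually allI X) (simp add: R_def)
    also have "\<dots> = ennreal (D * U)" by (simp add: Liminf_const)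
    finally show "(\<integral>\<^sup>+z. ennreal (cmod (?g z) powr q) \<partial>disc_measure \<alpha>) \<le> ennreal (D * (\<integral>z. cmod (u z) powr q \<partial>disc_measure \<alpha>))"
      by (simp add: U_def)
  qed
  have sp: "bergman_op \<alpha> u \<in> bergman_space q \<alpha>" if u: "u \<in> weighted_Lp q \<alpha>" for u
  proof -
    note [measurable] = holomorphic_measurable_disc[OF hol[OF u], of \<alpha>]
    have "integrable (disc_measure \<alpha>) (\<lambda>z. cmod (bergman_op \<alpha> u z) powr q)"
    proof (rule integrableI_bounded)
      show "(\<integral>\<^sup>+z. ennreal (norm (cmod (bergman_op \<alpha> u z) powr q)) \<partial>disc_measure \<alpha>) < \<infinity>"
        using main[OF u] by (simp add: order.strict_trans1)
    qed measurable
    then show ?thesis using hol[OF u] by (simp add: bergman_space_def weighted_Lp_def)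
  qed
  show thesis
  proof
    fix u assume u: "u \<in> weighted_Lp q \<alpha>"
    show "(\<integral>z. cmod (bergman_op \<alpha> u z) powr q \<partial>disc_measure \<alpha>) \<le> D * (\<integral>z. cmod (u z) powr q \<partial>disc_measure \<alpha>)"
      using main[OF u] D unfolding nn_integral_weighted_Lp[OF bergman_space_weighted_Lp[OF sp[OF u]]]
      by (subst (asm) ennreal_le_iff) auto
  qed (use D sp in auto)
qed

text \<open>The kernel is Hermitian, so only the interchange of the two integrals is at stake.
  Schur's bound, with moduli inside the double integral, is precisely the absolute integrability
  that Fubini asks for.\<close>

lemma bergman_op_adjoint:
  assumes \<alpha>: "-1 < \<alpha>" and pq: "1 < p" "1 < q" "1 / p + 1 / q = 1"
    and u: "u \<in> weighted_Lp q \<alpha>" and v: "v \<in> weighted_Lp p \<alpha>"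
  shows "disc_pairing \<alpha> (bergman_op \<alpha> u) v = disc_pairing \<alpha> u (bergman_op \<alpha> v)"
proof -
  interpret M: finite_measure "disc_measure \<alpha>"
    by (rule finite_measure_disc_measure[OF \<alpha>])
  interpret MM: pair_sigma_finite "disc_measure \<alpha>" "disc_measure \<alpha>" ..
  note [measurable] = measurable_bergman_kernel_pair[OF \<alpha>] measurable_cnj[OF \<alpha>]
    weighted_Lp_measurable[OF u] weighted_Lp_measurable[OF v]
  note ui = weighted_Lp_integrable_1[OF \<alpha> u less_imp_le[OF pq(2)]]
  note vi = weighted_Lp_integrable_1[OF \<alpha> v less_imp_le[OF pq(1)]]
  let ?f = "\<lambda>z w. bergman_kernel \<alpha> z w * u w * cnj (v z)"
  obtain C where C: "0 < C"
    and schur: "\<And>u v. u \<in> borel_measurable (disc_measure \<alpha>) \<Longrightarrow> v \<in> borel_measurable (disc_measure \<alpha>) \<Longrightarrow>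
      (\<integral>\<^sup>+z. \<integral>\<^sup>+w. ennreal (cmod (bergman_kernel \<alpha> z w) * cmod (u w) * cmod (v z)) \<partial>disc_measure \<alpha> \<partial>disc_measure \<alpha>)
      \<le> ennreal C * ((\<integral>\<^sup>+w. ennreal (cmod (u w) powr q) \<partial>disc_measure \<alpha>) + (\<integral>\<^sup>+z. ennreal (cmod (v z) powr p) \<partial>disc_measure \<alpha>))"
    by (rule bergman_kernel_schur[OF \<alpha> pq]) (rule that)
  have int: "integrable (disc_measure \<alpha> \<Otimes>\<^sub>M disc_measure \<alpha>) (case_prod ?f)"
  proof (rule integrableI_bounded)
    show m: "case_prod ?f \<in> borel_measurable (disc_measure \<alpha> \<Otimes>\<^sub>M disc_measure \<alpha>)"
      unfolding case_prod_unfold by measurable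
    have "(\<integral>\<^sup>+x. ennreal (norm (case_prod ?f x)) \<partial>(disc_measure \<alpha> \<Otimes>\<^sub>M disc_measure \<alpha>)) = 
      (\<integral>\<^sup>+z. \<integral>\<^sup>+w. ennreal (norm (?f z w)) \<partial>disc_measure \<alpha> \<partial>disc_measure \<alpha>)"
      using m by (subst M.nn_integral_fst[symmetric]) auto
    also have "\<dots> \<le> ennreal C * ((\<integral>\<^sup>+w. ennreal (cmod (u w) powr q) \<partial>disc_measure \<alpha>) + (\<integral>\<^sup>+z. ennreal (cmod (v z) powr p) \<partial>disc_measure \<alpha>))"
      using schur[of u v] by (simp add: norm_mult)
    also have "\<dots> < \<infinity>"
      by (simp add: nn_integral_weighted_Lp[OF u] nn_integral_weighted_Lp[OF v] ennreal_mult_less_top)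
    finally show "(\<integral>\<^sup>+x. ennreal (norm (case_prod ?f x)) \<partial>(disc_measure \<alpha> \<Otimes>\<^sub>M disc_measure \<alpha>)) < \<infinity>" .
  qed
  have "disc_pairing \<alpha> (bergman_op \<alpha> u) v = (\<integral>z. \<integral>w. ?f z w \<partial>disc_measure \<alpha> \<partial>disc_measure \<alpha>)"
    unfolding disc_pairing_def
    by (intro Bochner_Integration.integral_cong) (simp_all add: bergman_op_kernel[OF \<alpha> ui])
  also have "\<dots> = (\<integral>w. \<integral>z. ?f z w \<partial>disc_measure \<alpha> \<partial>disc_measure \<alpha>)"
    by (rule MM.Fubini_integral[OF int, symmetric])
  also have "\<dots> = disc_pairing \<alpha> u (bergman_op \<alpha> v)"
    unfolding disc_pairing_def
  proof (rule Bochner_Integration.integral_cong[OF refl])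
    fix w assume "w \<in> space (disc_measure \<alpha>)"
    then have w: "cmod w < 1" by simp
    have "(\<integral>z. ?f z w \<partial>disc_measure \<alpha>) = (\<integral>z. u w * cnj (bergman_kernel \<alpha> w z * v z) \<partial>disc_measure \<alpha>)"
      by (rule Bochner_Integration.integral_cong[OF refl])
         (simp add: cnj_bergman_kernel[OF \<alpha> mult_cnj_lt_1[OF w]] mult_ac)
    also have "\<dots> = u w * cnj (\<integral>z. bergman_kernel \<alpha> w z * v z \<partial>disc_measure \<alpha>)"
      by (simp only: integral_mult_right_zero Bochner_Integration.integral_cnj)
    finally show "(\<integral>z. ?f z w \<partial>disc_measure \<alpha>) = u w * cnj (bergman_op \<alpha> v w)"
      by (simp add: bergman_op_kernel[OF \<alpha> vi w])
  qed
  finally show ?thesis .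
qed

section \<open>Identification of the Bergman projection\<close>

text \<open>The extension by 0 agrees with the normalisation off the disc in both definite
  descriptions, so that equality of total functions can be proved.\<close>

definition bergman_op0 :: "real \<Rightarrow> (complex \<Rightarrow> complex) \<Rightarrow> complex \<Rightarrow> complex" where
  "bergman_op0 \<alpha> u z = (if z \<in> ball 0 1 then bergman_op \<alpha> u z else 0)"

lemma bergman_space_cong:
  assumes "\<And>z. z \<in> ball 0 1 \<Longrightarrow> f z = g z"
  shows "f \<in> bergman_space s \<alpha> \<longleftrightarrow> g \<in> bergman_space s \<alpha>"
proof -
  have "f holomorphic_on ball 0 1 \<longleftrightarrow> g holomorphic_on ball 0 1"
    by (rule holomorphic_cong) (use assms in auto)
  moreover have "f \<in> borel_measurable (disc_measure \<alpha>) \<longleftrightarrow> g \<in> borel_measurable (disc_measure \<alpha>)"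
    by (rule measurable_cong) (use assms in simp)
  moreover have "integrable (disc_measure \<alpha>) (\<lambda>z. cmod (f z) powr s) \<longleftrightarrow> integrable (disc_measure \<alpha>) (\<lambda>z. cmod (g z) powr s)"
    by (rule Bochner_Integration.integrable_cong) (use assms in simp_all)
  ultimately show ?thesis by (simp add: bergman_space_def weighted_Lp_def)
qed

lemma disc_integral_cong:
  fixes f g :: "complex \<Rightarrow> 'a::{banach, second_countable_topology}"
  shows "(\<And>z. cmod z < 1 \<Longrightarrow> f z = g z) \<Longrightarrow> (\<integral>z. f z \<partial>disc_measure \<alpha>) = (\<integral>z. g z \<partial>disc_measure \<alpha>)"
  by (intro Bochner_Integration.integral_cong) auto

lemma weighted_norm_powr:
  "0 < s \<Longrightarrow> weighted_norm s \<alpha> f powr s = (\<integral>z. cmod (f z) powr s \<partial>disc_measure \<alpha>)"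
  by (simp add: weighted_norm_def powr_powr)

lemma weighted_norm_nonneg [simp]: "0 \<le> weighted_norm s \<alpha> f"
  by (simp add: weighted_norm_def)

text \<open>Limits are taken with integrals of s-th powers, for which the crude inequality
  \<open>powr_add_le\<close> does the job of Minkowski's.\<close>

lemma weighted_norm_tendsto_0_iff:
  assumes s: "0 < s"
  shows "(\<lambda>n::nat. weighted_norm s \<alpha> (f n)) \<longlonglongrightarrow> 0
    \<longleftrightarrow> (\<lambda>n. \<integral>z. cmod (f n z) powr s \<partial>disc_measure \<alpha>) \<longlonglongrightarrow> 0" (is "?L \<longleftrightarrow> ?R")
proof
  assume ?L
  then have "(\<lambda>n. weighted_norm s \<alpha> (f n) powr s) \<longlonglongrightarrow> 0"
    using s by (intro tendsto_zero_powrI[OF _ tendsto_const]) auto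
  then show ?R by (simp add: weighted_norm_powr[OF s])
next
  assume ?R
  then show ?L unfolding weighted_norm_def
    using s by (intro tendsto_zero_powrI[OF _ tendsto_const]) auto
qed

lemma bergman_op0_eq [simp]: "cmod z < 1 \<Longrightarrow> bergman_op0 \<alpha> u z = bergman_op \<alpha> u z"
  and bergman_op0_outside [simp]: "1 \<le> cmod z \<Longrightarrow> bergman_op0 \<alpha> u z = 0"
  by (simp_all add: bergman_op0_def)

lemma bergman_op0_space:
  assumes \<alpha>: "-1 < \<alpha>" and q: "1 < q" and u: "u \<in> weighted_Lp q \<alpha>"
  shows "bergman_op0 \<alpha> u \<in> bergman_space q \<alpha>"
proof -
  have "bergman_op \<alpha> u \<in> bergman_space q \<alpha>"
    by (rule bergman_op_bounded[OF \<alpha> q]) (use u in blast)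
  then show ?thesis by (subst bergman_space_cong[where g = "bergman_op \<alpha> u"]) auto
qed

text \<open>Symmetry moves the operator onto the analytic test function f, which it fixes; hence u
  minus its image is orthogonal to f. Two candidates differ by an analytic function orthogonal to
  itself, so they agree on the disc, and off it both are 0.\<close>

lemma bergman_proj_L2_eq:
  assumes \<alpha>: "-1 < \<alpha>" and u: "u \<in> weighted_Lp 2 \<alpha>"
  shows "bergman_proj_L2 \<alpha> u = bergman_op0 \<alpha> u"
proof -
  have two: "(1::real) < 2" "1 < (2::real)" "1 / 2 + 1 / 2 = (1::real)" by auto
  let ?P = "\<lambda>g. g \<in> bergman_space 2 \<alpha> \<and> (\<forall>z. z \<notin> ball 0 1 \<longrightarrow> g z = 0) \<and>
     (\<forall>f\<in>bergman_space 2 \<alpha>. disc_pairing \<alpha> (\<lambda>z. u z - g z) f = 0)"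
  have pair: "disc_pairing \<alpha> (\<lambda>z. u z - g z) f = disc_pairing \<alpha> u f - disc_pairing \<alpha> g f"
    if "g \<in> bergman_space 2 \<alpha>" "f \<in> bergman_space 2 \<alpha>" for f g
    unfolding disc_pairing_def left_diff_distrib
    by (intro Bochner_Integration.integral_diff integrable_mult_cnj[OF _ _ two] u bergman_space_weighted_Lp that)
  have op: "bergman_op0 \<alpha> u \<in> bergman_space 2 \<alpha>" by (rule bergman_op0_space[OF \<alpha> two(1) u])
  have op_pair: "disc_pairing \<alpha> (bergman_op0 \<alpha> u) f = disc_pairing \<alpha> u f" if f: "f \<in> bergman_space 2 \<alpha>" for f
  proof -
    note fL = bergman_space_weighted_Lp[OF f]
    have "disc_pairing \<alpha> (bergman_op0 \<alpha> u) f = disc_pairing \<alpha> (bergman_op \<alpha> u) f"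
      unfolding disc_pairing_def by (intro disc_integral_cong) simp
    also have "\<dots> = disc_pairing \<alpha> u (bergman_op \<alpha> f)"
      by (rule bergman_op_adjoint[OF \<alpha> two u fL])
    also have "\<dots> = disc_pairing \<alpha> u f"
      unfolding disc_pairing_def
      by (intro disc_integral_cong)
        (simp add: bergman_op_reproducing[OF \<alpha> bergman_space_holomorphic[OF f] weighted_Lp_integrable_1[OF \<alpha> fL]])
    finally show ?thesis .
  qed
  have "?P (bergman_op0 \<alpha> u)"
    using op op_pair pair by (simp add: not_less)
  moreover have "g = bergman_op0 \<alpha> u" if g: "?P g" for g
  proof
    fix z
    define d where "d z = g z - bergman_op0 \<alpha> u z" for z
    have d: "d \<in> bergman_space 2 \<alpha>"
      unfolding d_def using g op by (intro bergman_space_diff) auto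
    note dL = bergman_space_weighted_Lp[OF d]
    have "disc_pairing \<alpha> d d = disc_pairing \<alpha> g d - disc_pairing \<alpha> (bergman_op0 \<alpha> u) d"
      unfolding disc_pairing_def left_diff_distrib d_def
      using g op d unfolding d_def
      by (intro Bochner_Integration.integral_diff integrable_mult_cnj[OF _ _ two] bergman_space_weighted_Lp) auto
    also have "\<dots> = 0" using g pair[OF _ d, of g] op_pair[OF d] d by auto
    finally have "disc_pairing \<alpha> d d = 0" .
    moreover have "disc_pairing \<alpha> d d = complex_of_real (\<integral>z. cmod (d z) powr 2 \<partial>disc_measure \<alpha>)"
    proof -
      have "d z * cnj (d z) = complex_of_real (cmod (d z) powr 2)" for z
        by (subst powr_numeral) (simp_all only: complex_norm_square norm_ge_zero)
      then show ?thesis by (simp only: disc_pairing_def integral_complex_of_real)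
    qed
    ultimately have "(\<integral>z. cmod (d z) powr 2 \<partial>disc_measure \<alpha>) = 0" by simp
    then have "AE z in disc_measure \<alpha>. cmod (d z) powr 2 = 0"
      using integral_nonneg_eq_0_iff_AE[OF weighted_Lp_integrable[OF dL]] by simp
    then have "AE z in disc_measure \<alpha>. d z = 0" by eventually_elim simp
    then have "d z = 0" if "cmod z < 1"
      using holomorphic_AE_zero[OF \<alpha> bergman_space_holomorphic[OF d]] that by blast
    then show "g z = bergman_op0 \<alpha> u z"
      using g by (cases "cmod z < 1") (auto simp: d_def bergman_op0_def)
  qed
  ultimately show ?thesis unfolding bergman_proj_L2_def by (rule the_equality)
qed

lemma weighted_Lp_bounded:
  assumes \<alpha>: "-1 < \<alpha>" and [measurable]: "f \<in> borel_measurable (disc_measure \<alpha>)"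
    and B: "\<And>z. cmod z < 1 \<Longrightarrow> cmod (f z) \<le> B" and s: "0 \<le> s"
  shows "f \<in> weighted_Lp s \<alpha>"
proof -
  interpret finite_measure "disc_measure \<alpha>" by (rule finite_measure_disc_measure[OF \<alpha>])
  have "integrable (disc_measure \<alpha>) (\<lambda>z. cmod (f z) powr s)"
    by (rule integrable_const_bound[where B = "B powr s"]) (use s B in \<open>auto intro!: AE_I2 powr_mono2\<close>)
  then show ?thesis by (simp add: weighted_Lp_def)
qed

text \<open>By linearity the projection of u n differs from the image of h by the image of u n - h,
  which the L^q bound controls. Hence \<open>conv\<close>: along every admissible sequence the
  projections tend to the same limit. Existence then needs just one sequence, and uniqueness follows
  by comparing g with that limit.\<close>

lemma bergman_proj_eq:
  assumes \<alpha>: "-1 < \<alpha>" and q: "1 < q" and h: "h \<in> weighted_Lp q \<alpha>"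
  shows "bergman_proj q \<alpha> h = bergman_op0 \<alpha> h"
proof -
  have q0: "0 < q" "0 \<le> q" "1 \<le> q" using q by auto
  note hm [measurable] = weighted_Lp_measurable[OF h]
  have int: "integrable (disc_measure \<alpha>) f" if "f \<in> weighted_Lp q \<alpha>" for f
    by (rule weighted_Lp_integrable_1[OF \<alpha> that q0(3)])
  obtain C where C: "0 < C" and opsp: "\<And>u. u \<in> weighted_Lp q \<alpha> \<Longrightarrow> bergman_op \<alpha> u \<in> bergman_space q \<alpha>"
    and bd: "\<And>u. u \<in> weighted_Lp q \<alpha> \<Longrightarrow>
      (\<integral>z. cmod (bergman_op \<alpha> u z) powr q \<partial>disc_measure \<alpha>) \<le> C * (\<integral>z. cmod (u z) powr q \<partial>disc_measure \<alpha>)"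
    by (rule bergman_op_bounded[OF \<alpha> q]) (rule that)
  let ?Q = "\<lambda>g u. (\<forall>n. u n \<in> weighted_Lp q \<alpha> \<inter> weighted_Lp 2 \<alpha> \<and>
             bergman_proj_L2 \<alpha> (u n) \<in> bergman_space q \<alpha>) \<and>
        (\<lambda>n. weighted_norm q \<alpha> (\<lambda>z. u n z - h z)) \<longlonglongrightarrow> 0 \<and>
        (\<lambda>n. weighted_norm q \<alpha> (\<lambda>z. bergman_proj_L2 \<alpha> (u n) z - g z)) \<longlonglongrightarrow> 0"
  have conv: "(\<lambda>n. \<integral>z. cmod (bergman_proj_L2 \<alpha> (u n) z - bergman_op \<alpha> h z) powr q \<partial>disc_measure \<alpha>) \<longlonglongrightarrow> 0"
    if u: "\<And>n. u n \<in> weighted_Lp q \<alpha> \<inter> weighted_Lp 2 \<alpha>"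
      and lim: "(\<lambda>n. \<integral>z. cmod (u n z - h z) powr q \<partial>disc_measure \<alpha>) \<longlonglongrightarrow> 0" for u :: "nat \<Rightarrow> complex \<Rightarrow> complex"
  proof (rule tendsto_sandwich[OF _ _ tendsto_const])
    have "(\<integral>z. cmod (bergman_proj_L2 \<alpha> (u n) z - bergman_op \<alpha> h z) powr q \<partial>disc_measure \<alpha>)
        \<le> C * (\<integral>z. cmod (u n z - h z) powr q \<partial>disc_measure \<alpha>)" for n
    proof -
      have un: "u n \<in> weighted_Lp q \<alpha>" "u n \<in> weighted_Lp 2 \<alpha>" using u[of n] by auto
      have "(\<integral>z. cmod (bergman_proj_L2 \<alpha> (u n) z - bergman_op \<alpha> h z) powr q \<partial>disc_measure \<alpha>)
        = (\<integral>z. cmod (bergman_op \<alpha> (\<lambda>z. u n z - h z) z) powr q \<partial>disc_measure \<alpha>)"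
        by (rule disc_integral_cong) (simp add: bergman_proj_L2_eq[OF \<alpha> un(2)] bergman_op_diff[OF \<alpha> int[OF un(1)] int[OF h]])
      also have "\<dots> \<le> C * (\<integral>z. cmod (u n z - h z) powr q \<partial>disc_measure \<alpha>)"
        by (rule bd) (rule weighted_Lp_diff[OF un(1) h q0(2)])
      finally show ?thesis .
    qed
    then show "\<forall>\<^sub>F n in sequentially. (\<integral>z. cmod (bergman_proj_L2 \<alpha> (u n) z - bergman_op \<alpha> h z) powr q \<partial>disc_measure \<alpha>)
        \<le> C * (\<integral>z. cmod (u n z - h z) powr q \<partial>disc_measure \<alpha>)"
      by (intro always_eventually) auto
    show "(\<lambda>n. C * (\<integral>z. cmod (u n z - h z) powr q \<partial>disc_measure \<alpha>)) \<longlonglongrightarrow> 0"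
      using tendsto_mult_right_zero[OF lim, of C] by simp
  qed (auto intro: always_eventually)
  \<comment> \<open>Truncations are bounded, hence square integrable on the finite measure, and h
    itself dominates the error.\<close>
  define v where "v n z = (if cmod (h z) \<le> real n then h z else 0)" for n z
  have vm [measurable]: "v n \<in> borel_measurable (disc_measure \<alpha>)" for n
    unfolding v_def by measurable
  have v: "v n \<in> weighted_Lp q \<alpha> \<inter> weighted_Lp 2 \<alpha>" for n
    using weighted_Lp_bound[OF h vm[of n] _ q0(2)] weighted_Lp_bounded[OF \<alpha> vm[of n], of "real n" 2]
    by (auto simp: v_def)
  have vlim: "(\<lambda>n. \<integral>z. cmod (v n z - h z) powr q \<partial>disc_measure \<alpha>) \<longlonglongrightarrow> 0"
  proof -
    have "(\<lambda>n. \<integral>z. cmod (v n z - h z) powr q \<partial>disc_measure \<alpha>) \<longlonglongrightarrow> (\<integral>z. 0 \<partial>disc_measure \<alpha>)"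
    proof (rule integral_dominated_convergence)
      show "integrable (disc_measure \<alpha>) (\<lambda>z. cmod (h z) powr q)" by (rule weighted_Lp_integrable[OF h])
      show "AE z in disc_measure \<alpha>. (\<lambda>n. cmod (v n z - h z) powr q) \<longlonglongrightarrow> 0"
      proof (rule AE_I2, rule tendsto_eventually)
        fix z
        obtain N :: nat where "cmod (h z) \<le> real N" using real_arch_simple by blast
        then show "eventually (\<lambda>n. cmod (v n z - h z) powr q = 0) sequentially"
          unfolding eventually_sequentially by (intro exI[of _ N]) (auto simp: v_def)
      qed
      show "AE z in disc_measure \<alpha>. norm (cmod (v n z - h z) powr q) \<le> cmod (h z) powr q" for n
        by (rule AE_I2) (simp add: v_def)
    qed measurable
    then show ?thesis by simp
  qed
  have op0: "bergman_op0 \<alpha> h \<in> bergman_space q \<alpha>" by (rule bergman_op0_space[OF \<alpha> q h])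
  have "?Q (bergman_op0 \<alpha> h) v"
  proof (intro conjI allI)
    show "bergman_proj_L2 \<alpha> (v n) \<in> bergman_space q \<alpha>" for n
      using v[of n] by (auto simp: bergman_proj_L2_eq[OF \<alpha>] intro!: bergman_op0_space[OF \<alpha> q])
    show "(\<lambda>n. weighted_norm q \<alpha> (\<lambda>z. v n z - h z)) \<longlonglongrightarrow> 0"
      unfolding weighted_norm_tendsto_0_iff[OF q0(1)] by (rule vlim)
    have "(\<integral>z. cmod (bergman_proj_L2 \<alpha> (v n) z - bergman_op0 \<alpha> h z) powr q \<partial>disc_measure \<alpha>)
       = (\<integral>z. cmod (bergman_proj_L2 \<alpha> (v n) z - bergman_op \<alpha> h z) powr q \<partial>disc_measure \<alpha>)" for n
      by (rule disc_integral_cong) simp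
    then show "(\<lambda>n. weighted_norm q \<alpha> (\<lambda>z. bergman_proj_L2 \<alpha> (v n) z - bergman_op0 \<alpha> h z)) \<longlonglongrightarrow> 0"
      unfolding weighted_norm_tendsto_0_iff[OF q0(1)] using conv[OF v vlim] by simp
  qed (use v in auto)
  then have "bergman_op0 \<alpha> h \<in> bergman_space q \<alpha> \<and> (\<forall>z. z \<notin> ball 0 1 \<longrightarrow> bergman_op0 \<alpha> h z = 0) \<and> (\<exists>u. ?Q (bergman_op0 \<alpha> h) u)"
    using op0 by (auto simp only: bergman_op0_def if_False)
  moreover have "g = bergman_op0 \<alpha> h"
    if g: "g \<in> bergman_space q \<alpha> \<and> (\<forall>z. z \<notin> ball 0 1 \<longrightarrow> g z = 0) \<and> (\<exists>u. ?Q g u)" for g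
  proof
    fix z
    obtain u where u: "\<And>n. u n \<in> weighted_Lp q \<alpha> \<inter> weighted_Lp 2 \<alpha>" 
      "\<And>n. bergman_proj_L2 \<alpha> (u n) \<in> bergman_space q \<alpha>"
      "(\<lambda>n. \<integral>z. cmod (u n z - h z) powr q \<partial>disc_measure \<alpha>) \<longlonglongrightarrow> 0"
      "(\<lambda>n. \<integral>z. cmod (bergman_proj_L2 \<alpha> (u n) z - g z) powr q \<partial>disc_measure \<alpha>) \<longlonglongrightarrow> 0"
      using g unfolding weighted_norm_tendsto_0_iff[OF q0(1)] by blast
    define d where "d z = g z - bergman_op \<alpha> h z" for z
    have gs: "g \<in> bergman_space q \<alpha>" using g by simp
    have d: "d \<in> bergman_space q \<alpha>"
      unfolding d_def by (rule bergman_space_diff[OF gs opsp[OF h] q0(2)])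
    note dL = bergman_space_weighted_Lp[OF d]
    let ?a = "\<lambda>n z. cmod (bergman_proj_L2 \<alpha> (u n) z - bergman_op \<alpha> h z) powr q"
    let ?b = "\<lambda>n z. cmod (bergman_proj_L2 \<alpha> (u n) z - g z) powr q"
    have le: "(\<integral>z. cmod (d z) powr q \<partial>disc_measure \<alpha>) \<le> 
      2 powr q * ((\<integral>z. ?a n z \<partial>disc_measure \<alpha>) + (\<integral>z. ?b n z \<partial>disc_measure \<alpha>))" for n
    proof -
      have ia: "integrable (disc_measure \<alpha>) (?a n)"
        by (rule weighted_Lp_integrable[OF bergman_space_weighted_Lp[OF bergman_space_diff[OF u(2) opsp[OF h] q0(2)]]])
      have ib: "integrable (disc_measure \<alpha>) (?b n)"
        by (rule weighted_Lp_integrable[OF bergman_space_weighted_Lp[OF bergman_space_diff[OF u(2) gs q0(2)]]])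
      have "(\<integral>z. cmod (d z) powr q \<partial>disc_measure \<alpha>) \<le> (\<integral>z. 2 powr q * (?a n z + ?b n z) \<partial>disc_measure \<alpha>)"
      proof (rule integral_mono[OF weighted_Lp_integrable[OF dL]])
        show "integrable (disc_measure \<alpha>) (\<lambda>z. 2 powr q * (?a n z + ?b n z))"
          using ia ib by (intro integrable_mult_right Bochner_Integration.integrable_add)
        fix z
        have "cmod (d z) \<le> cmod (bergman_proj_L2 \<alpha> (u n) z - bergman_op \<alpha> h z) + cmod (bergman_proj_L2 \<alpha> (u n) z - g z)"
          unfolding d_def using norm_triangle_ineq4[of "bergman_proj_L2 \<alpha> (u n) z - bergman_op \<alpha> h z" "bergman_proj_L2 \<alpha> (u n) z - g z"]
          by simp
        then have "cmod (d z) powr q \<le> (cmod (bergman_proj_L2 \<alpha> (u n) z - bergman_op \<alpha> h z) + cmod (bergman_proj_L2 \<alpha> (u n) z - g z)) powr q"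
          using q0 by (intro powr_mono2) auto
        also have "\<dots> \<le> 2 powr q * (?a n z + ?b n z)"
          by (rule powr_add_le) (use q0 in auto)
        finally show "cmod (d z) powr q \<le> 2 powr q * (?a n z + ?b n z)" .
      qed
      then show ?thesis using Bochner_Integration.integral_add[OF ia ib] by simp
    qed
    have "(\<lambda>n. 2 powr q * ((\<integral>z. ?a n z \<partial>disc_measure \<alpha>) + (\<integral>z. ?b n z \<partial>disc_measure \<alpha>))) \<longlonglongrightarrow> 2 powr q * (0 + 0)"
      by (intro tendsto_intros conv u)
    then have "(\<integral>z. cmod (d z) powr q \<partial>disc_measure \<alpha>) \<le> 2 powr q * (0 + 0)"
      by (rule LIMSEQ_le_const) (use le in blast)
    moreover have "0 \<le> (\<integral>z. cmod (d z) powr q \<partial>disc_measure \<alpha>)" by simp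
    ultimately have "(\<integral>z. cmod (d z) powr q \<partial>disc_measure \<alpha>) = 0" by simp
    then have "AE z in disc_measure \<alpha>. cmod (d z) powr q = 0"
      using integral_nonneg_eq_0_iff_AE[OF weighted_Lp_integrable[OF dL]] by simp
    then have "AE z in disc_measure \<alpha>. d z = 0" by eventually_elim simp
    then have "d z = 0" if "cmod z < 1"
      using holomorphic_AE_zero[OF \<alpha> bergman_space_holomorphic[OF d]] that by blast
    then show "g z = bergman_op0 \<alpha> h z"
      using g by (cases "cmod z < 1") (auto simp: d_def bergman_op0_def)
  qed
  ultimately show ?thesis unfolding bergman_proj_def by (rule the_equality)
qed

section \<open>Pointwise convexity inequalities\<close>

text \<open>Weighted arithmetic-geometric mean of t and 1 with weights r and 1 - r.\<close>

lemma powr_le_tangent: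
  fixes t r :: real
  assumes "0 \<le> t" "0 < r" "r \<le> 1"
  shows "t powr r \<le> 1 + r * (t - 1)"
proof (cases "t = 0")
  case False
  then show ?thesis
    using Youngs_inequality_0[of r "1 - r" t 1] assms by (simp add: algebra_simps)
qed (use assms in simp)

text \<open>Where the tangent is positive, this is the concave case with exponent 1 / r evaluated at
  the value of the tangent; elsewhere the right-hand side is nonnegative anyway.\<close>

lemma powr_ge_tangent:
  fixes t r :: real
  assumes t: "0 \<le> t" and r: "1 \<le> r"
  shows "1 + r * (t - 1) \<le> t powr r"
proof (cases "1 + r * (t - 1) \<le> 0")
  case True
  then show ?thesis by (rule order_trans) simp
next
  case False
  define s where "s = 1 + r * (t - 1)"
  have s: "0 < s" using False by (simp add: s_def)
  have "s powr (1 / r) \<le> 1 + (1 / r) * (s - 1)" using s r by (intro powr_le_tangent) auto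
  also have "\<dots> = t" using r by (simp add: s_def)
  finally have "(s powr (1 / r)) powr r \<le> t powr r" using r by (intro powr_mono2) auto
  then show ?thesis using s r by (simp add: powr_powr s_def)
qed

text \<open>Jensen's inequality by means of the tangent at the mean z; the linear terms average to
  zero.\<close>

lemma powr_concave_mix:
  fixes x y l m r :: real
  assumes x: "0 \<le> x" and y: "0 \<le> y" and l: "0 \<le> l" and m: "0 \<le> m" and lm: "l + m = 1"
    and r: "0 < r" "r \<le> 1"
  shows "l * x powr r + m * y powr r \<le> (l * x + m * y) powr r"
proof -
  define z where "z = l * x + m * y"
  have z0: "0 \<le> z" using assms by (simp add: z_def)
  show ?thesis
  proof (cases "z = 0")
    case True
    then have "l * x = 0" "m * y = 0"
      using x y l m by (simp_all add: z_def add_nonneg_eq_0_iff)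
    then show ?thesis by auto
  next
    case False
    then have z: "0 < z" using z0 by simp
    have t: "w powr r \<le> z powr r * (1 + r * (w / z - 1))" if "0 \<le> w" for w
    proof -
      have "w powr r = z powr r * (w / z) powr r" using z that by (simp add: powr_divide)
      also have "\<dots> \<le> z powr r * (1 + r * (w / z - 1))"
        using z that r by (intro mult_left_mono powr_le_tangent) auto
      finally show ?thesis .
    qed
    have "l * x powr r + m * y powr r \<le> l * (z powr r * (1 + r * (x / z - 1))) + m * (z powr r * (1 + r * (y / z - 1)))"
      using t[OF x] t[OF y] l m by (intro add_mono mult_left_mono)
    also have "\<dots> = z powr r * ((l + m) * (1 - r) + r * ((l * x + m * y) / z))"
      by (simp add: algebra_simps add_divide_distrib)
    also have "\<dots> = z powr r" using z by (simp add: lm flip: z_def)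
    finally show ?thesis by (simp add: z_def)
  qed
qed

text \<open>For fixed weights the left side is linear in \<open>x powr r\<close> and
  \<open>y powr r\<close>, so it can be integrated termwise, which the right side does not allow.
  Equality holds for l = x / (x + y). It is concavity at the points x / l and y / m.\<close>

lemma powr_two_term_Hoelder:
  fixes x y l m r :: real
  assumes x: "0 \<le> x" and y: "0 \<le> y" and l: "0 \<le> l" and m: "0 \<le> m" and lm: "l + m = 1"
    and r: "0 < r" "r \<le> 1"
  shows "l powr (1 - r) * x powr r + m powr (1 - r) * y powr r \<le> (x + y) powr r"
proof -
  consider "l = 0" "m = 1" | "l = 1" "m = 0" | "0 < l" "0 < m" using l m lm by linarith
  then show ?thesis
  proof cases
    case 3
    have e: "w * (v / w) powr r = w powr (1 - r) * v powr r" if "0 < w" "0 \<le> v" for v w :: real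
      using that by (simp add: powr_divide powr_diff)
    have "l * (x / l) powr r + m * (y / m) powr r \<le> (l * (x / l) + m * (y / m)) powr r"
      using assms 3 by (intro powr_concave_mix) auto
    then show ?thesis using 3 by (simp add: e x y)
  qed (use x y r in \<open>auto intro: powr_mono2\<close>)
qed

text \<open>Each summand satisfies w^r \<le> w (x + y)^(r - 1), and these bounds add up to the
  right-hand side.\<close>

lemma powr_superadditive:
  fixes x y r :: real
  assumes "0 \<le> x" "0 \<le> y" "1 \<le> r"
  shows "x powr r + y powr r \<le> (x + y) powr r"
proof (cases "x + y = 0")
  case False
  then have s: "0 < x + y" using assms by simp
  have e: "w powr r \<le> w * (x + y) powr (r - 1)" if "0 \<le> w" "w \<le> x + y" for w
  proof (cases "w = 0")
    case False
    have "w powr r = w * w powr (r - 1)" using False that by (simp add: powr_diff)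
    also have "\<dots> \<le> w * (x + y) powr (r - 1)" using that assms by (intro mult_left_mono powr_mono2) auto
    finally show ?thesis .
  qed (use assms in simp)
  have "x powr r + y powr r \<le> x * (x + y) powr (r - 1) + y * (x + y) powr (r - 1)"
    using assms by (intro add_mono e) auto
  also have "\<dots> = (x + y) * (x + y) powr (r - 1)" by (simp only: distrib_right)
  also have "\<dots> = (x + y) powr r" using s by (simp add: powr_diff)
  finally show ?thesis .
qed (use assms in \<open>simp add: add_nonneg_eq_0_iff\<close>)

lemma cmod_powr_eq: "0 < p \<Longrightarrow> cmod z powr p = ((cmod z)\<^sup>2) powr (p / 2)"
  by (cases "z = 0") (auto simp: powr_powr simp flip: powr_numeral)

lemma cmod_square_add: "(cmod (a + b))\<^sup>2 = ((cmod a)\<^sup>2 + (cmod b)\<^sup>2) + 2 * Re (a * cnj b)"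
  and cmod_square_diff: "(cmod (a - b))\<^sup>2 = ((cmod a)\<^sup>2 + (cmod b)\<^sup>2) - 2 * Re (a * cnj b)"
  unfolding cmod_power2 by (simp_all add: power2_eq_square algebra_simps)

lemma abs_Re_mult_cnj_le: "\<bar>2 * Re (a * cnj b)\<bar> \<le> 2 * (cmod a * cmod b)"
  using abs_Re_le_cmod[of "a * cnj b"] by (simp add: norm_mult)

text \<open>Write the squared moduli of a + b and a - b as A + B and A - B. Superadditivity of
  t^(p/2) bounds the left side by 2 A^(p/2); convexity bounds this by the right side, since the
  linear terms of the tangents at A cancel.\<close>

lemma clarkson_pointwise:
  assumes p: "2 \<le> p"
  shows "2 * (cmod a powr p + cmod b powr p) \<le> cmod (a + b) powr p + cmod (a - b) powr p"
proof -
  define A where "A = (cmod a)\<^sup>2 + (cmod b)\<^sup>2"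
  define B where "B = 2 * Re (a * cnj b)"
  define r where "r = p / 2"
  have r: "1 \<le> r" using p by (simp add: r_def)
  have BA: "\<bar>B\<bar> \<le> A"
    using abs_Re_mult_cnj_le[of a b] sum_squares_bound[of "cmod a" "cmod b"] by (simp add: A_def B_def)
  have "cmod a powr p + cmod b powr p = ((cmod a)\<^sup>2) powr r + ((cmod b)\<^sup>2) powr r"
    using p by (simp add: r_def cmod_powr_eq)
  also have "\<dots> \<le> A powr r" unfolding A_def using r by (intro powr_superadditive) auto
  finally have 1: "cmod a powr p + cmod b powr p \<le> A powr r" .
  have 2: "2 * A powr r \<le> (A + B) powr r + (A - B) powr r"
  proof (cases "A = 0")
    case False
    then have A: "0 < A" using BA by linarith
    have e: "A powr r * (1 + r * (c / A)) \<le> (A + c) powr r" if "\<bar>c\<bar> \<le> A" for c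
    proof -
      have "1 + r * ((1 + c / A) - 1) \<le> (1 + c / A) powr r"
        using that A r by (intro powr_ge_tangent) (auto simp: field_simps)
      then have "A powr r * (1 + r * (c / A)) \<le> A powr r * (1 + c / A) powr r"
        by (intro mult_left_mono) auto
      also have "\<dots> = (A * (1 + c / A)) powr r" 
      proof -
        have "0 \<le> 1 + c / A" using A that by (simp add: field_simps)
        then show ?thesis using A by (simp add: powr_mult)
      qed
      also have "A * (1 + c / A) = A + c" using A by (simp add: field_simps)
      finally show ?thesis .
    qed
    show ?thesis using e[of B] e[of "- B"] BA by (simp add: algebra_simps)
  qed (use BA in simp)
  show ?thesis
    using 1 2 p unfolding cmod_powr_eq[of p "a + b", OF less_le_trans[OF zero_less_numeral p]]
      cmod_powr_eq[of p "a - b", OF less_le_trans[OF zero_less_numeral p]] cmod_square_add cmod_square_diff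
    by (simp add: A_def B_def r_def)
qed

text \<open>The second-order Taylor bound at \<open>0\<close>; the remainder is convex because \<open>s \<mapsto> s powr (p - 2)\<close> is.\<close>

lemma even_powr_ge_quadratic:
  fixes x p :: real
  assumes p: "1 < p" "p < 2" and x: "0 \<le> x" "x \<le> 1"
  shows "1 + p * (p - 1) / 2 * x\<^sup>2 \<le> ((1 + x) powr p + (1 - x) powr p) / 2"
proof -
  have g: "2 * (p - 1) * x \<le> (1 + x) powr (p - 1) - (1 - x) powr (p - 1)" if x: "0 \<le> x" "x < 1" for x
  proof -
    let ?g = "\<lambda>x. (1 + x) powr (p - 1) - (1 - x) powr (p - 1) - 2 * (p - 1) * x"
    have "?g 0 \<le> ?g x"
    proof (rule DERIV_nonneg_imp_nondecreasing[OF x(1)])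
      fix y assume y: "0 \<le> y" "y \<le> x"
      \<comment> \<open>Square roots of the two powers in the derivative: a^2 + b^2 \<ge> 2 a b, and
        a b is a negative power of 1 - y^2, hence at least 1.\<close>
      define a where "a = (1 + y) powr ((p - 2) / 2)"
      define b where "b = (1 - y) powr ((p - 2) / 2)"
      have y1: "y < 1" using y x by simp
      have "(?g has_real_derivative (p - 1) * ((1 + y) powr (p - 2) + (1 - y) powr (p - 2) - 2)) (at y)"
        using y y1 by (auto intro!: derivative_eq_intros simp: algebra_simps)
      moreover have "(1 + y) powr (p - 2) = a\<^sup>2" "(1 - y) powr (p - 2) = b\<^sup>2"
        by (simp_all add: a_def b_def power2_eq_square flip: powr_add)
      moreover have "1 \<le> a * b"
      proof -
        have "a * b = (1 - y\<^sup>2) powr ((p - 2) / 2)"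
          using y y1 by (simp add: a_def b_def powr_mult[symmetric] power2_eq_square algebra_simps)
        moreover have "0 < 1 - y\<^sup>2" using y y1 by (simp add: abs_square_less_1)
        then have "1 powr ((p - 2) / 2) \<le> (1 - y\<^sup>2) powr ((p - 2) / 2)"
          using p by (intro powr_mono2') auto
        ultimately show ?thesis by simp
      qed
      moreover have "2 * (a * b) \<le> a\<^sup>2 + b\<^sup>2" using sum_squares_bound[of a b] by simp
      ultimately show "\<exists>D. (?g has_real_derivative D) (at y) \<and> 0 \<le> D"
        using p by (intro exI[of _ "(p - 1) * (a\<^sup>2 + b\<^sup>2 - 2)"]) auto
    qed
    then show ?thesis by simp
  qed
  let ?f = "\<lambda>x. ((1 + x) powr p + (1 - x) powr p) / 2 - p * (p - 1) / 2 * x\<^sup>2"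
  have "?f 0 \<le> ?f x"
  proof (rule DERIV_nonneg_imp_increasing_open[OF x(1)])
    fix y assume y: "0 < y" "y < x"
    have y1: "y < 1" using y x by simp
    have "(?f has_real_derivative (p / 2 * ((1 + y) powr (p - 1) - (1 - y) powr (p - 1) - 2 * (p - 1) * y))) (at y)"
      using y y1 by (auto intro!: derivative_eq_intros simp: field_simps)
    then show "\<exists>D. (?f has_real_derivative D) (at y) \<and> 0 \<le> D"
      using g[of y] y y1 p by (intro exI conjI) (auto intro!: mult_nonneg_nonneg)
  next
    show "continuous_on {0..x} ?f"
      using p x by (intro continuous_intros continuous_on_powr') auto
  qed
  then have "1 \<le> ((1 + x) powr p + (1 - x) powr p) / 2 - p * (p - 1) / 2 * x\<^sup>2" by simp
  then show ?thesis by linarith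
qed

text \<open>By homogeneity the larger number can be scaled to 1. The left side then lies below its
  tangent in x^2 and the right side above its Taylor polynomial, and the coefficient p - 1 makes
  these two quadratics the same. If b exceeds a, interchanging them increases the left side because
  p - 1 < 1.\<close>

lemma two_point_real:
  fixes a b p :: real
  assumes p: "1 < p" "p < 2" and a: "0 \<le> a" and b: "0 \<le> b"
  shows "2 * (a\<^sup>2 + (p - 1) * b\<^sup>2) powr (p / 2) \<le> (a + b) powr p + \<bar>a - b\<bar> powr p"
proof -
  have *: "2 * (a\<^sup>2 + (p - 1) * b\<^sup>2) powr (p / 2) \<le> (a + b) powr p + (a - b) powr p"
    if ab: "0 < a" "0 \<le> b" "b \<le> a" for a b :: real
  proof -
    define x where "x = b / a"
    have x: "0 \<le> x" "x \<le> 1" using ab by (auto simp: x_def)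
    have b_eq: "b = a * x" using ab by (simp add: x_def)
    have "(1 + (p - 1) * x\<^sup>2) powr (p / 2) \<le> 1 + p / 2 * ((1 + (p - 1) * x\<^sup>2) - 1)"
      using p by (intro powr_le_tangent) auto
    also have "\<dots> = 1 + p * (p - 1) / 2 * x\<^sup>2" by simp
    also have "\<dots> \<le> ((1 + x) powr p + (1 - x) powr p) / 2"
      by (rule even_powr_ge_quadratic[OF p x])
    finally have "a powr p * (2 * (1 + (p - 1) * x\<^sup>2) powr (p / 2)) \<le> a powr p * ((1 + x) powr p + (1 - x) powr p)"
      by (intro mult_left_mono) auto
    moreover have "a powr p * (1 + (p - 1) * x\<^sup>2) powr (p / 2) = (a\<^sup>2 + (p - 1) * b\<^sup>2) powr (p / 2)"
    proof -
      have "a powr p = (a\<^sup>2) powr (p / 2)"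
        using ab by (simp add: powr_powr flip: powr_numeral)
      then show ?thesis
        using p by (simp add: powr_mult[symmetric] b_eq power_mult_distrib algebra_simps)
    qed
    moreover have "a powr p * (1 + x) powr p = (a + b) powr p" "a powr p * (1 - x) powr p = (a - b) powr p"
      using ab x by (simp_all add: powr_mult[symmetric] b_eq algebra_simps)
    ultimately show ?thesis by (simp add: algebra_simps)
  qed
  consider "0 < a" "b \<le> a" | "0 < b" "a \<le> b" | "a = 0" "b = 0" using a b by linarith
  then show ?thesis
  proof cases
    case 1
    then show ?thesis using *[of a b] b by simp
  next
    case 2
    have "(2 - p) * a\<^sup>2 \<le> (2 - p) * b\<^sup>2" using 2 a p by (intro mult_left_mono power_mono) auto
    then have "a\<^sup>2 + (p - 1) * b\<^sup>2 \<le> b\<^sup>2 + (p - 1) * a\<^sup>2" by (simp add: algebra_simps)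
    then have "(a\<^sup>2 + (p - 1) * b\<^sup>2) powr (p / 2) \<le> (b\<^sup>2 + (p - 1) * a\<^sup>2) powr (p / 2)"
      using p by (intro powr_mono2) auto
    then show ?thesis using *[of b a] 2 a by (simp add: add.commute)
  qed (use p in simp)
qed

text \<open>For fixed moduli only B = 2 Re (a cnj b) varies, and the right side is an even concave
  function of it. It is smallest at the extreme values B0 and - B0, where the numbers are aligned
  and the real inequality applies.\<close>

lemma two_point_complex:
  assumes p: "1 < p" "p < 2"
  shows "2 * ((cmod a)\<^sup>2 + (p - 1) * (cmod b)\<^sup>2) powr (p / 2) \<le> cmod (a + b) powr p + cmod (a - b) powr p"
proof -
  define A where "A = (cmod a)\<^sup>2 + (cmod b)\<^sup>2"
  define B where "B = 2 * Re (a * cnj b)"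
  define B0 where "B0 = 2 * (cmod a * cmod b)"
  define r where "r = p / 2"
  have r: "0 < r" "r \<le> 1" using p by (simp_all add: r_def)
  have BB0: "\<bar>B\<bar> \<le> B0" using abs_Re_mult_cnj_le[of a b] by (simp add: B0_def B_def)
  have B0A: "B0 \<le> A" using sum_squares_bound[of "cmod a" "cmod b"] by (simp add: A_def B0_def)
  have "(A + B0) powr r + (A - B0) powr r \<le> (A + B) powr r + (A - B) powr r"
  proof (cases "B0 = 0")
    case False
    then have B0: "0 < B0" using BB0 by simp
    \<comment> \<open>The weight expressing A + B as a mixture of A + B0 and A - B0; with the
      weights exchanged it expresses A - B.\<close>
    define l where "l = (1 + B / B0) / 2"
    have l: "0 \<le> l" "0 \<le> 1 - l" using BB0 B0 by (auto simp: l_def field_simps)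
    have e1: "l * (A + B0) + (1 - l) * (A - B0) = A + B" and e2: "l * (A - B0) + (1 - l) * (A + B0) = A - B"
      using B0 by (simp_all add: l_def field_simps)
    have "l * (A + B0) powr r + (1 - l) * (A - B0) powr r \<le> (A + B) powr r"
      "l * (A - B0) powr r + (1 - l) * (A + B0) powr r \<le> (A - B) powr r"
      using powr_concave_mix[of "A + B0" "A - B0" l "1 - l" r] powr_concave_mix[of "A - B0" "A + B0" l "1 - l" r]
        B0 B0A l r unfolding e1 e2 by auto
    then show ?thesis by (simp add: algebra_simps)
  qed (use BB0 in simp)
  moreover have "A + B0 = (cmod a + cmod b)\<^sup>2" "A - B0 = (cmod a - cmod b)\<^sup>2"
    by (simp_all add: A_def B0_def power2_eq_square algebra_simps)
  moreover have "((cmod a + cmod b)\<^sup>2) powr r = (cmod a + cmod b) powr p"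
    "((cmod a - cmod b)\<^sup>2) powr r = \<bar>cmod a - cmod b\<bar> powr p"
    using cmod_powr_eq[of p "of_real (cmod a + cmod b)"] cmod_powr_eq[of p "of_real (cmod a - cmod b)"] p
    by (simp_all add: r_def norm_of_real del: of_real_add of_real_diff)
  moreover have "cmod (a + b) powr p = (A + B) powr r" "cmod (a - b) powr p = (A - B) powr r"
    using p by (simp_all add: cmod_powr_eq r_def A_def B_def cmod_square_add cmod_square_diff)
  ultimately show ?thesis using two_point_real[OF p, of "cmod a" "cmod b"] by simp
qed

section \<open>Uniform convexity and the estimate\<close>

lemma weighted_norm_cmult:
  assumes "0 < s" shows "weighted_norm s \<alpha> (\<lambda>z. c * f z) = cmod c * weighted_norm s \<alpha> f"
  using assms by (simp add: weighted_norm_def norm_mult powr_mult powr_powr)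

lemma weighted_norm_eq_0_AE:
  assumes s: "0 < s" and f: "f \<in> weighted_Lp s \<alpha>" and "weighted_norm s \<alpha> f = 0"
  shows "AE z in disc_measure \<alpha>. f z = 0"
proof -
  have "(\<integral>z. cmod (f z) powr s \<partial>disc_measure \<alpha>) = 0"
    using weighted_norm_powr[OF s, of \<alpha> f] assms by simp
  then have "AE z in disc_measure \<alpha>. cmod (f z) powr s = 0"
    using integral_nonneg_eq_0_iff_AE[OF weighted_Lp_integrable[OF f]] by simp
  then show ?thesis by eventually_elim simp
qed

lemma disc_pairing_Hoelder:
  assumes pq: "1 < p" "1 < q" "1 / p + 1 / q = 1"
    and f: "f \<in> weighted_Lp p \<alpha>" and g: "g \<in> weighted_Lp q \<alpha>"
  shows "cmod (disc_pairing \<alpha> f g) \<le> weighted_norm p \<alpha> f * weighted_norm q \<alpha> g"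
proof -
  define A where "A = weighted_norm p \<alpha> f"
  define B where "B = weighted_norm q \<alpha> g"
  note i = integrable_mult_cnj[OF f g pq]
  show ?thesis
  proof (cases "A = 0 \<or> B = 0")
    case True
    then have "AE z in disc_measure \<alpha>. f z * cnj (g z) = 0"
    proof
      assume "A = 0"
      then have "AE z in disc_measure \<alpha>. f z = 0"
        using pq by (intro weighted_norm_eq_0_AE[OF _ f]) (auto simp: A_def)
      then show ?thesis by eventually_elim simp
    next
      assume "B = 0"
      then have "AE z in disc_measure \<alpha>. g z = 0"
        using pq by (intro weighted_norm_eq_0_AE[OF _ g]) (auto simp: B_def)
      then show ?thesis by eventually_elim simp
    qed
    then have "disc_pairing \<alpha> f g = (\<integral>z. 0 \<partial>disc_measure \<alpha>)"
      unfolding disc_pairing_def using borel_measurable_integrable[OF i] by (intro integral_cong_AE) auto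
    then show ?thesis by simp
  next
    case False
    then have AB: "0 < A" "0 < B"
      using weighted_norm_nonneg[of p \<alpha> f] weighted_norm_nonneg[of q \<alpha> g] unfolding A_def B_def by linarith+
    have Ap: "A powr p = (\<integral>z. cmod (f z) powr p \<partial>disc_measure \<alpha>)" and Bq: "B powr q = (\<integral>z. cmod (g z) powr q \<partial>disc_measure \<alpha>)"
      using pq by (simp_all add: A_def B_def weighted_norm_powr)
    have "cmod (disc_pairing \<alpha> f g) \<le> (\<integral>z. cmod (f z * cnj (g z)) \<partial>disc_measure \<alpha>)"
      unfolding disc_pairing_def by (rule integral_norm_bound)
    also have "\<dots> \<le> (\<integral>z. A * B * (cmod (f z) powr p / (p * A powr p) + cmod (g z) powr q / (q * B powr q)) \<partial>disc_measure \<alpha>)"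
    proof (rule integral_mono)
      show "integrable (disc_measure \<alpha>) (\<lambda>z. A * B * (cmod (f z) powr p / (p * A powr p) + cmod (g z) powr q / (q * B powr q)))"
        using weighted_Lp_integrable[OF f] weighted_Lp_integrable[OF g]
        by (intro integrable_mult_right Bochner_Integration.integrable_add integrable_divide_zero impI)
      fix z
      have "(cmod (f z) / A) * (cmod (g z) / B) \<le> (cmod (f z) / A) powr p / p + (cmod (g z) / B) powr q / q"
        using AB by (intro Youngs_inequality[OF pq]) auto
      then have "A * B * ((cmod (f z) / A) * (cmod (g z) / B)) \<le> A * B * ((cmod (f z) / A) powr p / p + (cmod (g z) / B) powr q / q)"
        using AB by (intro mult_left_mono) auto
      then show "cmod (f z * cnj (g z)) \<le> A * B * (cmod (f z) powr p / (p * A powr p) + cmod (g z) powr q / (q * B powr q))"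
        using AB by (simp add: norm_mult powr_divide mult.commute[of p] mult.commute[of q])
    qed (use i in auto)
    also have "\<dots> = A * B * (A powr p / (p * A powr p) + B powr q / (q * B powr q))"
      using weighted_Lp_integrable[OF f] weighted_Lp_integrable[OF g] by (simp add: Ap Bq)
    also have "\<dots> = A * B * (1 / p + 1 / q)" using AB pq by simp
    also have "\<dots> = A * B" using pq by simp
    finally show ?thesis by (simp add: A_def B_def)
  qed
qed

lemma clarkson:
  assumes p: "2 \<le> p" and u: "u \<in> weighted_Lp p \<alpha>" and v: "v \<in> weighted_Lp p \<alpha>"
    and nadd: "weighted_norm p \<alpha> (\<lambda>z. u z + v z) = 1" and ndiff: "weighted_norm p \<alpha> (\<lambda>z. u z - v z) = 1"
  shows "weighted_norm p \<alpha> u powr p + weighted_norm p \<alpha> v powr p \<le> 1"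
proof -
  have p0: "0 < p" "0 \<le> p" using p by auto
  note iu = weighted_Lp_integrable[OF u] and iv = weighted_Lp_integrable[OF v]
  note ia = weighted_Lp_integrable[OF weighted_Lp_add[OF u v p0(2)]]
  note id = weighted_Lp_integrable[OF weighted_Lp_diff[OF u v p0(2)]]
  have "(\<integral>z. 2 * (cmod (u z) powr p + cmod (v z) powr p) \<partial>disc_measure \<alpha>)
     \<le> (\<integral>z. cmod (u z + v z) powr p + cmod (u z - v z) powr p \<partial>disc_measure \<alpha>)"
    using iu iv ia id clarkson_pointwise[OF p] by (intro integral_mono) auto
  then have "2 * (weighted_norm p \<alpha> u powr p + weighted_norm p \<alpha> v powr p) \<le>
      weighted_norm p \<alpha> (\<lambda>z. u z + v z) powr p + weighted_norm p \<alpha> (\<lambda>z. u z - v z) powr p"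
    using iu iv ia id by (simp add: weighted_norm_powr[OF p0(1)])
  then show ?thesis by (simp add: nadd ndiff)
qed

text \<open>The pointwise inequality passes to norms by the reverse Minkowski inequality for the exponent \<open>p / 2 \<le> 1\<close>.\<close>

lemma two_uniform_convexity:
  assumes p: "1 < p" "p < 2" and u: "u \<in> weighted_Lp p \<alpha>" and v: "v \<in> weighted_Lp p \<alpha>"
    and nadd: "weighted_norm p \<alpha> (\<lambda>z. u z + v z) = 1" and ndiff: "weighted_norm p \<alpha> (\<lambda>z. u z - v z) = 1"
  shows "(weighted_norm p \<alpha> u)\<^sup>2 + (p - 1) * (weighted_norm p \<alpha> v)\<^sup>2 \<le> 1"
proof -
  define r where "r = p / 2"
  have r: "0 < r" "r \<le> 1" using p by (simp_all add: r_def)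
  have p0: "0 < p" "0 \<le> p" using p by auto
  note iu = weighted_Lp_integrable[OF u] and iv = weighted_Lp_integrable[OF v]
  note ia = weighted_Lp_integrable[OF weighted_Lp_add[OF u v p0(2)]]
  note id = weighted_Lp_integrable[OF weighted_Lp_diff[OF u v p0(2)]]
  define x where "x = (weighted_norm p \<alpha> u)\<^sup>2"
  define y where "y = (p - 1) * (weighted_norm p \<alpha> v)\<^sup>2"
  have xy: "0 \<le> x" "0 \<le> y" using p by (simp_all add: x_def y_def)
  have sq: "(t\<^sup>2) powr r = t powr p" if "0 \<le> t" for t :: real
    using cmod_powr_eq[OF p0(1), of "of_real t"] that by (simp add: r_def)
  have xr: "x powr r = (\<integral>z. cmod (u z) powr p \<partial>disc_measure \<alpha>)"
    by (simp add: x_def sq weighted_norm_powr[OF p0(1)])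
  have yr: "y powr r = (p - 1) powr r * (\<integral>z. cmod (v z) powr p \<partial>disc_measure \<alpha>)"
    using p by (simp add: y_def powr_mult sq weighted_norm_powr[OF p0(1)])
  show ?thesis
  proof (cases "x + y = 0")
    case False
    then have S: "0 < x + y" using xy by simp
    \<comment> \<open>The weights for which the two-term Hoelder inequality is an equality at the
      integrated quantities. They are constants, so they can be taken out of the integral.\<close>
    define l where "l = x / (x + y)"
    define m where "m = y / (x + y)"
    have lm: "0 \<le> l" "0 \<le> m" "l + m = 1" using xy S by (simp_all add: l_def m_def add_divide_distrib[symmetric])
    have x_eq: "x = l * (x + y)" and y_eq: "y = m * (x + y)" using S by (simp_all add: l_def m_def)
    have "(\<integral>z. 2 * (l powr (1 - r) * cmod (u z) powr p + m powr (1 - r) * ((p - 1) powr r * cmod (v z) powr p)) \<partial>disc_measure \<alpha>)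
      \<le> (\<integral>z. cmod (u z + v z) powr p + cmod (u z - v z) powr p \<partial>disc_measure \<alpha>)"
    proof (rule integral_mono)
      fix z
      have "l powr (1 - r) * ((cmod (u z))\<^sup>2) powr r + m powr (1 - r) * ((p - 1) * (cmod (v z))\<^sup>2) powr r
          \<le> ((cmod (u z))\<^sup>2 + (p - 1) * (cmod (v z))\<^sup>2) powr r"
        using p lm r by (intro powr_two_term_Hoelder) auto
      moreover have "2 * ((cmod (u z))\<^sup>2 + (p - 1) * (cmod (v z))\<^sup>2) powr r \<le> cmod (u z + v z) powr p + cmod (u z - v z) powr p"
        unfolding r_def by (rule two_point_complex[OF p])
      moreover have "((p - 1) * (cmod (v z))\<^sup>2) powr r = (p - 1) powr r * cmod (v z) powr p"
        using p by (simp add: powr_mult sq)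
      ultimately show "2 * (l powr (1 - r) * cmod (u z) powr p + m powr (1 - r) * ((p - 1) powr r * cmod (v z) powr p))
        \<le> cmod (u z + v z) powr p + cmod (u z - v z) powr p"
        by (simp add: sq)
    qed (use iu iv ia id in auto)
    also have "\<dots> = weighted_norm p \<alpha> (\<lambda>z. u z + v z) powr p + weighted_norm p \<alpha> (\<lambda>z. u z - v z) powr p"
      using ia id by (simp add: weighted_norm_powr[OF p0(1)])
    also have "\<dots> = 2" by (simp add: nadd ndiff)
    also have "(\<integral>z. 2 * (l powr (1 - r) * cmod (u z) powr p + m powr (1 - r) * ((p - 1) powr r * cmod (v z) powr p)) \<partial>disc_measure \<alpha>)
       = 2 * (l powr (1 - r) * x powr r + m powr (1 - r) * y powr r)"
      using iu iv by (simp add: xr yr)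
    finally have "l powr (1 - r) * x powr r + m powr (1 - r) * y powr r \<le> 1" by simp
    \<comment> \<open>This is the equality case: since l + m = 1, the two terms add up to exactly (x
      + y)^r.\<close>
    moreover have e: "t powr (1 - r) * (t * (x + y)) powr r = t * (x + y) powr r" if "0 \<le> t" for t
      using that S r by (cases "t = 0") (auto simp: powr_mult powr_diff)
    have "l powr (1 - r) * x powr r = l * (x + y) powr r" "m powr (1 - r) * y powr r = m * (x + y) powr r"
      using e[OF lm(1)] e[OF lm(2)] by (simp_all only: x_eq[symmetric] y_eq[symmetric])
    ultimately have "(l + m) * (x + y) powr r \<le> 1" by (simp add: distrib_right)
    then have "(x + y) powr r \<le> 1 powr r" by (simp add: lm)
    then have "x + y \<le> 1"
      using r powr_less_mono2[of r 1 "x + y"] by (force simp: not_le[symmetric])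
    then show ?thesis by (simp add: x_def y_def)
  qed (simp add: x_def y_def)
qed

theorem theorem3p4:
  fixes p q \<alpha> \<delta> c :: real and k F G :: "complex \<Rightarrow> complex"
  assumes "1 < p" and "1 / p + 1 / q = 1" and "-1 < \<alpha>"
    and "k \<in> bergman_space q \<alpha>" and "\<exists>z\<in>ball 0 1. k z \<noteq> 0"
    and "is_extremal_for p \<alpha> k F"
    and "0 < c"
    and "G \<in> bergman_space p \<alpha>" and "weighted_norm p \<alpha> G = 1"
    and "0 < \<delta>" and "\<delta> < 1"
    and "weighted_norm q \<alpha> (\<lambda>z.
           bergman_proj q \<alpha> (\<lambda>w. of_real (cmod (G w) powr p) / cnj (G w)) z - of_real c * k z) < \<delta>"
  shows "(2 < p \<longrightarrow>
            weighted_norm p \<alpha> (\<lambda>z. F z - G z) < 2 * p powr (1 / p) * \<delta> powr (1 / p)) \<and>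
         (p < 2 \<longrightarrow>
            weighted_norm p \<alpha> (\<lambda>z. F z - G z) <
              2 * sqrt 2 * (p - 1) powr (- (1 / 2)) * \<delta> powr (1 / 2))"
proof -
  note p = assms(1) and \<alpha> = assms(3) and k = assms(4) and G = assms(8) and nG = assms(9)
  have q: "1 < q"
  proof -
    have "1 / q = (p - 1) / p" using assms(2) p by (simp add: field_simps)
    then have "q = p / (p - 1)" by (metis inverse_eq_divide inverse_inverse_eq inverse_divide)
    then show ?thesis using p by simp
  qed
  note pq = p q assms(2)
  have qp: "1 < q" "1 < p" "1 / q + 1 / p = 1" using pq by auto
  have p0: "0 < p" "0 \<le> p" and q0: "0 < q" "0 \<le> q" using p q by auto
  have F: "F \<in> bergman_space p \<alpha>" and nF: "weighted_norm p \<alpha> F = 1"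
    and ext: "\<And>f. f \<in> bergman_space p \<alpha> \<Longrightarrow> weighted_norm p \<alpha> f = 1 \<Longrightarrow>
        Re (disc_pairing \<alpha> f k) \<le> Re (disc_pairing \<alpha> F k)"
    using assms(6) by (auto simp: is_extremal_for_def)
  note FL = bergman_space_weighted_Lp[OF F] and GL = bergman_space_weighted_Lp[OF G] and kL = bergman_space_weighted_Lp[OF k]

  \<comment> \<open>At a zero of G division by 0 returns 0, which is the required interpretation;
    \<open>norm_h\<close> persists there because \<open>0 powr x = 0\<close>.\<close>
  define h where "h w = of_real (cmod (G w) powr p) / cnj (G w)" for w
  have norm_h: "cmod (h w) = cmod (G w) powr (p - 1)" for w
    by (cases "G w = 0") (auto simp: h_def norm_divide powr_diff)
  have h_powr: "cmod (h w) powr q = cmod (G w) powr p" for w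
    by (simp add: norm_h powr_powr powr_conjugate(1)[OF pq])
  note [measurable] = weighted_Lp_measurable[OF GL] measurable_cnj[OF \<alpha>]
  have "h \<in> borel_measurable (disc_measure \<alpha>)"
    unfolding h_def[abs_def] by measurable
  then have h: "h \<in> weighted_Lp q \<alpha>"
    unfolding weighted_Lp_def using weighted_Lp_integrable[OF GL] by (simp add: h_powr)
  have nh: "weighted_norm q \<alpha> h = 1"
  proof -
    have "(\<integral>z. cmod (G z) powr p \<partial>disc_measure \<alpha>) = 1"
      using weighted_norm_powr[OF p0(1), of \<alpha> G] nG by simp
    then show ?thesis by (simp add: weighted_norm_def h_powr)
  qed
  have Gh: "disc_pairing \<alpha> G h = 1"
  proof -
    have "G z * cnj (h z) = of_real (cmod (G z) powr p)" for z
      using p by (cases "G z = 0") (auto simp: h_def)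
    then have "disc_pairing \<alpha> G h = of_real (\<integral>z. cmod (G z) powr p \<partial>disc_measure \<alpha>)"
      by (simp only: disc_pairing_def integral_complex_of_real)
    then show ?thesis using weighted_norm_powr[OF p0(1), of \<alpha> G] nG by simp
  qed

  define g where "g = bergman_op0 \<alpha> h"
  have g: "g \<in> bergman_space q \<alpha>" unfolding g_def by (rule bergman_op0_space[OF \<alpha> q h])
  note gL = bergman_space_weighted_Lp[OF g]
  have pair_g: "disc_pairing \<alpha> f g = disc_pairing \<alpha> f h" if f: "f \<in> bergman_space p \<alpha>" for f
  proof -
    note fL = bergman_space_weighted_Lp[OF f]
    have "disc_pairing \<alpha> f g = disc_pairing \<alpha> f (bergman_op \<alpha> h)"
      unfolding disc_pairing_def g_def by (intro disc_integral_cong) simp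
    also have "\<dots> = disc_pairing \<alpha> (bergman_op \<alpha> f) h"
      by (rule bergman_op_adjoint[OF \<alpha> qp fL h, symmetric])
    also have "\<dots> = disc_pairing \<alpha> f h"
      unfolding disc_pairing_def
      by (intro disc_integral_cong)
        (simp add: bergman_op_reproducing[OF \<alpha> bergman_space_holomorphic[OF f] weighted_Lp_integrable_1[OF \<alpha> fL]] p less_imp_le)
    finally show ?thesis .
  qed

  \<comment> \<open>Estimating with the distance itself, and passing to \<delta> only at the very
    end, gives the strict inequalities of the conclusion.\<close>
  define d where "d = weighted_norm q \<alpha> (\<lambda>z. g z - of_real c * k z)"
  have d: "0 \<le> d" "d < \<delta>" "d < 1"
    using assms(11,12) bergman_proj_eq[OF \<alpha> q h] unfolding d_def g_def h_def by auto
  have close: "\<bar>Re (disc_pairing \<alpha> f h) - c * Re (disc_pairing \<alpha> f k)\<bar> \<le> d"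
    if f: "f \<in> bergman_space p \<alpha>" and nf: "weighted_norm p \<alpha> f = 1" for f
  proof -
    note fL = bergman_space_weighted_Lp[OF f]
    note ig = integrable_mult_cnj[OF fL gL pq] and ik = integrable_mult_cnj[OF fL kL pq]
    have "disc_pairing \<alpha> f (\<lambda>z. g z - of_real c * k z) = (\<integral>z. f z * cnj (g z) - of_real c * (f z * cnj (k z)) \<partial>disc_measure \<alpha>)"
      unfolding disc_pairing_def by (intro disc_integral_cong) (simp add: algebra_simps)
    also have "\<dots> = disc_pairing \<alpha> f g - of_real c * disc_pairing \<alpha> f k"
      using ig ik by (simp add: disc_pairing_def)
    finally have "Re (disc_pairing \<alpha> f h) - c * Re (disc_pairing \<alpha> f k) = Re (disc_pairing \<alpha> f (\<lambda>z. g z - of_real c * k z))"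
      by (simp add: pair_g[OF f])
    also have "\<bar>\<dots>\<bar> \<le> cmod (disc_pairing \<alpha> f (\<lambda>z. g z - of_real c * k z))"
      by (rule abs_Re_le_cmod)
    also have "\<dots> \<le> weighted_norm p \<alpha> f * d"
      unfolding d_def by (intro disc_pairing_Hoelder[OF pq fL] weighted_Lp_diff gL weighted_Lp_cmult kL q0)
    finally show ?thesis by (simp add: nf)
  qed
  \<comment> \<open>By extremality N is the norm of the functional represented by c k, and \<gamma>
    is its real part at G.\<close>
  define N where "N = c * Re (disc_pairing \<alpha> F k)"
  define \<gamma> where "\<gamma> = c * Re (disc_pairing \<alpha> G k)"
  have \<gamma>: "1 - d \<le> \<gamma>" using close[OF G nG] by (simp add: \<gamma>_def Gh)
  have N1: "N \<le> 1 + d"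
  proof -
    have "Re (disc_pairing \<alpha> F h) \<le> cmod (disc_pairing \<alpha> F h)" by (rule complex_Re_le_cmod)
    also have "\<dots> \<le> 1" using disc_pairing_Hoelder[OF pq FL h] by (simp add: nF nh)
    finally show ?thesis using close[OF F nF] by (simp add: N_def)
  qed
  have N\<gamma>: "\<gamma> \<le> N" using ext[OF G nG] assms(7) by (simp add: N_def \<gamma>_def)

  \<comment> \<open>Midpoint and half-difference: u + v = F and u - v = G have norm 1, as the
    uniform convexity lemmas require.\<close>
  define u where "u z = (F z + G z) / 2" for z
  define v where "v z = (F z - G z) / 2" for z
  have u: "u \<in> bergman_space p \<alpha>"
    using bergman_space_lincomb[OF F G p0(2), of "1/2" "1/2"] by (simp add: u_def[abs_def] add_divide_distrib)
  note uL = bergman_space_weighted_Lp[OF u]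
  have v: "v \<in> weighted_Lp p \<alpha>"
    using bergman_space_weighted_Lp[OF bergman_space_lincomb[OF F G p0(2), of "1/2" "-1/2"]]
    by (simp add: v_def[abs_def] diff_divide_distrib)
  have nadd: "weighted_norm p \<alpha> (\<lambda>z. u z + v z) = 1"
    using nF by (simp add: u_def v_def add_divide_distrib[symmetric])
  have ndiff: "weighted_norm p \<alpha> (\<lambda>z. u z - v z) = 1"
    using nG by (simp add: u_def v_def diff_divide_distrib[symmetric])
  have nFG: "weighted_norm p \<alpha> (\<lambda>z. F z - G z) = 2 * weighted_norm p \<alpha> v"
  proof -
    have "F z - G z = 2 * v z" for z by (simp add: v_def)
    then show ?thesis by (simp add: weighted_norm_cmult[OF p0(1)])
  qed

  define M where "M = weighted_norm p \<alpha> u"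
  have uk: "c * Re (disc_pairing \<alpha> u k) = (N + \<gamma>) / 2"
  proof -
    have "disc_pairing \<alpha> u k = (\<integral>z. (1/2) * (F z * cnj (k z)) + (1/2) * (G z * cnj (k z)) \<partial>disc_measure \<alpha>)"
      unfolding disc_pairing_def by (intro disc_integral_cong) (simp add: u_def field_simps)
    also have "\<dots> = (1/2) * disc_pairing \<alpha> F k + (1/2) * disc_pairing \<alpha> G k"
      using integrable_mult_cnj[OF FL kL pq] integrable_mult_cnj[OF GL kL pq] by (simp add: disc_pairing_def)
    finally show ?thesis by (simp add: N_def \<gamma>_def algebra_simps)
  qed
  \<comment> \<open>If the midpoint had norm 0, the functional would vanish there; but its value (N
    + \<gamma>) / 2 is at least 1 - d > 0. Positivity permits normalising u below.\<close>
  have M0: "0 < M"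
  proof (rule ccontr)
    assume "\<not> 0 < M"
    then have "M = 0" using weighted_norm_nonneg[of p \<alpha> u] by (simp add: M_def)
    then have "disc_pairing \<alpha> u k = 0"
      using disc_pairing_Hoelder[OF pq uL kL] by (simp add: M_def)
    then show False using uk \<gamma> N\<gamma> d by simp
  qed
  have "(N + \<gamma>) / 2 \<le> M * N"
  proof -
    define w where "w z = of_real (1 / M) * u z" for z
    have w: "w \<in> bergman_space p \<alpha>"
      using bergman_space_lincomb[OF u u p0(2), of "of_real (1 / M)" 0] by (simp add: w_def[abs_def])
    have "weighted_norm p \<alpha> w = 1"
      using weighted_norm_cmult[OF p0(1), of \<alpha> "of_real (1 / M)" u] M0 by (simp add: w_def[abs_def] norm_divide M_def)
    from ext[OF w this] have le: "Re (disc_pairing \<alpha> w k) \<le> Re (disc_pairing \<alpha> F k)" .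
    have "disc_pairing \<alpha> w k = of_real (1 / M) * disc_pairing \<alpha> u k"
      unfolding disc_pairing_def w_def by (simp only: mult.assoc integral_mult_right_zero)
    then have "Re (disc_pairing \<alpha> w k) = Re (disc_pairing \<alpha> u k) / M" by simp
    then have "Re (disc_pairing \<alpha> u k) \<le> M * Re (disc_pairing \<alpha> F k)"
      using mult_left_mono[OF le, of M] M0 by simp
    then have "c * Re (disc_pairing \<alpha> u k) \<le> c * (M * Re (disc_pairing \<alpha> F k))"
      using assms(7) by (intro mult_left_mono) auto
    then show ?thesis unfolding uk by (simp add: N_def mult_ac)
  qed
  \<comment> \<open>Dividing by N: M \<ge> 1/2 + \<gamma> / (2 N) \<ge> 1/2 + (1 - d) / (2 (1 + d)),
    and the last expression is 1 / (1 + d).\<close>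
  then have M: "1 / (1 + d) \<le> M"
  proof -
    assume le: "(N + \<gamma>) / 2 \<le> M * N"
    have N0: "0 < N" using \<gamma> N\<gamma> d by simp
    have "(1 - d) * N \<le> \<gamma> * (1 + d)"
    proof -
      have "(1 - d) * N \<le> (1 - d) * (1 + d)" using d N1 by (intro mult_left_mono) auto
      also have "\<dots> \<le> \<gamma> * (1 + d)" using d \<gamma> by (intro mult_right_mono) auto
      finally show ?thesis .
    qed
    then have "2 * N \<le> (N + \<gamma>) * (1 + d)" by (simp add: algebra_simps)
    also have "\<dots> \<le> (2 * (M * N)) * (1 + d)" using le d by (intro mult_right_mono) auto
    finally have "N * 1 \<le> N * (M * (1 + d))" by (simp add: algebra_simps)
    then have "1 \<le> M * (1 + d)" using N0 by (subst (asm) mult_le_cancel_left_pos) auto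
    then show ?thesis using d by (simp add: field_simps)
  qed
  \<comment> \<open>Bernoulli's inequality for (1 + d)^(-s), from exp x \<ge> 1 + x and ln (1 + d)
    \<le> d. It is used for s = p and for s = 2.\<close>
  have Mp: "1 - s * d \<le> M powr s" if s: "0 < s" for s
  proof -
    have "1 + (- s * ln (1 + d)) \<le> exp (- s * ln (1 + d))" by (rule exp_ge_add_one_self)
    moreover have "s * ln (1 + d) \<le> s * d" using s d by (intro mult_left_mono ln_add_one_self_le_self) auto
    moreover have "exp (- s * ln (1 + d)) = (1 / (1 + d)) powr s"
      using d by (simp add: powr_def ln_div)
    moreover have "(1 / (1 + d)) powr s \<le> M powr s" using M d s by (intro powr_mono2) auto
    ultimately show ?thesis by simp
  qed
  define V where "V = weighted_norm p \<alpha> v"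
  have V0: "0 \<le> V" by (simp add: V_def)
  show ?thesis
  proof (intro conjI impI)
    assume p2: "2 < p"
    \<comment> \<open>Clarkson gives V^p \<le> 1 - M^p, and \<open>Mp\<close> with s = p bounds the
      right side.\<close>
    have "V powr p \<le> p * d"
      using clarkson[OF less_imp_le[OF p2] uL v nadd ndiff] Mp[OF p0(1)] by (simp add: V_def M_def)
    also have "\<dots> < p * \<delta>" using p d by simp
    finally have "(V powr p) powr (1 / p) < (p * \<delta>) powr (1 / p)"
      using p by (intro powr_less_mono2) auto
    then have "V < p powr (1 / p) * \<delta> powr (1 / p)"
      using p V0 assms(10) by (simp add: powr_powr powr_mult)
    then show "weighted_norm p \<alpha> (\<lambda>z. F z - G z) < 2 * p powr (1 / p) * \<delta> powr (1 / p)"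
      by (simp add: nFG V_def)
  next
    assume p2: "p < 2"
    have "M\<^sup>2 + (p - 1) * V\<^sup>2 \<le> 1"
      using two_uniform_convexity[OF p p2 uL v nadd ndiff] by (simp add: V_def M_def)
    moreover have "1 - 2 * d \<le> M\<^sup>2" using Mp[of 2] M0 by simp
    ultimately have "(p - 1) * V\<^sup>2 \<le> 2 * d" by simp
    also have "\<dots> < 2 * \<delta>" using d by simp
    finally have "V\<^sup>2 < 2 * \<delta> / (p - 1)" using p by (simp add: field_simps)
    then have "V < sqrt (2 * \<delta> / (p - 1))" by (rule real_less_rsqrt)
    also have "\<dots> = sqrt 2 * (p - 1) powr (- (1 / 2)) * \<delta> powr (1 / 2)"
    proof -
      have "(p - 1) powr (- (1 / 2)) = 1 / sqrt (p - 1)"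
        using p by (simp add: powr_minus_divide powr_half_sqrt)
      moreover have "\<delta> powr (1 / 2) = sqrt \<delta>"
        using assms(10) by (simp add: powr_half_sqrt)
      ultimately show ?thesis by (simp add: real_sqrt_divide real_sqrt_mult)
    qed
    finally show "weighted_norm p \<alpha> (\<lambda>z. F z - G z) < 2 * sqrt 2 * (p - 1) powr (- (1 / 2)) * \<delta> powr (1 / 2)"
      by (simp add: nFG V_def)
  qed
qed

end
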